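(* Let $u(y)=\sum_{n=1}^{\infty}a_n\sin(3^ny)$, where $a_n\in\mathbb{R}$, $3^{-n\alpha}\le|a_n|\le C_03^{-n\alpha}$ for all $n\ge1$ for some constants $\alpha\in(0,1)$, $C_0>1$, and $1\le|a_n|/|a_{n+1}|\le 3$ for all $n\ge 1$. Then there exist positive constants $\varepsilon,C$ (independent of $\nu$, $k$, $t$) such that for every $\nu>0$ and every integer $k\neq0$ satisfying $\nu|k|^{-1}\le1/2$, $$\|S_\nu(t)P_k\|_{L^2\to L^2}\le Ce^{-\varepsilon\widetilde{\lambda}_{\nu,k}t},\qquad \|R_\nu(t)P_k\|_{L^2\to L^2}\le Ce^{-\varepsilon\widetilde{\lambda}_{\nu,k}t},\qquad\forall\,t\ge0,$$ where $\widetilde{\lambda}_{\nu,k}=\nu^{\frac{\alpha}{\alpha+2}}|k|^{\frac{2}{\alpha+2}}$.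
   Context: $\mathbb{T}=\mathbb{R}/2\pi\mathbb{Z}$; functions on $\mathbb{T}$ are identified with $2\pi$-periodic functions on $\mathbb{R}$. For $\nu>0$, $S_\nu(t):L^2(\mathbb{T}^2)\to L^2(\mathbb{T}^2)$, $t\ge0$, is the linear evolution semigroup generated by the drift-diffusion equation $\partial_tf-\nu\Delta f+u(y)\partial_xf=0$, $(x,y)\in\mathbb{T}^2$, $t>0$ (so $S_\nu(t)f_0$ is the solution at time $t$ with initial datum $f_0$), and $R_\nu(t):L^2(\mathbb{T}^2)\to L^2(\mathbb{T}^2)$ is the semigroup generated by $\partial_tf-\nu\partial_y^2f+u(y)\partial_xf=0$. $P_k$ denotes the projection onto the $k$-th Fourier mode in $x$. On the $k$-th mode, $S_\nu(t)P_k$ and $R_\nu(t)P_k$ correspond to the semigroups $e^{-tL_{k,\nu}}$ and $e^{-tR_{k,\nu}}$ on $L^2(\mathbb{T})$ (in $y$), with $L_{k,\nu}=iku-\nu(\partial_y^2-|k|^2)$ and $R_{k,\nu}=iku-\nu\partial_y^2$, both with domain $H^2(\mathbb{T})$. *)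

theory Defs
  imports "HOL-Analysis.Analysis"
begin

text \<open>
  Functions on the two-torus are doubly \<open>2\<pi>\<close>-periodic functions on the plane, and elements of
  \<open>L\<^sup>2\<close> are represented by functions; identities between elements of \<open>L\<^sup>2\<close> are therefore stated
  almost everywhere. Borel measurability of the representatives costs no generality, since every
  class has a Borel representative.
\<close>

definition doubly_periodic :: "(real \<times> real \<Rightarrow> complex) \<Rightarrow> bool" where
  "doubly_periodic f \<longleftrightarrow>
     (\<forall>x y. f (x + 2 * pi, y) = f (x, y) \<and> f (x, y + 2 * pi) = f (x, y))"

definition torus_cell :: "(real \<times> real) set" where
  "torus_cell = {0..2 * pi} \<times> {0..2 * pi}"

definition L2_torus :: "(real \<times> real \<Rightarrow> complex) set" where
  "L2_torus = {f. f \<in> borel_measurable borel \<and> doubly_periodic f \<and>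
                  set_integrable lborel torus_cell (\<lambda>z. (cmod (f z))\<^sup>2)}"

definition L2_norm :: "(real \<times> real \<Rightarrow> complex) \<Rightarrow> real" where
  "L2_norm f = sqrt (LINT z:torus_cell|lborel. (cmod (f z))\<^sup>2)"

text \<open>
  The operator norm takes values in \<open>ennreal\<close>, so that an unbounded operator has norm \<open>\<infinity>\<close>. It is
  meaningful only for maps from \<open>L2_torus\<close> to \<open>L2_torus\<close>, because \<open>L2_norm\<close> is \<open>0\<close> on functions
  that are not square integrable.
\<close>

definition L2_opnorm ::
  "((real \<times> real \<Rightarrow> complex) \<Rightarrow> (real \<times> real \<Rightarrow> complex)) \<Rightarrow> ennreal" where
  "L2_opnorm T = (SUP f\<in>{f \<in> L2_torus. L2_norm f \<le> 1}. ennreal (L2_norm (T f)))"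

definition x_mode_proj ::
  "int \<Rightarrow> (real \<times> real \<Rightarrow> complex) \<Rightarrow> (real \<times> real \<Rightarrow> complex)" where
  "x_mode_proj k f = (\<lambda>(x, y).
     cis (of_int k * x) *
       (LINT s:{0..2 * pi}|lborel. f (s, y) * cis (- (of_int k * s))) / (2 * pi))"

definition C0_semigroup ::
  "(real \<Rightarrow> (real \<times> real \<Rightarrow> complex) \<Rightarrow> (real \<times> real \<Rightarrow> complex)) \<Rightarrow> bool" where
  "C0_semigroup S \<longleftrightarrow>
     (\<forall>t\<ge>0. \<forall>f\<in>L2_torus. S t f \<in> L2_torus) \<and>
     (\<forall>t\<ge>0. \<forall>f\<in>L2_torus. \<forall>g\<in>L2_torus. \<forall>c.
        AE z in lborel. S t (\<lambda>w. c * f w + g w) z = c * S t f z + S t g z) \<and>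
     (\<forall>t\<ge>0. \<exists>M. \<forall>f\<in>L2_torus. L2_norm (S t f) \<le> M * L2_norm f) \<and>
     (\<forall>f\<in>L2_torus. AE z in lborel. S 0 f z = f z) \<and>
     (\<forall>s\<ge>0. \<forall>t\<ge>0. \<forall>f\<in>L2_torus. AE z in lborel. S (s + t) f z = S s (S t f) z) \<and>
     (\<forall>f\<in>L2_torus. ((\<lambda>h. L2_norm (\<lambda>z. S h f z - f z)) \<longlongrightarrow> 0) (at_right 0))"

text \<open>
  An unbounded operator is given by its graph \<open>A\<close>: \<open>A f g\<close> means that \<open>f\<close> is in the domain and is
  mapped to \<open>g\<close>. The equivalence below says that the generator of \<open>S\<close> has exactly this graph,
  domain included.
\<close>

definition generated_by ::
  "(real \<Rightarrow> (real \<times> real \<Rightarrow> complex) \<Rightarrow> (real \<times> real \<Rightarrow> complex)) \<Rightarrow>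
   ((real \<times> real \<Rightarrow> complex) \<Rightarrow> (real \<times> real \<Rightarrow> complex) \<Rightarrow> bool) \<Rightarrow> bool" where
  "generated_by S A \<longleftrightarrow> C0_semigroup S \<and>
     (\<forall>f\<in>L2_torus. \<forall>g\<in>L2_torus.
        ((\<lambda>h. L2_norm (\<lambda>z. (S h f z - f z) / of_real h - g z)) \<longlongrightarrow> 0) (at_right 0)
        \<longleftrightarrow> A f g)"

text \<open>
  \<open>D i j\<close> is the partial derivative of \<open>D 0 0\<close> of order \<open>i\<close> in \<open>x\<close> and \<open>j\<close> in \<open>y\<close>; a function is
  smooth iff it is \<open>D 0 0\<close> for some such family.
\<close>

definition smooth_family :: "(nat \<Rightarrow> nat \<Rightarrow> real \<times> real \<Rightarrow> complex) \<Rightarrow> bool" where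
  "smooth_family D \<longleftrightarrow> (\<forall>i j. continuous_on UNIV (D i j) \<and>
     (\<forall>x y. ((\<lambda>s. D i j (s, y)) has_vector_derivative D (Suc i) j (x, y)) (at x) \<and>
            ((\<lambda>s. D i j (x, s)) has_vector_derivative D i (Suc j) (x, y)) (at y)))"

text \<open>
  The graph of \<open>\<nu>\<^sub>x \<partial>\<^sub>x\<^sup>2 + \<nu>\<^sub>y \<partial>\<^sub>y\<^sup>2 - u(y) \<partial>\<^sub>x\<close> with its maximal domain in \<open>L\<^sup>2\<close>:
  the operator is applied in the sense of distributions on the torus and the result is required to
  be the \<open>L\<^sup>2\<close> function \<open>g\<close>. The sign of the drift flips on the test function because \<open>u\<close> does not
  depend on \<open>x\<close>. On the \<open>k\<close>-th mode in \<open>x\<close> this is \<open>\<nu>\<^sub>y \<partial>\<^sub>y\<^sup>2 - \<nu>\<^sub>x k\<^sup>2 - \<i> k u\<close> with domain \<open>H\<^sup>2\<close>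
  (for \<open>\<nu>\<^sub>y > 0\<close> and \<open>u\<close> bounded).
\<close>

definition drift_diffusion_op ::
  "real \<Rightarrow> real \<Rightarrow> (real \<Rightarrow> real) \<Rightarrow>
   (real \<times> real \<Rightarrow> complex) \<Rightarrow> (real \<times> real \<Rightarrow> complex) \<Rightarrow> bool" where
  "drift_diffusion_op \<nu>x \<nu>y u f g \<longleftrightarrow>
     (\<forall>D. smooth_family D \<and> doubly_periodic (D 0 0) \<longrightarrow>
        (LINT z:torus_cell|lborel. g z * D 0 0 z) =
        (LINT z:torus_cell|lborel. f z *
           (of_real \<nu>x * D 2 0 z + of_real \<nu>y * D 0 2 z + of_real (u (snd z)) * D 1 0 z)))"

definition is_S_semigroup ::
  "(real \<Rightarrow> real) \<Rightarrow> real \<Rightarrow>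
   (real \<Rightarrow> (real \<times> real \<Rightarrow> complex) \<Rightarrow> (real \<times> real \<Rightarrow> complex)) \<Rightarrow> bool" where
  "is_S_semigroup u \<nu> S \<longleftrightarrow> generated_by S (drift_diffusion_op \<nu> \<nu> u)"

definition is_R_semigroup ::
  "(real \<Rightarrow> real) \<Rightarrow> real \<Rightarrow>
   (real \<Rightarrow> (real \<times> real \<Rightarrow> complex) \<Rightarrow> (real \<times> real \<Rightarrow> complex)) \<Rightarrow> bool" where
  "is_R_semigroup u \<nu> R \<longleftrightarrow> generated_by R (drift_diffusion_op 0 \<nu> u)"

definition decay_rate :: "real \<Rightarrow> real \<Rightarrow> int \<Rightarrow> real" where
  "decay_rate \<alpha> \<nu> k = \<nu> powr (\<alpha> / (\<alpha> + 2)) * \<bar>of_int k\<bar> powr (2 / (\<alpha> + 2))"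

end

(* Write c_j for the y-Fourier coefficients of the k-th mode. On them the shear acts by
   c_j |-> -(k/2) * sum_n a_n (c_(j-3^n) - c_(j+3^n)). For N = 3^m the functional
   |c|^2 + tau * Re sum_j w_j c_j cnj(c_(j+N)), where w_j is the ramp clamped from 0 at j = -N to 1 at
   j = 0, has a drift derivative whose main part is a multiple of a_m |c|^2: it comes from the
   frequency n = m, because w_j - w_(j-N) is close to 1 for small j. Every other frequency produces
   correlations sum_j c_j cnj(c_(j+L)) with L ~ max(N, 3^n), which are at most
   2 |c| |j c| / |L| and are absorbed by the dissipation nu |j c|^2. Choosing
   N^(alpha+2) ~ |k| / nu balances the terms and gives decay at the rate nu N^2. *)
theory Submission
  imports Defs
begin

section \<open>Square integrable functions on a measure space\<close>

text \<open>Shifts commute, so with a constant weight \<open>w\<close> the drift derivative of the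
  correlation term would vanish; a varying weight is what makes the shear visible. The bounds on
  |a_m| leave the sign of k a_m free, hence \<open>\<tau>\<close> carries that sign. The factor 3
  between frequencies keeps |N - 3^n| comparable to the larger of the two, and the contributions of
  the lower frequencies sum geometrically with ratio 3 powr (\<alpha> - 1), which is where \<alpha>
  < 1 enters. Outside the estimate, the obstacle is that the semigroups are known only through their
  generators and through almost-everywhere identities: continuity of orbits on the whole half-line,
  invariance of the domain and confinement to one mode all have to be derived. Trigonometric
  polynomials lie in the domain because u is multiplied, never differentiated. The estimate is run
  for them with right derivatives, and density together with boundedness of each single operator
  reaches all data. Confinement to the mode k comes from the same functional with
  \<open>\<tau>\<close> = 0, applied to the other modes.\<close>

definition sqi :: "'a measure \<Rightarrow> ('a \<Rightarrow> complex) \<Rightarrow> bool" where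
  "sqi M f \<longleftrightarrow> f \<in> borel_measurable M \<and> integrable M (\<lambda>x. (cmod (f x))\<^sup>2)"

text \<open>One pair of notions serves every space of the proof: the counting measure on the
  integers, an interval and the torus cell. The value means something only together with
  \<open>sqi\<close>, since the integral of a non-integrable function is 0.\<close>

definition l2n :: "'a measure \<Rightarrow> ('a \<Rightarrow> complex) \<Rightarrow> real" where
  "l2n M f = sqrt (\<integral>x. (cmod (f x))\<^sup>2 \<partial>M)"

lemma l2n_nonneg [simp]: "0 \<le> l2n M f"
  by (simp add: l2n_def)

lemma l2n_power2: "(l2n M f)\<^sup>2 = (\<integral>x. (cmod (f x))\<^sup>2 \<partial>M)"
  by (simp add: l2n_def)

lemma sqi_measurable [measurable_dest]: "sqi M f \<Longrightarrow> f \<in> borel_measurable M"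
  by (simp add: sqi_def)

lemma sqi_integrable: "sqi M f \<Longrightarrow> integrable M (\<lambda>x. (cmod (f x))\<^sup>2)"
  by (simp add: sqi_def)

lemma sqi_bound:
  assumes "sqi M g" and [measurable]: "f \<in> borel_measurable M"
    and "AE x in M. cmod (f x) \<le> B * cmod (g x)"
  shows "sqi M f"
proof -
  have "integrable M (\<lambda>x. (cmod (f x))\<^sup>2)"
  proof (rule Bochner_Integration.integrable_bound)
    show "integrable M (\<lambda>x. B\<^sup>2 * (cmod (g x))\<^sup>2)"
      using sqi_integrable[OF assms(1)] by simp
    show "AE x in M. norm ((cmod (f x))\<^sup>2) \<le> norm (B\<^sup>2 * (cmod (g x))\<^sup>2)"
      using assms(3)
    proof eventually_elim
      case (elim x)
      then have "(cmod (f x))\<^sup>2 \<le> (B * cmod (g x))\<^sup>2"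
        by (intro power_mono) auto
      then show ?case by (simp add: power_mult_distrib)
    qed
  qed measurable
  then show ?thesis by (simp add: sqi_def)
qed

lemma sqi_cmult: "sqi M f \<Longrightarrow> sqi M (\<lambda>x. c * f x)"
  by (rule sqi_bound[of M f _ "cmod c"]) (auto simp: norm_mult)

lemma sqi_mult_bounded:
  assumes "sqi M f" "w \<in> borel_measurable M" "\<And>x. x \<in> space M \<Longrightarrow> cmod (w x) \<le> B"
  shows "sqi M (\<lambda>x. w x * f x)"
  by (rule sqi_bound[OF assms(1), of _ B])
     (use assms in \<open>auto simp: norm_mult intro!: mult_right_mono AE_I2 dest: sqi_measurable\<close>)

lemma sqi_zero [simp]: "sqi M (\<lambda>x. 0)"
  by (simp add: sqi_def)

lemma sqi_add:
  assumes f: "sqi M f" and g: "sqi M g"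
  shows "sqi M (\<lambda>x. f x + g x)"
proof -
  note [measurable] = sqi_measurable[OF f] sqi_measurable[OF g]
  have "integrable M (\<lambda>x. (cmod (f x + g x))\<^sup>2)"
  proof (rule Bochner_Integration.integrable_bound)
    show "integrable M (\<lambda>x. 2 * (cmod (f x))\<^sup>2 + 2 * (cmod (g x))\<^sup>2)"
      using f g by (simp add: sqi_integrable)
    have "(cmod (f x + g x))\<^sup>2 \<le> 2 * (cmod (f x))\<^sup>2 + 2 * (cmod (g x))\<^sup>2" for x
    proof -
      have "(cmod (f x + g x))\<^sup>2 \<le> (cmod (f x) + cmod (g x))\<^sup>2"
        by (intro power_mono norm_triangle_ineq) auto
      also have "\<dots> \<le> 2 * (cmod (f x))\<^sup>2 + 2 * (cmod (g x))\<^sup>2"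
        using sum_squares_bound[of "cmod (f x)" "cmod (g x)"] by (simp add: power2_sum)
      finally show ?thesis .
    qed
    then show "AE x in M. norm ((cmod (f x + g x))\<^sup>2) \<le> norm (2 * (cmod (f x))\<^sup>2 + 2 * (cmod (g x))\<^sup>2)"
      by auto
  qed measurable
  then show ?thesis by (simp add: sqi_def)
qed

lemma sqi_uminus: "sqi M f \<Longrightarrow> sqi M (\<lambda>x. - f x)"
  using sqi_cmult[of M f "-1"] by simp

lemma sqi_diff: "sqi M f \<Longrightarrow> sqi M g \<Longrightarrow> sqi M (\<lambda>x. f x - g x)"
  using sqi_add[of M f "\<lambda>x. - g x"] sqi_uminus[of M g] by simp

lemma sqi_divide: "sqi M f \<Longrightarrow> sqi M (\<lambda>x. f x / c)"
  using sqi_cmult[of M f "inverse c"] by (simp add: field_simps)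

lemma sqi_sum: "(\<And>i. i \<in> I \<Longrightarrow> sqi M (f i)) \<Longrightarrow> sqi M (\<lambda>x. \<Sum>i\<in>I. f i x)"
  by (induction I rule: infinite_finite_induct) (auto intro: sqi_add)

lemma sqi_cnj: "sqi M f \<Longrightarrow> sqi M (\<lambda>x. cnj (f x))"
  by (auto simp: sqi_def intro: borel_measurable_continuous_onI[THEN measurable_compose[rotated]] continuous_intros)

lemma cmod_mult_le_squares: "2 * (cmod a * cmod b) \<le> (cmod a)\<^sup>2 + (cmod b)\<^sup>2"
  using sum_squares_bound[of "cmod a" "cmod b"] by (simp add: mult.assoc)

lemma sqi_integrable_cmod_mult:
  assumes f: "sqi M f" and g: "sqi M g"
  shows "integrable M (\<lambda>x. cmod (f x) * cmod (g x))"
proof -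
  note [measurable] = sqi_measurable[OF f] sqi_measurable[OF g]
  show ?thesis
  proof (rule Bochner_Integration.integrable_bound)
    show "integrable M (\<lambda>x. (cmod (f x))\<^sup>2 + (cmod (g x))\<^sup>2)"
      using f g by (simp add: sqi_integrable)
    show "AE x in M. norm (cmod (f x) * cmod (g x)) \<le> norm ((cmod (f x))\<^sup>2 + (cmod (g x))\<^sup>2)"
    proof (intro AE_I2)
      fix x
      have "0 \<le> cmod (f x) * cmod (g x)" by simp
      then show "norm (cmod (f x) * cmod (g x)) \<le> norm ((cmod (f x))\<^sup>2 + (cmod (g x))\<^sup>2)"
        using cmod_mult_le_squares[of "f x" "g x"] by (simp only: real_norm_def abs_of_nonneg)
    qed
  qed measurable
qed

lemma sqi_integrable_mult:
  assumes f: "sqi M f" and g: "sqi M g"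
  shows "integrable M (\<lambda>x. f x * g x)"
proof -
  note [measurable] = sqi_measurable[OF f] sqi_measurable[OF g]
  show ?thesis
    by (rule Bochner_Integration.integrable_bound[OF sqi_integrable_cmod_mult[OF f g]])
       (auto simp: norm_mult)
qed

text \<open>Integrate 2ab <= s a^2 + b^2 / s pointwise, with the optimal ratio B / A regularised by
  \<open>d\<close> so that vanishing norms need no separate case. The resulting loss d (A + B) / 2
  is at most e by the choice of \<open>d\<close>.\<close>

lemma l2n_Cauchy_Schwarz:
  assumes f: "sqi M f" and g: "sqi M g"
  shows "(\<integral>x. cmod (f x) * cmod (g x) \<partial>M) \<le> l2n M f * l2n M g"
proof (rule field_le_epsilon)
  fix e :: real assume e: "e > 0"
  define A where "A = l2n M f"
  define B where "B = l2n M g"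
  have AB: "A \<ge> 0" "B \<ge> 0" by (auto simp: A_def B_def)
  define d where "d = 2 * e / (A + B + 1)"
  have d: "d > 0" "d * (A + B) \<le> 2 * e"
    using e AB by (auto simp: d_def field_simps add_pos_nonneg)
  define s where "s = (B + d) / (A + d)"
  have s: "s > 0" using d AB by (simp add: s_def add_nonneg_pos)
  have "(\<integral>x. cmod (f x) * cmod (g x) \<partial>M) \<le> (\<integral>x. s / 2 * (cmod (f x))\<^sup>2 + inverse s / 2 * (cmod (g x))\<^sup>2 \<partial>M)"
  proof (rule integral_mono)
    show "integrable M (\<lambda>x. cmod (f x) * cmod (g x))"
      by (rule sqi_integrable_cmod_mult[OF f g])
    show "integrable M (\<lambda>x. s / 2 * (cmod (f x))\<^sup>2 + inverse s / 2 * (cmod (g x))\<^sup>2)"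
      using f g by (simp add: sqi_integrable)
    fix x
    have "0 \<le> (s * cmod (f x) - cmod (g x))\<^sup>2" by simp
    then have "2 * s * (cmod (f x) * cmod (g x)) \<le> s * s * (cmod (f x))\<^sup>2 + (cmod (g x))\<^sup>2"
      by (simp add: power2_eq_square algebra_simps)
    then show "cmod (f x) * cmod (g x) \<le> s / 2 * (cmod (f x))\<^sup>2 + inverse s / 2 * (cmod (g x))\<^sup>2"
      using s by (simp add: field_simps)
  qed
  also have "\<dots> = s / 2 * A\<^sup>2 + inverse s / 2 * B\<^sup>2"
    using f g by (simp add: sqi_integrable A_def B_def l2n_power2)
  also have "\<dots> \<le> (B + d) * A / 2 + (A + d) * B / 2"
  proof (rule add_mono)
    have *: "x\<^sup>2 / (x + d) \<le> x" if "x \<ge> 0" for x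
      using that d by (simp add: field_simps power2_eq_square add_nonneg_pos)
    have "s / 2 * A\<^sup>2 = (B + d) / 2 * (A\<^sup>2 / (A + d))" by (simp add: s_def)
    also have "\<dots> \<le> (B + d) / 2 * A"
      using *[of A] AB d by (intro mult_left_mono) auto
    finally show "s / 2 * A\<^sup>2 \<le> (B + d) * A / 2" by (simp add: field_simps)
    have "inverse s / 2 * B\<^sup>2 = (A + d) / 2 * (B\<^sup>2 / (B + d))" by (simp add: s_def)
    also have "\<dots> \<le> (A + d) / 2 * B"
      using *[of B] AB d by (intro mult_left_mono) auto
    finally show "inverse s / 2 * B\<^sup>2 \<le> (A + d) * B / 2" by (simp add: field_simps)
  qed
  also have "\<dots> \<le> A * B + e"
    using d by (simp add: field_simps)
  finally show "(\<integral>x. cmod (f x) * cmod (g x) \<partial>M) \<le> l2n M f * l2n M g + e"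
    by (simp add: A_def B_def)
qed

lemma l2n_integral_mult_le:
  assumes f: "sqi M f" and g: "sqi M g"
  shows "cmod (\<integral>x. f x * g x \<partial>M) \<le> l2n M f * l2n M g"
proof -
  have "cmod (\<integral>x. f x * g x \<partial>M) \<le> (\<integral>x. cmod (f x * g x) \<partial>M)"
    by (rule integral_norm_bound)
  also have "\<dots> \<le> l2n M f * l2n M g"
    using l2n_Cauchy_Schwarz[OF f g] by (simp add: norm_mult)
  finally show ?thesis .
qed

lemma l2n_mono:
  assumes "sqi M g" "f \<in> borel_measurable M"
    and "AE x in M. cmod (f x) \<le> cmod (g x)"
  shows "l2n M f \<le> l2n M g"
  unfolding l2n_def
proof (intro real_sqrt_le_mono integral_mono_AE)
  have "sqi M f" using sqi_bound[of M g f 1] assms by simp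
  then show "integrable M (\<lambda>x. (cmod (f x))\<^sup>2)" by (rule sqi_integrable)
  show "integrable M (\<lambda>x. (cmod (g x))\<^sup>2)" using assms(1) by (rule sqi_integrable)
  show "AE x in M. (cmod (f x))\<^sup>2 \<le> (cmod (g x))\<^sup>2"
    using assms(3) by eventually_elim (auto intro: power_mono)
qed

lemma l2n_zero [simp]: "l2n M (\<lambda>x. 0) = 0"
  by (simp add: l2n_def)

lemma l2n_cong_AE:
  assumes "f \<in> borel_measurable M" "g \<in> borel_measurable M" "AE x in M. f x = g x"
  shows "l2n M f = l2n M g"
  unfolding l2n_def
  by (intro arg_cong[of _ _ sqrt] integral_cong_AE) (use assms in auto)

lemma l2n_cmult: "l2n M (\<lambda>x. c * f x) = cmod c * l2n M f"
  by (simp add: l2n_def norm_mult power_mult_distrib real_sqrt_mult)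

lemma l2n_uminus [simp]: "l2n M (\<lambda>x. - f x) = l2n M f"
  by (simp add: l2n_def)

lemma l2n_minus_commute: "l2n M (\<lambda>x. f x - g x) = l2n M (\<lambda>x. g x - f x)"
  by (simp add: l2n_def norm_minus_commute)

lemma l2n_triangle:
  assumes f: "sqi M f" and g: "sqi M g"
  shows "l2n M (\<lambda>x. f x + g x) \<le> l2n M f + l2n M g"
proof (rule power2_le_imp_le)
  have "(l2n M (\<lambda>x. f x + g x))\<^sup>2 = (\<integral>x. (cmod (f x + g x))\<^sup>2 \<partial>M)"
    by (rule l2n_power2)
  also have "\<dots> \<le> (\<integral>x. (cmod (f x))\<^sup>2 + (cmod (g x))\<^sup>2 + 2 * (cmod (f x) * cmod (g x)) \<partial>M)"
  proof (rule integral_mono)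
    show "integrable M (\<lambda>x. (cmod (f x + g x))\<^sup>2)"
      by (rule sqi_integrable[OF sqi_add[OF f g]])
    show "integrable M (\<lambda>x. (cmod (f x))\<^sup>2 + (cmod (g x))\<^sup>2 + 2 * (cmod (f x) * cmod (g x)))"
      using f g by (simp add: sqi_integrable sqi_integrable_cmod_mult)
    fix x
    have "(cmod (f x + g x))\<^sup>2 \<le> (cmod (f x) + cmod (g x))\<^sup>2"
      by (intro power_mono norm_triangle_ineq) auto
    then show "(cmod (f x + g x))\<^sup>2 \<le> (cmod (f x))\<^sup>2 + (cmod (g x))\<^sup>2 + 2 * (cmod (f x) * cmod (g x))"
      by (simp add: power2_sum mult.assoc)
  qed
  also have "\<dots> = (l2n M f)\<^sup>2 + (l2n M g)\<^sup>2 + 2 * (\<integral>x. cmod (f x) * cmod (g x) \<partial>M)"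
    using f g by (simp add: sqi_integrable sqi_integrable_cmod_mult l2n_power2)
  also have "\<dots> \<le> (l2n M f + l2n M g)\<^sup>2"
    using l2n_Cauchy_Schwarz[OF f g] by (simp add: power2_sum)
  finally show "(l2n M (\<lambda>x. f x + g x))\<^sup>2 \<le> (l2n M f + l2n M g)\<^sup>2" .
qed simp

lemma l2n_diff_triangle:
  assumes "sqi M f" "sqi M g" "sqi M h"
  shows "l2n M (\<lambda>x. f x - h x) \<le> l2n M (\<lambda>x. f x - g x) + l2n M (\<lambda>x. g x - h x)"
  using l2n_triangle[OF sqi_diff[OF assms(1,2)] sqi_diff[OF assms(2,3)]] by simp

lemma l2n_le_add_diff:
  assumes "sqi M f" "sqi M g"
  shows "l2n M f \<le> l2n M g + l2n M (\<lambda>x. f x - g x)"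
  using l2n_triangle[OF assms(2) sqi_diff[OF assms]] by simp

lemma l2n_tendsto_dominated:
  assumes [measurable]: "\<And>n. F n \<in> borel_measurable M" "f \<in> borel_measurable M"
    and w: "integrable M w"
    and lim: "AE x in M. (\<lambda>n. F n x) \<longlonglongrightarrow> f x"
    and bd: "\<And>n. AE x in M. (cmod (F n x - f x))\<^sup>2 \<le> w x"
  shows "(\<lambda>n. l2n M (\<lambda>x. F n x - f x)) \<longlonglongrightarrow> 0"
proof -
  have "(\<lambda>n. \<integral>x. (cmod (F n x - f x))\<^sup>2 \<partial>M) \<longlonglongrightarrow> (\<integral>x. 0 \<partial>M)"
  proof (rule integral_dominated_convergence[OF _ _ w])
    show "AE x in M. (\<lambda>n. (cmod (F n x - f x))\<^sup>2) \<longlonglongrightarrow> 0"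
      using lim
    proof eventually_elim
      case (elim x)
      then have "(\<lambda>n. (cmod (F n x - f x))\<^sup>2) \<longlonglongrightarrow> (cmod (f x - f x))\<^sup>2"
        by (intro tendsto_intros)
      then show ?case by simp
    qed
    show "AE x in M. norm ((cmod (F n x - f x))\<^sup>2) \<le> w x" for n
      using bd by simp
  qed measurable
  then have "(\<lambda>n. sqrt (\<integral>x. (cmod (F n x - f x))\<^sup>2 \<partial>M)) \<longlonglongrightarrow> sqrt 0"
    by (intro tendsto_real_sqrt) simp
  then show ?thesis by (simp add: l2n_def)
qed

lemma integral_mult_cnj_self: "(\<integral>x. f x * cnj (f x) \<partial>M) = of_real ((l2n M f)\<^sup>2)"
  unfolding l2n_power2 integral_complex_of_real[symmetric] complex_norm_square ..

lemma inner_integrable: "sqi M c \<Longrightarrow> sqi M d \<Longrightarrow> integrable M (\<lambda>j. c j * cnj (d j))"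
  using sqi_integrable_mult[OF _ sqi_cnj] .

section \<open>Square summable sequences and the shear commutator\<close>

abbreviation Zm :: "int measure" where "Zm \<equiv> count_space UNIV"

lemma Zm_integrable_shift:
  fixes f :: "int \<Rightarrow> 'b::{banach, second_countable_topology}"
  shows "integrable Zm (\<lambda>i. f (i + a)) \<longleftrightarrow> integrable Zm f"
  by (rule integrable_bij_count_space) (auto intro: bij_betwI[of _ _ _ "\<lambda>i. i - a"])

lemma Zm_integral_shift:
  fixes f :: "int \<Rightarrow> 'b::{banach, second_countable_topology}"
  shows "(\<integral>i. f (i + a) \<partial>Zm) = (\<integral>i. f i \<partial>Zm)"
  by (rule integral_bij_count_space) (auto intro: bij_betwI[of _ _ _ "\<lambda>i. i - a"])

lemma sqi_shift: "sqi Zm c \<Longrightarrow> sqi Zm (\<lambda>i. c (i + a))"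
  using Zm_integrable_shift[of "\<lambda>i. (cmod (c i))\<^sup>2" a] by (simp add: sqi_def)

lemma sqi_shift_minus: "sqi Zm c \<Longrightarrow> sqi Zm (\<lambda>i. c (i - a))"
  using sqi_shift[of c "-a"] by simp

lemma l2n_shift: "l2n Zm (\<lambda>i. c (i + a)) = l2n Zm c"
  using Zm_integral_shift[of "\<lambda>i. (cmod (c i))\<^sup>2" a] by (simp add: l2n_def)

lemma l2n_shift_minus: "l2n Zm (\<lambda>i. c (i - a)) = l2n Zm c"
  using l2n_shift[of c "-a"] by simp

lemma cnj_integral_shift: "cnj (\<integral>i. f i \<partial>Zm) = (\<integral>i. cnj (f (i + a)) \<partial>Zm)"
  by (simp add: Zm_integral_shift)

lemma cmod_le_l2n:
  assumes "sqi Zm c"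
  shows "cmod (c i) \<le> l2n Zm c"
proof (rule power2_le_imp_le)
  have "(cmod (c i))\<^sup>2 = (\<integral>j. indicator {i} j * (cmod (c j))\<^sup>2 \<partial>Zm)"
  proof -
    have "(\<integral>j. indicator {i} j * (cmod (c j))\<^sup>2 \<partial>Zm) = (\<integral>j. indicator {i} j * (cmod (c i))\<^sup>2 \<partial>Zm)"
      by (intro Bochner_Integration.integral_cong) (auto split: split_indicator)
    then show ?thesis by simp
  qed
  also have "\<dots> \<le> (\<integral>j. (cmod (c j))\<^sup>2 \<partial>Zm)"
    using sqi_integrable[OF assms] integrable_mult_indicator[of "{i}" Zm, OF _ sqi_integrable[OF assms]]
    by (intro integral_mono) (auto split: split_indicator)
  finally show "(cmod (c i))\<^sup>2 \<le> (l2n Zm c)\<^sup>2" by (simp add: l2n_power2)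
qed simp

lemma finite_sum_le_l2n:
  assumes "sqi Zm c" "finite P"
  shows "(\<Sum>j\<in>P. (cmod (c j))\<^sup>2) \<le> (l2n Zm c)\<^sup>2"
proof -
  have "(\<Sum>j\<in>P. (cmod (c j))\<^sup>2) = (\<integral>j. indicator P j *\<^sub>R (cmod (c j))\<^sup>2 \<partial>Zm)"
    using assms(2) by (subst lebesgue_integral_count_space_finite_support) (auto intro!: sum.mono_neutral_cong_right split: split_indicator)
  also have "\<dots> \<le> (\<integral>j. (cmod (c j))\<^sup>2 \<partial>Zm)"
    using sqi_integrable[OF assms(1)] integrable_mult_indicator[of P Zm, OF _ sqi_integrable[OF assms(1)]]
    by (intro integral_mono) (auto split: split_indicator)
  finally show ?thesis by (simp add: l2n_power2)
qed

text \<open>Turns a bound on finite sums, such as Bessel's inequality, into integrability for the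
  counting measure, by way of unordered summability.\<close>

lemma Zm_integrable_bounded_sums:
  fixes h :: "int \<Rightarrow> real"
  assumes nn: "\<And>i. h i \<ge> 0" and le: "\<And>P. finite P \<Longrightarrow> sum h P \<le> B"
  shows "integrable Zm h" "(\<integral>i. h i \<partial>Zm) \<le> B"
proof -
  have s: "h summable_on UNIV"
    by (rule nonneg_bdd_above_summable_on) (use nn le in \<open>auto intro!: bdd_aboveI2\<close>)
  then have "Infinite_Sum.abs_summable_on h UNIV"
    by (rule summable_on_iff_abs_summable_on_real[THEN iffD1])
  then have a: "Infinite_Set_Sum.abs_summable_on h UNIV"
    by (rule abs_summable_equivalent[THEN iffD1])
  then show "integrable Zm h" by (simp add: Infinite_Set_Sum.abs_summable_on_def)
  have "(\<integral>i. h i \<partial>Zm) = infsum h UNIV"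
    using infsetsum_infsum[OF a] by (simp add: infsetsum_def)
  also have "\<dots> \<le> B" using s le by (intro infsum_le_finite_sums) auto
  finally show "(\<integral>i. h i \<partial>Zm) \<le> B" .
qed

text \<open>Two indices at distance L cannot both be small: |L| <= |i| + |i + L|. One factor L is
  thus exchanged for one factor of the index, the quantity that diffusion controls, and
  Cauchy-Schwarz finishes.\<close>

lemma correlation_bound:
  fixes c w :: "int \<Rightarrow> complex" and L :: int
  assumes c: "sqi Zm c" and dc: "sqi Zm (\<lambda>i. of_int i * c i)"
    and w: "\<And>i. cmod (w i) \<le> B" and L: "L \<noteq> 0"
  shows "cmod (\<integral>i. w i * (c i * cnj (c (i + L))) \<partial>Zm)
           \<le> B * (2 * (l2n Zm c * l2n Zm (\<lambda>i. of_int i * c i)) / \<bar>of_int L\<bar>)"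
proof -
  define J where "J = l2n Zm c * l2n Zm (\<lambda>i. of_int i * c i)"
  have B: "B \<ge> 0" using w[of 0] norm_ge_zero order_trans by blast
  have i1: "integrable Zm (\<lambda>i. cmod (c i) * cmod (c (i + L)))"
    by (rule sqi_integrable_cmod_mult[OF c sqi_shift[OF c]])
  have i2: "integrable Zm (\<lambda>i. cmod (of_int i * c i) * cmod (c (i + L)))"
    by (rule sqi_integrable_cmod_mult[OF dc sqi_shift[OF c]])
  have i3: "integrable Zm (\<lambda>i. cmod (c i) * cmod (of_int (i + L) * c (i + L)))"
    by (rule sqi_integrable_cmod_mult[OF c sqi_shift[OF dc]])
  have "\<bar>of_int L\<bar> * (\<integral>i. cmod (c i) * cmod (c (i + L)) \<partial>Zm)
      = (\<integral>i. \<bar>of_int L\<bar> * (cmod (c i) * cmod (c (i + L))) \<partial>Zm)"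
    by simp
  also have "\<dots> \<le> (\<integral>i. cmod (of_int i * c i) * cmod (c (i + L))
                       + cmod (c i) * cmod (of_int (i + L) * c (i + L)) \<partial>Zm)"
  proof (rule integral_mono)
    show "integrable Zm (\<lambda>i. \<bar>of_int L\<bar> * (cmod (c i) * cmod (c (i + L))))"
      using i1 by (intro integrable_mult_right)
    show "integrable Zm (\<lambda>i. cmod (of_int i * c i) * cmod (c (i + L))
                       + cmod (c i) * cmod (of_int (i + L) * c (i + L)))"
      using i2 i3 by (intro Bochner_Integration.integrable_add)
    fix i :: int
    have "\<bar>of_int L\<bar> \<le> \<bar>of_int i :: real\<bar> + \<bar>of_int (i + L)\<bar>" by simp
    then have "\<bar>of_int L\<bar> * (cmod (c i) * cmod (c (i + L)))
       \<le> (\<bar>of_int i\<bar> + \<bar>of_int (i + L)\<bar>) * (cmod (c i) * cmod (c (i + L)))"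
      by (intro mult_right_mono) auto
    also have "\<dots> = cmod (of_int i * c i) * cmod (c (i + L))
                       + cmod (c i) * cmod (of_int (i + L) * c (i + L))"
      by (simp only: norm_mult norm_of_int) (simp add: algebra_simps)
    finally show "\<bar>of_int L\<bar> * (cmod (c i) * cmod (c (i + L))) \<le> \<dots>" .
  qed
  also have "\<dots> = (\<integral>i. cmod (of_int i * c i) * cmod (c (i + L)) \<partial>Zm)
                + (\<integral>i. cmod (c i) * cmod (of_int (i + L) * c (i + L)) \<partial>Zm)"
    by (rule Bochner_Integration.integral_add[OF i2 i3])
  also have "\<dots> \<le> J + J"
    using l2n_Cauchy_Schwarz[OF dc sqi_shift[OF c, of L]] l2n_Cauchy_Schwarz[OF c sqi_shift[OF dc, of L]]
    unfolding l2n_shift[of c L] l2n_shift[of "\<lambda>i. of_int i * c i" L]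
    by (simp add: J_def mult.commute)
  finally have P: "(\<integral>i. cmod (c i) * cmod (c (i + L)) \<partial>Zm) \<le> 2 * J / \<bar>of_int L\<bar>"
    using L by (simp add: field_simps)
  have "cmod (\<integral>i. w i * (c i * cnj (c (i + L))) \<partial>Zm) \<le> (\<integral>i. cmod (w i * (c i * cnj (c (i + L)))) \<partial>Zm)"
    by (rule integral_norm_bound)
  also have "\<dots> \<le> (\<integral>i. B * (cmod (c i) * cmod (c (i + L))) \<partial>Zm)"
  proof (rule integral_mono')
    show "integrable Zm (\<lambda>i. B * (cmod (c i) * cmod (c (i + L))))"
      using i1 by simp
    show "cmod (w i * (c i * cnj (c (i + L)))) \<le> B * (cmod (c i) * cmod (c (i + L)))" for i
      using w[of i] by (auto simp: norm_mult intro!: mult_right_mono)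
    show "0 \<le> B * (cmod (c i) * cmod (c (i + L)))" for i
      using B by simp
  qed
  also have "\<dots> \<le> B * (2 * J / \<bar>of_int L\<bar>)"
    using mult_left_mono[OF P B] by simp
  finally show ?thesis by (simp add: J_def)
qed

section \<open>The ramp weight and its commutator with the shear\<close>

definition ramp :: "int \<Rightarrow> int \<Rightarrow> real" where
  "ramp N i = max 0 (min 1 (of_int (i + N) / of_int N))"

lemma ramp_bounds: "0 \<le> ramp N i" "ramp N i \<le> 1"
  by (auto simp: ramp_def)

text \<open>The ramp has slope at most 1/N and total rise 1; each fact gives one argument of the
  minimum.\<close>

lemma ramp_lipschitz:
  assumes "N > 0" "s > 0"
  shows "\<bar>ramp N (i + s) - ramp N i\<bar> \<le> min 1 (of_int s / of_int N)"
proof -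
  have "of_int (i + s + N) / of_int N = of_int (i + N) / of_int N + of_int s / (of_int N :: real)"
    using assms by (simp add: field_simps)
  moreover have "of_int s / of_int N > (0::real)" using assms by simp
  ultimately show ?thesis by (auto simp: ramp_def)
qed

text \<open>In x = i/N the difference is the tent max(0, 1 - |x|), whose distance from 1 is at most
  |x|. The defect of the main term is therefore paid with one factor of the index, again a
  dissipated quantity.\<close>

lemma ramp_step:
  assumes "N > 0"
  shows "\<bar>ramp N i - ramp N (i - N) - 1\<bar> \<le> \<bar>of_int i\<bar> / of_int N"
proof -
  define x where "x = (of_int i / of_int N :: real)"
  have "of_int (i + N) / of_int N = x + 1" "\<bar>of_int i\<bar> / of_int N = \<bar>x\<bar>"
    "of_int (i - N + N) / of_int N = x"
    using assms by (simp_all add: x_def field_simps)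
  then show ?thesis unfolding ramp_def by auto
qed

text \<open>Absolute summability of \<open>b\<close>, with the norm of each shift difference at most
  2 |c| uniformly in n, dominates the double sum. Since \<open>d\<close> is arbitrary, the same
  exchange serves the energy identity and both slots of the correlation.\<close>

lemma shear_exchange:
  fixes b :: "nat \<Rightarrow> real" and s :: "nat \<Rightarrow> int"
  assumes b: "summable (\<lambda>n. \<bar>b n\<bar>)" and c: "sqi Zm c" and d: "sqi Zm d"
    and V: "\<And>j. V j = (\<Sum>n. of_real (b n) * (c (j - s n) - c (j + s n)))"
  shows "(\<lambda>n. of_real (b n) * (\<integral>j. (c (j - s n) - c (j + s n)) * d j \<partial>Zm)) sums (\<integral>j. V j * d j \<partial>Zm)"
proof -
  define f where "f n j = of_real (b n) * ((c (j - s n) - c (j + s n)) * d j)" for n j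
  have sh: "sqi Zm (\<lambda>j. c (j - s n) - c (j + s n))" for n
    by (intro sqi_diff sqi_shift_minus sqi_shift c)
  have le: "cmod (c (j - s n) - c (j + s n)) \<le> 2 * l2n Zm c" for n j
    using norm_triangle_ineq4[of "c (j - s n)" "c (j + s n)"] cmod_le_l2n[OF c, of "j - s n"]
      cmod_le_l2n[OF c, of "j + s n"] by linarith
  have summV: "summable (\<lambda>n. norm (of_real (b n) * (c (j - s n) - c (j + s n))))" for j
  proof (rule summable_comparison_test'[of "\<lambda>n. \<bar>b n\<bar> * (2 * l2n Zm c)" 0])
    show "summable (\<lambda>n. \<bar>b n\<bar> * (2 * l2n Zm c))" using b by (rule summable_mult2)
  qed (auto simp: norm_mult intro!: mult_left_mono le)
  have "(\<lambda>n. integral\<^sup>L Zm (f n)) sums (\<integral>j. (\<Sum>n. f n j) \<partial>Zm)"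
  proof (rule sums_integral)
    show "integrable Zm (f n)" for n
      unfolding f_def using sqi_integrable_mult[OF sh d] by (intro integrable_mult_right)
    show "AE j in Zm. summable (\<lambda>n. norm (f n j))"
    proof (intro AE_I2)
      fix j
      show "summable (\<lambda>n. norm (f n j))"
        using summable_mult2[OF summV, of j "norm (d j)"]
        by (simp add: f_def norm_mult mult.assoc)
    qed
    show "summable (\<lambda>n. \<integral>j. norm (f n j) \<partial>Zm)"
    proof (rule summable_comparison_test'[of "\<lambda>n. \<bar>b n\<bar> * (2 * l2n Zm c * l2n Zm d)" 0])
      show "summable (\<lambda>n. \<bar>b n\<bar> * (2 * l2n Zm c * l2n Zm d))" using b by (rule summable_mult2)
      fix n
      have "(\<integral>j. norm (f n j) \<partial>Zm) = \<bar>b n\<bar> * (\<integral>j. cmod (c (j - s n) - c (j + s n)) * cmod (d j) \<partial>Zm)"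
        by (simp add: f_def norm_mult)
      also have "\<dots> \<le> \<bar>b n\<bar> * (l2n Zm (\<lambda>j. c (j - s n) - c (j + s n)) * l2n Zm d)"
        by (intro mult_left_mono l2n_Cauchy_Schwarz sh d) auto
      also have "\<dots> \<le> \<bar>b n\<bar> * (2 * l2n Zm c * l2n Zm d)"
      proof (intro mult_left_mono mult_right_mono)
        have "l2n Zm (\<lambda>j. c (j - s n) - c (j + s n)) \<le> l2n Zm (\<lambda>j. c (j - s n)) + l2n Zm (\<lambda>j. - c (j + s n))"
          using l2n_triangle[OF sqi_shift_minus[OF c, of "s n"] sqi_uminus[OF sqi_shift[OF c, of "s n"]]]
          by simp
        then show "l2n Zm (\<lambda>j. c (j - s n) - c (j + s n)) \<le> 2 * l2n Zm c"
          by (simp add: l2n_shift l2n_shift_minus)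
      qed auto
      finally show "norm (\<integral>j. norm (f n j) \<partial>Zm) \<le> \<bar>b n\<bar> * (2 * l2n Zm c * l2n Zm d)"
        by simp
    qed
  qed
  moreover have "(\<Sum>n. f n j) = V j * d j" for j
    unfolding f_def V
    using suminf_mult2[OF summable_norm_cancel[OF summV[of j]], of "d j"] by (simp add: mult.assoc)
  moreover have "integral\<^sup>L Zm (f n) = of_real (b n) * (\<integral>j. (c (j - s n) - c (j + s n)) * d j \<partial>Zm)" for n
    by (simp add: f_def[abs_def])
  ultimately show ?thesis by simp
qed

text \<open>Shifting the summation index turns the commutator of the shear with the weighted shift by \<open>N\<close>
  into two correlations with weights \<open>w(i + s) - w(i)\<close>; only \<open>s = N\<close> produces a correlation at
  distance \<open>0\<close>.\<close>

lemma commutator_split: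
  fixes c :: "int \<Rightarrow> complex" and N s :: int
  assumes c: "sqi Zm c"
  defines "w \<equiv> ramp N"
  shows "(\<integral>j. of_real (w j) * ((c (j - s) - c (j + s)) * cnj (c (j + N)))
               + of_real (w j) * (c j * cnj (c (j + N - s) - c (j + N + s))) \<partial>Zm)
       = (\<integral>i. of_real (w (i + s) - w i) * (c i * cnj (c (i + (N + s)))) \<partial>Zm)
         + (\<integral>i. of_real (w i - w (i - s)) * (c i * cnj (c (i + (N - s)))) \<partial>Zm)"
proof -
  have int: "integrable Zm (\<lambda>i. of_real (w (i + a)) * (c (i + p) * cnj (c (i + q))))" for a p q
  proof -
    have "sqi Zm (\<lambda>i. of_real (w (i + a)) * c (i + p))"
      by (rule sqi_mult_bounded[OF sqi_shift[OF c], of _ 1]) (simp_all add: w_def ramp_bounds)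
    from sqi_integrable_mult[OF this sqi_cnj[OF sqi_shift[OF c, of q]]] show ?thesis
      by (simp add: mult.assoc)
  qed
  have shift: "(\<integral>i. of_real (w (i + a)) * (c (i + p) * cnj (c (i + q))) \<partial>Zm)
     = (\<integral>i. of_real (w (i + (a - p))) * (c i * cnj (c (i + (q - p)))) \<partial>Zm)" for a p q
    using Zm_integral_shift[of "\<lambda>i. of_real (w (i + (a - p))) * (c i * cnj (c (i + (q - p))))" p]
    by (simp add: algebra_simps)
  have "(\<integral>j. of_real (w j) * ((c (j - s) - c (j + s)) * cnj (c (j + N)))
               + of_real (w j) * (c j * cnj (c (j + N - s) - c (j + N + s))) \<partial>Zm)
     = (\<integral>j. of_real (w (j + 0)) * (c (j + (- s)) * cnj (c (j + N)))
          - of_real (w (j + 0)) * (c (j + s) * cnj (c (j + N)))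
          + of_real (w (j + 0)) * (c (j + 0) * cnj (c (j + (N - s))))
          - of_real (w (j + 0)) * (c (j + 0) * cnj (c (j + (N + s)))) \<partial>Zm)"
    by (intro Bochner_Integration.integral_cong) (auto simp: algebra_simps)
  also have "\<dots> = (\<integral>j. of_real (w (j + 0)) * (c (j + (- s)) * cnj (c (j + N))) \<partial>Zm)
       - (\<integral>j. of_real (w (j + 0)) * (c (j + s) * cnj (c (j + N))) \<partial>Zm)
       + (\<integral>j. of_real (w (j + 0)) * (c (j + 0) * cnj (c (j + (N - s)))) \<partial>Zm)
       - (\<integral>j. of_real (w (j + 0)) * (c (j + 0) * cnj (c (j + (N + s)))) \<partial>Zm)"
    by (simp only: Bochner_Integration.integral_add Bochner_Integration.integral_diff int
          Bochner_Integration.integrable_add Bochner_Integration.integrable_diff)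
  also have "\<dots> = ((\<integral>i. of_real (w (i + s)) * (c (i + 0) * cnj (c (i + (N + s)))) \<partial>Zm)
              - (\<integral>i. of_real (w (i + 0)) * (c (i + 0) * cnj (c (i + (N + s)))) \<partial>Zm))
            + ((\<integral>i. of_real (w (i + 0)) * (c (i + 0) * cnj (c (i + (N - s)))) \<partial>Zm)
              - (\<integral>i. of_real (w (i + (- s))) * (c (i + 0) * cnj (c (i + (N - s)))) \<partial>Zm))"
    unfolding shift[of 0 "-s" N] shift[of 0 s N] by (simp add: algebra_simps)
  also have "\<dots> = (\<integral>i. of_real (w (i + s)) * (c (i + 0) * cnj (c (i + (N + s))))
                 - of_real (w (i + 0)) * (c (i + 0) * cnj (c (i + (N + s)))) \<partial>Zm)
      + (\<integral>i. of_real (w (i + 0)) * (c (i + 0) * cnj (c (i + (N - s))))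
                 - of_real (w (i + (- s))) * (c (i + 0) * cnj (c (i + (N - s)))) \<partial>Zm)"
    by (simp only: Bochner_Integration.integral_diff int)
  finally show ?thesis by (simp add: algebra_simps)
qed

text \<open>When s differs from N, both increments of the ramp are at most \<open>om\<close> = min 1
  (s/N), and both distances N + s and |N - s| are comparable to the larger of N and s; the minimum
  in the bound is exactly \<open>om\<close> divided by that maximum. When s = N, the second
  correlation sits at distance 0 and produces the squared norm up to the defect of the tent.\<close>

lemma commutator_bound:
  fixes c :: "int \<Rightarrow> complex" and N s :: int
  assumes c: "sqi Zm c" and dc: "sqi Zm (\<lambda>i. of_int i * c i)"
    and N: "N > 0" and s: "s > 0" and gap: "3 * s \<le> N \<or> 3 * N \<le> s \<or> s = N"
  defines "J \<equiv> l2n Zm c * l2n Zm (\<lambda>i. of_int i * c i)"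
  shows "cmod ((\<integral>j. of_real (ramp N j) * ((c (j - s) - c (j + s)) * cnj (c (j + N)))
               + of_real (ramp N j) * (c j * cnj (c (j + N - s) - c (j + N + s))) \<partial>Zm)
             - (if s = N then of_real ((l2n Zm c)\<^sup>2) else 0))
         \<le> 5 * J * min (of_int s / (of_int N)\<^sup>2) (1 / of_int s)"
proof -
  have J: "J \<ge> 0" by (simp add: J_def)
  define I1 where "I1 = (\<integral>i. of_real (ramp N (i + s) - ramp N i) * (c i * cnj (c (i + (N + s)))) \<partial>Zm)"
  define I2 where "I2 = (\<integral>i. of_real (ramp N i - ramp N (i - s)) * (c i * cnj (c (i + (N - s)))) \<partial>Zm)"
  define om where "om = min 1 (of_int s / of_int N :: real)"
  have om0: "om > 0" using N s by (simp add: om_def)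
  have I1: "cmod I1 \<le> om * (2 * J / of_int (N + s))"
  proof -
    have "cmod I1 \<le> om * (2 * J / \<bar>of_int (N + s)\<bar>)"
      unfolding I1_def J_def om_def
    proof (rule correlation_bound[OF c dc])
      show "cmod (of_real (ramp N (i + s) - ramp N i)) \<le> min 1 (of_int s / of_int N)" for i
        unfolding norm_of_real by (rule ramp_lipschitz[OF N s])
    qed (use N s in auto)
    then show ?thesis using N s by simp
  qed
  show ?thesis
  proof (cases "s = N")
    case False
    have I2: "cmod I2 \<le> om * (2 * J / \<bar>of_int (N - s)\<bar>)"
      unfolding I2_def J_def om_def
    proof (rule correlation_bound[OF c dc])
      show "cmod (of_real (ramp N i - ramp N (i - s))) \<le> min 1 (of_int s / of_int N)" for i
        using ramp_lipschitz[OF N s, of "i - s"] by (simp only: norm_of_real) simp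
    qed (use False in auto)
    define r where "r = (of_int N :: real)"
    define q where "q = (of_int s :: real)"
    have rq1: "r > 0" "q > 0" using N s by (simp_all add: r_def q_def)
    have rq3: "3 * q \<le> r \<or> 3 * r \<le> q"
    proof -
      have "real_of_int (3 * s) \<le> of_int N \<or> real_of_int (3 * N) \<le> of_int s"
        using gap False by (simp only: of_int_le_iff) auto
      then show ?thesis by (simp add: r_def q_def)
    qed
    note rq = rq1 rq3
    \<comment> \<open>The gap gives |r - q| >= (2/3) max r q, so the two terms cost 2 and 3 in units
      of 1 / max r q.\<close>
    have k1: "2 / (r + q) + 2 / \<bar>r - q\<bar> \<le> 5 / max r q"
      using rq(3)
    proof
      assume *: "3 * q \<le> r"
      then have "2 / (r + q) \<le> 2 / r" "2 / \<bar>r - q\<bar> \<le> 3 / r"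
        using rq(1,2) by (auto simp: field_simps)
      then show ?thesis using * rq(1,2) by (simp add: max_def)
    next
      assume *: "3 * r \<le> q"
      then have "2 / (r + q) \<le> 2 / q" "2 / \<bar>r - q\<bar> \<le> 3 / q"
        using rq(1,2) by (auto simp: field_simps)
      then show ?thesis using * rq(1,2) by (simp add: max_def)
    qed
    have k2: "om / max r q = min (q / r\<^sup>2) (1 / q)"
    proof (cases "q \<le> r")
      case True
      then have "om = q / r" using rq by (simp add: om_def r_def q_def)
      moreover have "q / r\<^sup>2 \<le> 1 / q"
        using True rq1 mult_mono[of q r q r] by (simp add: field_simps power2_eq_square)
      ultimately show ?thesis using True by (simp add: max_def min_def power2_eq_square)
    next
      case f: False
      then have "om = 1" using rq by (simp add: om_def r_def q_def)
      moreover have "\<not> q / r\<^sup>2 \<le> 1 / q"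
        using f rq1 mult_strict_mono[of r q r q] by (simp add: field_simps power2_eq_square)
      ultimately show ?thesis using f by (simp add: max_def min_def)
    qed
    have key: "om * (2 / (r + q) + 2 / \<bar>r - q\<bar>) \<le> 5 * min (q / r\<^sup>2) (1 / q)"
    proof -
      have "om * (2 / (r + q) + 2 / \<bar>r - q\<bar>) \<le> om * (5 / max r q)"
        using k1 om0 by (intro mult_left_mono) auto
      also have "\<dots> = 5 * (om / max r q)" by simp
      finally show ?thesis using k2 by simp
    qed
    have "cmod (I1 + I2) \<le> om * (2 * J / (r + q)) + om * (2 * J / \<bar>r - q\<bar>)"
      using norm_triangle_ineq[of I1 I2] I1 I2 by (simp add: r_def q_def)
    also have "\<dots> = J * (om * (2 / (r + q) + 2 / \<bar>r - q\<bar>))"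
      by (simp add: algebra_simps)
    also have "\<dots> \<le> J * (5 * min (q / r\<^sup>2) (1 / q))"
      using key J by (rule mult_left_mono)
    finally show ?thesis
      unfolding commutator_split[OF c] I1_def[symmetric] I2_def[symmetric]
      using False by (simp add: r_def q_def mult_ac)
  next
    case True
    have i1: "integrable Zm (\<lambda>i. of_real (ramp N i - ramp N (i - N)) * (c i * cnj (c i)))"
    proof -
      have "\<bar>ramp N i - ramp N (i - N)\<bar> \<le> 1" for i
        using ramp_bounds[of N i] ramp_bounds[of N "i - N"] by linarith
      then have "sqi Zm (\<lambda>i. of_real (ramp N i - ramp N (i - N)) * c i)"
        by (intro sqi_mult_bounded[OF c, of _ 1]) (simp_all only: norm_of_real, auto)
      from sqi_integrable_mult[OF this sqi_cnj[OF c]] show ?thesis by (simp add: mult.assoc)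
    qed
    have i2: "integrable Zm (\<lambda>i. c i * cnj (c i))"
      using sqi_integrable_mult[OF c sqi_cnj[OF c]] .
    have E: "of_real ((l2n Zm c)\<^sup>2) = (\<integral>i. c i * cnj (c i) \<partial>Zm)"
      by (rule integral_mult_cnj_self[symmetric])
    have "I2 - of_real ((l2n Zm c)\<^sup>2) = (\<integral>i. of_real (ramp N i - ramp N (i - N)) * (c i * cnj (c i)) - c i * cnj (c i) \<partial>Zm)"
      unfolding E I2_def using True Bochner_Integration.integral_diff[OF i1 i2] by simp
    also have "cmod \<dots> \<le> (\<integral>i. cmod (of_real (ramp N i - ramp N (i - N)) * (c i * cnj (c i)) - c i * cnj (c i)) \<partial>Zm)"
      by (rule integral_norm_bound)
    also have "\<dots> \<le> (\<integral>i. (cmod (of_int i * c i) * cmod (c i)) / of_int N \<partial>Zm)"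
    proof (rule integral_mono')
      show "integrable Zm (\<lambda>i. (cmod (of_int i * c i) * cmod (c i)) / of_int N)"
        using sqi_integrable_cmod_mult[OF dc c] by simp
      fix i
      have "of_real (ramp N i - ramp N (i - N)) * (c i * cnj (c i)) - c i * cnj (c i)
          = of_real (ramp N i - ramp N (i - N) - 1) * (c i * cnj (c i))"
        by (simp add: algebra_simps)
      then have "cmod (of_real (ramp N i - ramp N (i - N)) * (c i * cnj (c i)) - c i * cnj (c i))
          = \<bar>ramp N i - ramp N (i - N) - 1\<bar> * (cmod (c i) * cmod (c i))"
        by (simp only: norm_mult norm_of_real complex_mod_cnj)
      also have "\<dots> \<le> \<bar>of_int i\<bar> / of_int N * (cmod (c i) * cmod (c i))"
        by (intro mult_right_mono ramp_step N) auto
      finally show "cmod (of_real (ramp N i - ramp N (i - N)) * (c i * cnj (c i)) - c i * cnj (c i))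
        \<le> (cmod (of_int i * c i) * cmod (c i)) / of_int N"
        by (simp add: norm_mult)
      show "0 \<le> (cmod (of_int i * c i) * cmod (c i)) / of_int N" using N by simp
    qed
    also have "\<dots> \<le> J / of_int N"
      using l2n_Cauchy_Schwarz[OF dc c] N by (simp add: J_def divide_right_mono mult.commute)
    finally have I2: "cmod (I2 - of_real ((l2n Zm c)\<^sup>2)) \<le> J / of_int N" .
    \<comment> \<open>Here \<open>om\<close> = 1 and the distance is 2N, so the bound is 2J /
      (2N).\<close>
    have I1': "cmod I1 \<le> J / of_int N"
      using I1 True N by (simp add: om_def)
    have "cmod (I1 + (I2 - of_real ((l2n Zm c)\<^sup>2))) \<le> J / of_int N + J / of_int N"
      by (rule norm_triangle_le) (use I1' I2 in linarith)
    also have "\<dots> \<le> 5 * J * min (of_int s / (of_int N)\<^sup>2) (1 / of_int s)"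
    proof -
      have "min (of_int s / (of_int N)\<^sup>2) (1 / of_int s) = (1 / of_int N :: real)"
        using True N by (simp add: power2_eq_square)
      moreover have "J / of_int N \<ge> 0" using J N by simp
      ultimately show ?thesis by simp
    qed
    finally show ?thesis
      unfolding commutator_split[OF c] I1_def[symmetric] I2_def[symmetric]
      using True by (simp add: algebra_simps)
  qed
qed

section \<open>The hypocoercive functional\<close>

text \<open>The polarised correlation, symmetric and real-bilinear in \<open>c\<close> and
  \<open>d\<close>. On the diagonal it is twice the weighted sum of the functional, whence the
  factor \<tau> / 2 in \<open>lyap\<close>; by symmetry the derivative along a curve is twice
  \<open>lyap\<close> of the curve and its velocity.\<close>

definition cross :: "int \<Rightarrow> (int \<Rightarrow> complex) \<Rightarrow> (int \<Rightarrow> complex) \<Rightarrow> complex" where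
  "cross N c d = (\<integral>j. of_real (ramp N j) * (c j * cnj (d (j + N)) + d j * cnj (c (j + N))) \<partial>Zm)"

definition lyap :: "real \<Rightarrow> int \<Rightarrow> (int \<Rightarrow> complex) \<Rightarrow> (int \<Rightarrow> complex) \<Rightarrow> real" where
  "lyap \<tau> N c d = Re (\<integral>j. c j * cnj (d j) \<partial>Zm) + \<tau> / 2 * Re (cross N c d)"

section \<open>Bilinearity and boundedness of the functional\<close>

lemma ramp_integrable:
  assumes "sqi Zm c" "sqi Zm d"
  shows "integrable Zm (\<lambda>j. of_real (ramp N j) * (c j * cnj (d (j + N))))"
proof -
  have "sqi Zm (\<lambda>i. of_real (ramp N i) * c i)"
    by (rule sqi_mult_bounded[OF assms(1), of _ 1]) (simp_all add: ramp_bounds)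
  from sqi_integrable_mult[OF this sqi_cnj[OF sqi_shift[OF assms(2)]]] show ?thesis
    by (simp add: mult.assoc)
qed

lemma cross_split:
  assumes "sqi Zm c" "sqi Zm d"
  shows "cross N c d = (\<integral>j. of_real (ramp N j) * (c j * cnj (d (j + N))) \<partial>Zm)
                       + (\<integral>j. of_real (ramp N j) * (d j * cnj (c (j + N))) \<partial>Zm)"
  unfolding cross_def distrib_left
  by (rule Bochner_Integration.integral_add[OF ramp_integrable[OF assms] ramp_integrable[OF assms(2,1)]])

lemma cross_commute: "cross N c d = cross N d c"
  by (simp add: cross_def add.commute)

lemma cross_integrable:
  assumes "sqi Zm c" "sqi Zm d"
  shows "integrable Zm (\<lambda>j. of_real (ramp N j) * (c j * cnj (d (j + N)) + d j * cnj (c (j + N))))"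
  unfolding distrib_left
  by (rule Bochner_Integration.integrable_add[OF ramp_integrable[OF assms] ramp_integrable[OF assms(2,1)]])

lemma cross_add_right:
  assumes "sqi Zm c" "sqi Zm d" "sqi Zm e"
  shows "cross N c (\<lambda>j. d j + e j) = cross N c d + cross N c e"
  unfolding cross_def
  by (subst Bochner_Integration.integral_add[OF cross_integrable[OF assms(1,2)] cross_integrable[OF assms(1,3)], symmetric])
     (simp add: algebra_simps)

lemma cross_scale_right: "cross N c (\<lambda>j. of_real r * d j) = of_real r * cross N c d"
  unfolding cross_def
  by (subst integral_mult_right_zero[symmetric]) (simp add: algebra_simps)

lemma cross_bound:
  assumes "sqi Zm c" "sqi Zm d"
  shows "cmod (cross N c d) \<le> 2 * (l2n Zm c * l2n Zm d)"
proof -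
  have *: "cmod (\<integral>j. of_real (ramp N j) * (c j * cnj (d (j + N))) \<partial>Zm) \<le> l2n Zm c * l2n Zm d"
    if "sqi Zm c" "sqi Zm d" for c d :: "int \<Rightarrow> complex"
  proof -
    have "sqi Zm (\<lambda>i. of_real (ramp N i) * c i)"
      by (rule sqi_mult_bounded[OF that(1), of _ 1]) (simp_all add: ramp_bounds)
    from l2n_integral_mult_le[OF this sqi_cnj[OF sqi_shift[OF that(2), of N]]]
    have "cmod (\<integral>j. of_real (ramp N j) * (c j * cnj (d (j + N))) \<partial>Zm)
        \<le> l2n Zm (\<lambda>i. of_real (ramp N i) * c i) * l2n Zm (\<lambda>j. cnj (d (j + N)))"
      by (simp add: mult.assoc)
    also have "l2n Zm (\<lambda>j. cnj (d (j + N))) = l2n Zm d"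
      using l2n_shift[of d N] by (simp add: l2n_def)
    also have "l2n Zm (\<lambda>i. of_real (ramp N i) * c i) \<le> l2n Zm c"
      by (rule l2n_mono[OF that(1)]) (auto simp: norm_mult ramp_bounds intro!: mult_left_le_one_le)
    finally show ?thesis by (simp add: mult_right_mono)
  qed
  have "cmod (cross N c d) \<le> l2n Zm c * l2n Zm d + l2n Zm d * l2n Zm c"
    unfolding cross_split[OF assms]
    by (intro norm_triangle_le add_mono * assms)
  then show ?thesis by (simp add: mult.commute)
qed

lemma lyap_commute:
  shows "lyap \<tau> N c d = lyap \<tau> N d c"
proof -
  have "(\<integral>j. d j * cnj (c j) \<partial>Zm) = cnj (\<integral>j. c j * cnj (d j) \<partial>Zm)"
    by (simp add: mult.commute flip: Bochner_Integration.integral_cnj)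
  then show ?thesis by (simp add: lyap_def cross_commute)
qed

lemma lyap_add_right:
  assumes "sqi Zm c" "sqi Zm d" "sqi Zm e"
  shows "lyap \<tau> N c (\<lambda>j. d j + e j) = lyap \<tau> N c d + lyap \<tau> N c e"
  using Bochner_Integration.integral_add[OF inner_integrable[OF assms(1,2)] inner_integrable[OF assms(1,3)]]
  by (simp add: lyap_def cross_add_right[OF assms] algebra_simps)

lemma lyap_scale_right: "lyap \<tau> N c (\<lambda>j. of_real r * d j) = r * lyap \<tau> N c d"
proof -
  have "(\<integral>j. c j * cnj (of_real r * d j) \<partial>Zm) = of_real r * (\<integral>j. c j * cnj (d j) \<partial>Zm)"
    by (subst integral_mult_right_zero[symmetric]) (simp add: algebra_simps)
  then show ?thesis by (simp add: lyap_def cross_scale_right algebra_simps)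
qed

lemma lyap_bound:
  assumes "sqi Zm c" "sqi Zm d"
  shows "\<bar>lyap \<tau> N c d\<bar> \<le> (1 + \<bar>\<tau>\<bar>) * (l2n Zm c * l2n Zm d)"
proof -
  have "cmod (\<integral>j. c j * cnj (d j) \<partial>Zm) \<le> l2n Zm c * l2n Zm d"
    using l2n_integral_mult_le[OF assms(1) sqi_cnj[OF assms(2)]] by (simp add: l2n_def)
  then have 1: "\<bar>Re (\<integral>j. c j * cnj (d j) \<partial>Zm)\<bar> \<le> l2n Zm c * l2n Zm d"
    using abs_Re_le_cmod order_trans by blast
  have "\<bar>Re (cross N c d)\<bar> \<le> 2 * (l2n Zm c * l2n Zm d)"
    using cross_bound[OF assms] abs_Re_le_cmod order_trans by blast
  then have "\<bar>\<tau>\<bar> * \<bar>Re (cross N c d)\<bar> \<le> \<bar>\<tau>\<bar> * (2 * (l2n Zm c * l2n Zm d))"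
    by (rule mult_left_mono) simp
  then have 2: "\<bar>\<tau> / 2 * Re (cross N c d)\<bar> \<le> \<bar>\<tau>\<bar> * (l2n Zm c * l2n Zm d)"
    by (simp add: abs_mult)
  from 1 2 show ?thesis unfolding lyap_def by (simp add: distrib_right)
qed

text \<open>The weight is at most 1 and shifts are isometries. For |\<tau>| <= 1/2 this is
  coercivity: the functional lies between 1/2 and 3/2 of the squared norm. For \<tau> = 0 the two
  coincide.\<close>

lemma lyap_diag:
  assumes "sqi Zm c"
  shows "\<bar>lyap \<tau> N c c - (l2n Zm c)\<^sup>2\<bar> \<le> \<bar>\<tau>\<bar> * (l2n Zm c)\<^sup>2"
proof -
  have "(\<integral>j. c j * cnj (c j) \<partial>Zm) = of_real ((l2n Zm c)\<^sup>2)"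
    by (rule integral_mult_cnj_self)
  then have *: "lyap \<tau> N c c - (l2n Zm c)\<^sup>2 = \<tau> / 2 * Re (cross N c c)"
    by (simp add: lyap_def)
  have "\<bar>Re (cross N c c)\<bar> \<le> 2 * (l2n Zm c * l2n Zm c)"
    using cross_bound[OF assms assms] abs_Re_le_cmod order_trans by blast
  then have "\<bar>\<tau>\<bar> * \<bar>Re (cross N c c)\<bar> \<le> \<bar>\<tau>\<bar> * (2 * (l2n Zm c * l2n Zm c))"
    by (rule mult_left_mono) simp
  then show ?thesis unfolding * by (simp add: abs_mult power2_eq_square)
qed

text \<open>The commutator bound is applied frequency by frequency, and absolute summability of
  \<open>b\<close> allows the errors to be added. Only the index \<open>m\<close> leaves a term that
  is not controlled by \<open>J\<close>.\<close>

lemma commutator_series: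
  fixes b :: "nat \<Rightarrow> real" and s :: "nat \<Rightarrow> int"
  assumes c: "sqi Zm c" and dc: "sqi Zm (\<lambda>i. of_int i * c i)" and Vi: "sqi Zm V"
    and b: "summable (\<lambda>n. \<bar>b n\<bar>)"
    and V: "\<And>j. V j = (\<Sum>n. of_real (b n) * (c (j - s n) - c (j + s n)))"
    and s: "\<And>n. s n > 0" and N: "s m = N" and sep: "\<And>n. n \<noteq> m \<Longrightarrow> 3 * s n \<le> N \<or> 3 * N \<le> s n"
  defines "J \<equiv> l2n Zm c * l2n Zm (\<lambda>i. of_int i * c i)"
  shows "cmod (cross N c V - of_real (b m * (l2n Zm c)\<^sup>2))
       \<le> 5 * J * (\<Sum>n. \<bar>b n\<bar> * min (of_int (s n) / (of_int N)\<^sup>2) (1 / of_int (s n)))"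
proof -
  have J: "J \<ge> 0" by (simp add: J_def)
  have N0: "N > 0" using s[of m] N by simp
  define y1 where "y1 n = (\<integral>j. of_real (ramp N j) * ((c (j - s n) - c (j + s n)) * cnj (c (j + N))) \<partial>Zm)" for n
  define y2 where "y2 n = (\<integral>j. of_real (ramp N j) * (c j * cnj (c (j + N - s n) - c (j + N + s n))) \<partial>Zm)" for n
  define g where "g n = min (of_int (s n) / (of_int N)\<^sup>2) (1 / of_int (s n) :: real)" for n
  have sq: "sqi Zm (\<lambda>j. c (j - s n) - c (j + s n))" for n
    by (intro sqi_diff sqi_shift_minus sqi_shift c)
  have rc: "sqi Zm (\<lambda>j. of_real (ramp N j) * cnj (c (j + a)))" for a
    by (rule sqi_mult_bounded[OF sqi_cnj[OF sqi_shift[OF c]], of _ 1]) (simp_all add: ramp_bounds)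
  have 1: "(\<lambda>n. of_real (b n) * y1 n) sums (\<integral>j. of_real (ramp N j) * (V j * cnj (c (j + N))) \<partial>Zm)"
    using shear_exchange[OF b c rc[of N] V] by (simp add: y1_def mult.left_commute mult.assoc)
  \<comment> \<open>The shear now sits in the conjugated slot; translating the index by N and
    conjugating brings the sum into the form of \<open>shear_exchange\<close>.\<close>
  have 2: "(\<lambda>n. of_real (b n) * y2 n) sums (\<integral>j. of_real (ramp N j) * (c j * cnj (V (j + N))) \<partial>Zm)"
  proof -
    have "sqi Zm (\<lambda>j. of_real (ramp N j) * cnj (c j))" using rc[of 0] by simp
    from sqi_shift_minus[OF this, of N]
    have "(\<lambda>n. of_real (b n) * (\<integral>j. (c (j - s n) - c (j + s n)) * (of_real (ramp N (j - N)) * cnj (c (j - N))) \<partial>Zm))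
        sums (\<integral>j. V j * (of_real (ramp N (j - N)) * cnj (c (j - N))) \<partial>Zm)"
      by (rule shear_exchange[OF b c _ V])
    then have "(\<lambda>n. cnj (of_real (b n) * (\<integral>j. (c (j - s n) - c (j + s n)) * (of_real (ramp N (j - N)) * cnj (c (j - N))) \<partial>Zm)))
        sums cnj (\<integral>j. V j * (of_real (ramp N (j - N)) * cnj (c (j - N))) \<partial>Zm)"
      by (simp only: sums_cnj)
    moreover have "cnj (\<integral>j. (c (j - s n) - c (j + s n)) * (of_real (ramp N (j - N)) * cnj (c (j - N))) \<partial>Zm) = y2 n" for n
      unfolding y2_def
      unfolding cnj_integral_shift[of _ N] by (simp add: algebra_simps)
    moreover have "cnj (\<integral>j. V j * (of_real (ramp N (j - N)) * cnj (c (j - N))) \<partial>Zm)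
        = (\<integral>j. of_real (ramp N j) * (c j * cnj (V (j + N))) \<partial>Zm)"
      unfolding cnj_integral_shift[of _ N] by (simp add: algebra_simps)
    ultimately show ?thesis by simp
  qed
  have X: "(\<lambda>n. of_real (b n) * (y1 n + y2 n)) sums cross N c V"
    using sums_add[OF 1 2] by (simp add: cross_split[OF c Vi] algebra_simps)
  have "(\<lambda>n. if n = m then of_real (b m * (l2n Zm c)\<^sup>2) else 0) sums (of_real (b m * (l2n Zm c)\<^sup>2) :: complex)"
    by (rule sums_single)
  from sums_diff[OF X this]
  have *: "(\<lambda>n. of_real (b n) * (y1 n + y2 n - (if s n = N then of_real ((l2n Zm c)\<^sup>2) else 0)))
      sums (cross N c V - of_real (b m * (l2n Zm c)\<^sup>2))"
  proof (rule sums_cong[THEN iffD1, rotated])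
    fix n
    have "s n = N \<longleftrightarrow> n = m" using sep[of n] N N0 by force
    then show "of_real (b n) * (y1 n + y2 n) - (if n = m then of_real (b m * (l2n Zm c)\<^sup>2) else 0)
      = of_real (b n) * (y1 n + y2 n - (if s n = N then of_real ((l2n Zm c)\<^sup>2) else 0))"
      by (auto simp: algebra_simps)
  qed
  have y: "cmod (y1 n + y2 n - (if s n = N then of_real ((l2n Zm c)\<^sup>2) else 0)) \<le> 5 * J * g n" for n
  proof -
    have "integrable Zm (\<lambda>j. of_real (ramp N j) * (c j * cnj (c (j + N - s n) - c (j + N + s n))))"
      using ramp_integrable[OF c sq[of n], of N] by (simp add: algebra_simps)
    then have "y1 n + y2 n = (\<integral>j. of_real (ramp N j) * ((c (j - s n) - c (j + s n)) * cnj (c (j + N)))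
               + of_real (ramp N j) * (c j * cnj (c (j + N - s n) - c (j + N + s n))) \<partial>Zm)"
      unfolding y1_def y2_def
      by (rule Bochner_Integration.integral_add[OF ramp_integrable[OF sq c], symmetric])
    moreover have "3 * s n \<le> N \<or> 3 * N \<le> s n \<or> s n = N" using sep[of n] N by blast
    ultimately show ?thesis
      using commutator_bound[OF c dc N0 s[of n]] by (simp add: J_def g_def)
  qed
  have g1: "0 \<le> g n" "g n \<le> 1" for n
    using s[of n] N0 by (auto simp: g_def intro: min.coboundedI2)
  have bg: "summable (\<lambda>n. \<bar>b n\<bar> * g n)"
    by (rule summable_comparison_test'[OF b, of 0]) (use g1 in \<open>auto simp: abs_mult intro: mult_left_le\<close>)
  have sm: "summable (\<lambda>n. 5 * J * (\<bar>b n\<bar> * g n))" by (rule summable_mult[OF bg])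
  have le: "cmod (of_real (b n) * (y1 n + y2 n - (if s n = N then of_real ((l2n Zm c)\<^sup>2) else 0)))
      \<le> 5 * J * (\<bar>b n\<bar> * g n)" for n
    using mult_left_mono[OF y[of n], of "\<bar>b n\<bar>"] by (simp only: norm_mult norm_of_real abs_ge_zero) (simp add: mult_ac)
  have "cmod (cross N c V - of_real (b m * (l2n Zm c)\<^sup>2))
     = cmod (\<Sum>n. of_real (b n) * (y1 n + y2 n - (if s n = N then of_real ((l2n Zm c)\<^sup>2) else 0)))"
    using sums_unique[OF *] by simp
  also have "\<dots> \<le> (\<Sum>n. 5 * J * (\<bar>b n\<bar> * g n))"
    by (rule norm_suminf_le[OF le sm])
  also have "\<dots> = 5 * J * (\<Sum>n. \<bar>b n\<bar> * g n)"
    by (rule suminf_mult[OF bg])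
  finally show ?thesis by (simp add: g_def)
qed

text \<open>Translations by t and by -t are adjoint to each other, so their difference is
  skew-adjoint and contributes nothing to the energy.\<close>

lemma shear_skew:
  fixes b :: "nat \<Rightarrow> real" and s :: "nat \<Rightarrow> int"
  assumes c: "sqi Zm c" and b: "summable (\<lambda>n. \<bar>b n\<bar>)"
    and V: "\<And>j. V j = (\<Sum>n. of_real (b n) * (c (j - s n) - c (j + s n)))"
  shows "Re (\<integral>j. c j * cnj (V j) \<partial>Zm) = 0"
proof -
  have "Re (\<integral>j. (c (j - t) - c (j + t)) * cnj (c j) \<partial>Zm) = 0" for t
  proof -
    have i: "integrable Zm (\<lambda>j. c (j + a) * cnj (c j))" for a
      by (rule inner_integrable[OF sqi_shift[OF c] c])
    have "(\<integral>j. c (j - t) * cnj (c j) \<partial>Zm) = (\<integral>j. c j * cnj (c (j + t)) \<partial>Zm)"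
      by (subst Zm_integral_shift[of _ t, symmetric]) simp
    also have "\<dots> = cnj (\<integral>j. c (j + t) * cnj (c j) \<partial>Zm)"
      by (simp add: mult.commute flip: Bochner_Integration.integral_cnj)
    finally have "Re (\<integral>j. c (j - t) * cnj (c j) \<partial>Zm) = Re (\<integral>j. c (j + t) * cnj (c j) \<partial>Zm)" by simp
    then show ?thesis
      using Bochner_Integration.integral_diff[OF i[of "-t"] i[of t]] by (simp add: left_diff_distrib)
  qed
  then have "(\<lambda>n. Re (of_real (b n) * (\<integral>j. (c (j - s n) - c (j + s n)) * cnj (c j) \<partial>Zm))) = (\<lambda>n. 0)"
    by simp
  moreover have "(\<lambda>n. Re (of_real (b n) * (\<integral>j. (c (j - s n) - c (j + s n)) * cnj (c j) \<partial>Zm)))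
     sums Re (\<integral>j. V j * cnj (c j) \<partial>Zm)"
    by (intro sums_Re shear_exchange[OF b c sqi_cnj[OF c] V])
  ultimately have "Re (\<integral>j. V j * cnj (c j) \<partial>Zm) = 0"
    using sums_unique2 sums_zero by metis
  moreover have "(\<integral>j. V j * cnj (c j) \<partial>Zm) = cnj (\<integral>j. c j * cnj (V j) \<partial>Zm)"
    by (simp add: mult.commute flip: Bochner_Integration.integral_cnj)
  ultimately show ?thesis by simp
qed

text \<open>Second powers of the index must not survive, because only the norm of j c_j is
  dissipated. With x = j and y = j + N, write x^2 + y^2 = 2|x||y| + (|x| - |y|)^2. The difference
  ||x| - |y|| is at most N and at most |x| + |y|, so its square is at most N (|x| + |y|), and each
  factor carries at most one power of its index.\<close>

lemma cross_diffusion_bound: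
  fixes c :: "int \<Rightarrow> complex"
  assumes c: "sqi Zm c" and dc: "sqi Zm (\<lambda>i. of_int i * c i)" and N: "N > 0"
  defines "D \<equiv> l2n Zm (\<lambda>i. of_int i * c i)"
  shows "cmod (cross N c (\<lambda>j. of_int (j\<^sup>2) * c j)) \<le> 2 * D\<^sup>2 + 2 * of_int N * (l2n Zm c * D)"
proof -
  define F where "F j = 2 * (cmod (of_int j * c j) * cmod (of_int (j + N) * c (j + N)))
     + of_int N * (cmod (of_int j * c j) * cmod (c (j + N)) + cmod (c j) * cmod (of_int (j + N) * c (j + N)))" for j
  have i: "integrable Zm (\<lambda>j. cmod (of_int j * c j) * cmod (of_int (j + N) * c (j + N)))"
    "integrable Zm (\<lambda>j. cmod (of_int j * c j) * cmod (c (j + N)))"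
    "integrable Zm (\<lambda>j. cmod (c j) * cmod (of_int (j + N) * c (j + N)))"
    by (rule sqi_integrable_cmod_mult dc c sqi_shift[OF dc] sqi_shift[OF c])+
  have le: "cmod (of_real (ramp N j) * (c j * cnj (of_int ((j + N)\<^sup>2) * c (j + N)) + of_int (j\<^sup>2) * c j * cnj (c (j + N)))) \<le> F j"
    for j
  proof -
    define x y where "x = (of_int j :: real)" and "y = (of_int (j + N) :: real)"
    have y: "y = x + of_int N" by (simp add: x_def y_def)
    have "(\<bar>x\<bar> - \<bar>y\<bar>)\<^sup>2 \<le> of_int N * (\<bar>x\<bar> + \<bar>y\<bar>)"
    proof -
      have "\<bar>\<bar>x\<bar> - \<bar>y\<bar>\<bar> \<le> of_int N" "\<bar>\<bar>x\<bar> - \<bar>y\<bar>\<bar> \<le> \<bar>x\<bar> + \<bar>y\<bar>"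
        using N unfolding y by auto
      then have "\<bar>\<bar>x\<bar> - \<bar>y\<bar>\<bar> * \<bar>\<bar>x\<bar> - \<bar>y\<bar>\<bar> \<le> of_int N * (\<bar>x\<bar> + \<bar>y\<bar>)"
        using N by (intro mult_mono) auto
      then show ?thesis by (simp add: power2_eq_square)
    qed
    then have xy: "x\<^sup>2 + y\<^sup>2 \<le> 2 * (\<bar>x\<bar> * \<bar>y\<bar>) + of_int N * (\<bar>x\<bar> + \<bar>y\<bar>)"
      by (simp add: power2_diff algebra_simps)
    have "c j * cnj (of_int ((j + N)\<^sup>2) * c (j + N)) + of_int (j\<^sup>2) * c j * cnj (c (j + N))
        = of_real (x\<^sup>2 + y\<^sup>2) * (c j * cnj (c (j + N)))"
      by (simp add: x_def y_def algebra_simps)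
    then have "cmod (of_real (ramp N j) * (c j * cnj (of_int ((j + N)\<^sup>2) * c (j + N)) + of_int (j\<^sup>2) * c j * cnj (c (j + N))))
        = \<bar>ramp N j\<bar> * (\<bar>x\<^sup>2 + y\<^sup>2\<bar> * (cmod (c j) * cmod (c (j + N))))"
      by (simp only: norm_mult norm_of_real complex_mod_cnj)
    also have "\<dots> \<le> 1 * (\<bar>x\<^sup>2 + y\<^sup>2\<bar> * (cmod (c j) * cmod (c (j + N))))"
      using ramp_bounds[of N j] by (intro mult_right_mono) auto
    also have "\<dots> \<le> (2 * (\<bar>x\<bar> * \<bar>y\<bar>) + of_int N * (\<bar>x\<bar> + \<bar>y\<bar>)) * (cmod (c j) * cmod (c (j + N)))"
      using xy by (simp add: mult_right_mono)
    also have "\<dots> = F j"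
      unfolding F_def norm_mult norm_of_int x_def y_def by (simp add: algebra_simps)
    finally show ?thesis .
  qed
  have "cmod (cross N c (\<lambda>j. of_int (j\<^sup>2) * c j))
      \<le> (\<integral>j. cmod (of_real (ramp N j) * (c j * cnj (of_int ((j + N)\<^sup>2) * c (j + N)) + of_int (j\<^sup>2) * c j * cnj (c (j + N)))) \<partial>Zm)"
    unfolding cross_def by (rule integral_norm_bound)
  also have "\<dots> \<le> (\<integral>j. F j \<partial>Zm)"
  proof (rule integral_mono'[OF _ le])
    show "integrable Zm F"
      unfolding F_def by (intro Bochner_Integration.integrable_add integrable_mult_right i)
    show "0 \<le> F j" for j unfolding F_def using N by simp
  qed
  also have "(\<integral>j. F j \<partial>Zm) = 2 * (\<integral>j. cmod (of_int j * c j) * cmod (of_int (j + N) * c (j + N)) \<partial>Zm)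
     + of_int N * ((\<integral>j. cmod (of_int j * c j) * cmod (c (j + N)) \<partial>Zm) + (\<integral>j. cmod (c j) * cmod (of_int (j + N) * c (j + N)) \<partial>Zm))"
    unfolding F_def
    by (simp only: Bochner_Integration.integral_add integral_mult_right_zero Bochner_Integration.integrable_add integrable_mult_right i)
  also have "\<dots> \<le> 2 * (D * D) + of_int N * (D * l2n Zm c + l2n Zm c * D)"
    using l2n_Cauchy_Schwarz[OF dc sqi_shift[OF dc, of N]] l2n_Cauchy_Schwarz[OF dc sqi_shift[OF c, of N]]
      l2n_Cauchy_Schwarz[OF c sqi_shift[OF dc, of N]] N
    unfolding l2n_shift[of c N] l2n_shift[of "\<lambda>i. of_int i * c i" N] D_def
    by (intro add_mono mult_left_mono) auto
  finally show ?thesis by (simp add: power2_eq_square algebra_simps)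
qed

text \<open>The derivative of the functional along the equation, before any constant is chosen. Here
  \<kappa> is the mode number and \<mu> the damping due to diffusion in x. \<open>D\<close> is the
  norm of j c_j, but it is exported merely as some nonnegative number, which is all that the later
  optimisation uses. With \<tau> = 0 this is the plain energy estimate.\<close>

lemma lyap_dissipation:
  fixes b :: "nat \<Rightarrow> real" and s :: "nat \<Rightarrow> int"
  assumes c: "sqi Zm c" and gi: "sqi Zm g" and Vi: "sqi Zm V"
    and b: "summable (\<lambda>n. \<bar>b n\<bar>)"
    and V: "\<And>j. V j = (\<Sum>n. of_real (b n) * (c (j - s n) - c (j + s n)))"
    and s: "\<And>n. s n > 0" and N: "s m = N" and sep: "\<And>n. n \<noteq> m \<Longrightarrow> 3 * s n \<le> N \<or> 3 * N \<le> s n"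
    and nu: "\<nu> > 0"
    and g: "\<And>j. g j = - of_real (\<mu> + \<nu> * (of_int j)\<^sup>2) * c j - of_real (\<kappa> / 2) * V j"
  obtains D where "D \<ge> 0"
    "2 * lyap \<tau> N c g \<le> - 2 * \<nu> * D\<^sup>2 - 2 * \<mu> * lyap \<tau> N c c
       + \<bar>\<tau>\<bar> * (2 * \<nu> * D\<^sup>2 + 2 * \<nu> * of_int N * (l2n Zm c * D)) - \<tau> * \<kappa> * b m * (l2n Zm c)\<^sup>2 / 2
       + 5 / 2 * \<bar>\<tau> * \<kappa>\<bar> * (l2n Zm c * D)
         * (\<Sum>n. \<bar>b n\<bar> * min (of_int (s n) / (of_int N)\<^sup>2) (1 / of_int (s n)))"
proof -
  define \<Gamma> where "\<Gamma> = (\<Sum>n. \<bar>b n\<bar> * min (of_int (s n) / (of_int N)\<^sup>2) (1 / of_int (s n) :: real))"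
  have N0: "N > 0" using s[of m] N by simp
  define e where "e j = of_int (j\<^sup>2) * c j" for j
  \<comment> \<open>Solving the equation for j^2 c_j expresses it through square summable sequences;
    this is where the domain regularity of \<open>c\<close> comes from.\<close>
  have e_eq: "e = (\<lambda>j. of_real (- 1 / \<nu>) * (g j + of_real \<mu> * c j + of_real (\<kappa> / 2) * V j))"
    using nu by (auto simp: e_def g fun_eq_iff field_simps)
  have e: "sqi Zm e"
    unfolding e_eq by (intro sqi_cmult sqi_add gi c Vi)
  have dc: "sqi Zm (\<lambda>i. of_int i * c i)"
  proof (rule sqi_bound[OF e, of _ 1])
    have "\<bar>i\<bar> \<le> i\<^sup>2" for i :: int
      using self_le_power[of "\<bar>i\<bar>" 2] by (cases "i = 0") auto
    then have "\<bar>of_int i :: real\<bar> \<le> of_int (i\<^sup>2)" for i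
      by (metis of_int_abs of_int_le_iff)
    then show "AE i in Zm. cmod (of_int i * c i) \<le> 1 * cmod (e i)"
      by (auto simp: e_def norm_mult norm_power intro!: AE_I2 mult_right_mono)
  qed simp
  define D where "D = l2n Zm (\<lambda>i. of_int i * c i)"
  define J where "J = l2n Zm c * D"
  have g_eq: "g = (\<lambda>j. of_real (- \<mu>) * c j + (of_real (- \<nu>) * e j + of_real (- \<kappa> / 2) * V j))"
    by (auto simp: e_def g fun_eq_iff field_simps)
  have split: "lyap \<tau> N c g = - \<mu> * lyap \<tau> N c c - \<nu> * lyap \<tau> N c e - \<kappa> / 2 * lyap \<tau> N c V"
    unfolding g_eq
    by (simp add: lyap_add_right lyap_scale_right c e Vi sqi_add sqi_cmult del: of_real_minus of_real_divide)
  have "(\<integral>j. c j * cnj (e j) \<partial>Zm) = (\<integral>j. (of_int j * c j) * cnj (of_int j * c j) \<partial>Zm)"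
    by (simp add: e_def power2_eq_square mult_ac)
  also have "\<dots> = of_real (D\<^sup>2)" unfolding D_def by (rule integral_mult_cnj_self)
  finally have le: "lyap \<tau> N c e = D\<^sup>2 + \<tau> / 2 * Re (cross N c e)"
    by (simp add: lyap_def)
  have lV: "lyap \<tau> N c V = \<tau> / 2 * Re (cross N c V)"
    using shear_skew[OF c b V] by (simp add: lyap_def)
  have "\<bar>Re (cross N c e)\<bar> \<le> 2 * D\<^sup>2 + 2 * of_int N * J"
    using cross_diffusion_bound[OF c dc N0] abs_Re_le_cmod[of "cross N c e"]
    unfolding e_def[abs_def] D_def J_def by linarith
  then have "\<bar>\<tau>\<bar> * \<bar>Re (cross N c e)\<bar> \<le> \<bar>\<tau>\<bar> * (2 * D\<^sup>2 + 2 * of_int N * J)"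
    by (rule mult_left_mono) simp
  then have "- (\<tau> * Re (cross N c e)) \<le> \<bar>\<tau>\<bar> * (2 * D\<^sup>2 + 2 * of_int N * J)"
    by (simp flip: abs_mult)
  then have t1: "\<nu> * - (\<tau> * Re (cross N c e)) \<le> \<nu> * (\<bar>\<tau>\<bar> * (2 * D\<^sup>2 + 2 * of_int N * J))"
    using nu by (intro mult_left_mono) auto
  have "\<bar>Re (cross N c V - of_real (b m * (l2n Zm c)\<^sup>2))\<bar> \<le> 5 * J * \<Gamma>"
    using commutator_series[OF c dc Vi b V s N sep] abs_Re_le_cmod[of "cross N c V - of_real (b m * (l2n Zm c)\<^sup>2)"]
    unfolding J_def D_def \<Gamma>_def by linarith
  then have "\<bar>\<tau> * \<kappa>\<bar> * \<bar>Re (cross N c V) - b m * (l2n Zm c)\<^sup>2\<bar> \<le> \<bar>\<tau> * \<kappa>\<bar> * (5 * J * \<Gamma>)"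
    by (intro mult_left_mono) auto
  then have t2: "- (\<tau> * \<kappa> * (Re (cross N c V) - b m * (l2n Zm c)\<^sup>2)) \<le> \<bar>\<tau> * \<kappa>\<bar> * (5 * J * \<Gamma>)"
    by (simp flip: abs_mult)
  have eq: "2 * lyap \<tau> N c g = - 2 * \<nu> * D\<^sup>2 - 2 * \<mu> * lyap \<tau> N c c + \<nu> * - (\<tau> * Re (cross N c e))
     + 1 / 2 * - (\<tau> * \<kappa> * (Re (cross N c V) - b m * (l2n Zm c)\<^sup>2)) - \<tau> * \<kappa> * b m * (l2n Zm c)\<^sup>2 / 2"
    unfolding split le lV by (simp add: algebra_simps)
  have "2 * lyap \<tau> N c g \<le> - 2 * \<nu> * D\<^sup>2 - 2 * \<mu> * lyap \<tau> N c c
       + \<nu> * (\<bar>\<tau>\<bar> * (2 * D\<^sup>2 + 2 * of_int N * J)) + 1 / 2 * (\<bar>\<tau> * \<kappa>\<bar> * (5 * J * \<Gamma>)) - \<tau> * \<kappa> * b m * (l2n Zm c)\<^sup>2 / 2"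
    unfolding eq by (intro diff_right_mono add_mono t1 mult_left_mono t2 order_refl) auto
  also have "\<dots> = - 2 * \<nu> * D\<^sup>2 - 2 * \<mu> * lyap \<tau> N c c
       + \<bar>\<tau>\<bar> * (2 * \<nu> * D\<^sup>2 + 2 * \<nu> * of_int N * J) - \<tau> * \<kappa> * b m * (l2n Zm c)\<^sup>2 / 2
       + 5 / 2 * \<bar>\<tau> * \<kappa>\<bar> * J * \<Gamma>"
    by (simp add: algebra_simps)
  finally show ?thesis using that[of D] unfolding J_def \<Gamma>_def D_def by simp
qed

text \<open>The dissipation -2 \<nu> D^2 is split in two. One half absorbs 2 \<beta> \<nu> D^2, by
  \<beta> <= 1/2; the other absorbs all products E D by Young's inequality. The sign of \<tau> makes
  the main term -\<beta> |\<kappa> b m| E^2 / 2, which \<open>low\<close> bounds by -(\<beta>/54)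
  \<nu> N^2 E^2. Young's inequality takes back half of this, and E^2 >= (2/3) \<open>lyap\<close>
  turns the remaining \<beta>/108 into \<beta>/162.\<close>

lemma lyap_decay:
  fixes b :: "nat \<Rightarrow> real" and s :: "nat \<Rightarrow> int"
  assumes c: "sqi Zm c" and gi: "sqi Zm g" and Vi: "sqi Zm V"
    and b: "summable (\<lambda>n. \<bar>b n\<bar>)"
    and V: "\<And>j. V j = (\<Sum>n. of_real (b n) * (c (j - s n) - c (j + s n)))"
    and s: "\<And>n. s n > 0" and N: "s m = N" and sep: "\<And>n. n \<noteq> m \<Longrightarrow> 3 * s n \<le> N \<or> 3 * N \<le> s n"
    and nu: "\<nu> > 0" and mu: "\<mu> \<ge> 0"
    and g: "\<And>j. g j = - of_real (\<mu> + \<nu> * (of_int j)\<^sup>2) * c j - of_real (\<kappa> / 2) * V j"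
    and low: "\<nu> * (of_int N)\<^sup>2 \<le> 27 * \<bar>\<kappa> * b m\<bar>"
    and up: "\<bar>\<kappa>\<bar> * (\<Sum>n. \<bar>b n\<bar> * min (of_int (s n) / (of_int N)\<^sup>2) (1 / of_int (s n))) \<le> K * \<nu> * of_int N"
    and beta: "0 < \<beta>" "\<beta> \<le> 1 / 2" "\<beta> * (2 + 5 / 2 * K)\<^sup>2 \<le> 1 / 27"
    and tau: "\<tau> = \<beta> * sgn (\<kappa> * b m)"
  shows "2 * lyap \<tau> N c g \<le> - (\<beta> / 162 * \<nu> * (of_int N)\<^sup>2) * lyap \<tau> N c c"
proof -
  define \<Gamma> where "\<Gamma> = (\<Sum>n. \<bar>b n\<bar> * min (of_int (s n) / (of_int N)\<^sup>2) (1 / of_int (s n) :: real))"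
  define r where "r = (of_int N :: real)"
  have r: "r > 0" using s[of m] N by (simp add: r_def)
  define E where "E = l2n Zm c"
  have E0: "E \<ge> 0" by (simp add: E_def)
  obtain D where D: "D \<ge> 0" and main: "2 * lyap \<tau> N c g \<le> - 2 * \<nu> * D\<^sup>2 - 2 * \<mu> * lyap \<tau> N c c
       + \<bar>\<tau>\<bar> * (2 * \<nu> * D\<^sup>2 + 2 * \<nu> * r * (E * D)) - \<tau> * \<kappa> * b m * E\<^sup>2 / 2
       + 5 / 2 * \<bar>\<tau> * \<kappa>\<bar> * (E * D) * \<Gamma>"
    using lyap_dissipation[OF c gi Vi b V s N sep nu g, of \<tau>] unfolding \<Gamma>_def r_def E_def by blast
  have "0 < \<nu> * r\<^sup>2" using nu r by simp
  \<comment> \<open>The bound \<open>low\<close> excludes a vanishing product, so \<open>sgn\<close>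
    is not at its value 0 and |\<tau>| is exactly \<beta>.\<close>
  then have kb: "\<kappa> * b m \<noteq> 0" using low by (auto simp: r_def)
  have at: "\<bar>\<tau>\<bar> = \<beta>" using kb beta(1) unfolding tau abs_mult abs_sgn_eq by auto
  have tk: "\<tau> * \<kappa> * b m = \<beta> * \<bar>\<kappa> * b m\<bar>"
    unfolding tau by (simp add: mult.assoc abs_sgn mult.commute)
  define B where "B = 2 + 5 / 2 * K"
  have lyE: "\<bar>lyap \<tau> N c c - E\<^sup>2\<bar> \<le> 1 / 2 * E\<^sup>2"
  proof -
    have "\<bar>\<tau>\<bar> * E\<^sup>2 \<le> 1 / 2 * E\<^sup>2" using at beta(2) by (intro mult_right_mono) auto
    then show ?thesis using lyap_diag[OF c, of \<tau> N] unfolding E_def by linarith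
  qed
  have ly0: "0 \<le> lyap \<tau> N c c" "lyap \<tau> N c c \<le> 3 / 2 * E\<^sup>2"
    using lyE zero_le_power2[of E] by linarith+
  have t1: "5 / 2 * \<bar>\<tau> * \<kappa>\<bar> * (E * D) * \<Gamma> \<le> \<beta> * (E * D) * (5 / 2 * K * \<nu> * r)"
  proof -
    have "5 / 2 * \<bar>\<tau> * \<kappa>\<bar> * (E * D) * \<Gamma> = (5 / 2 * \<beta> * (E * D)) * (\<bar>\<kappa>\<bar> * \<Gamma>)"
      by (simp add: abs_mult at)
    also have "\<dots> \<le> (5 / 2 * \<beta> * (E * D)) * (K * \<nu> * r)"
      using up beta(1) E0 D unfolding \<Gamma>_def r_def by (intro mult_left_mono) auto
    finally show ?thesis by (simp add: algebra_simps)
  qed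
  have t2: "\<beta> * (\<nu> * r\<^sup>2 / 27) * E\<^sup>2 / 2 \<le> \<tau> * \<kappa> * b m * E\<^sup>2 / 2"
    unfolding tk using low beta(1) unfolding r_def by (intro divide_right_mono mult_right_mono mult_left_mono) auto
  \<comment> \<open>Completing the square leaves \<beta>^2 B^2 r^2 E^2 / 4, and \<beta> B^2 <= 1/27
    turns this into the fraction \<beta>/108.\<close>
  have t3: "\<beta> * (r * B) * (E * D) \<le> D\<^sup>2 + \<beta> / 108 * r\<^sup>2 * E\<^sup>2"
  proof -
    have "0 \<le> (D - \<beta> * (r * B) * E / 2)\<^sup>2" by simp
    then have "\<beta> * (r * B) * (E * D) \<le> D\<^sup>2 + \<beta> * (\<beta> * B\<^sup>2) * r\<^sup>2 * E\<^sup>2 / 4"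
      by (simp add: power2_eq_square algebra_simps)
    also have "\<beta> * (\<beta> * B\<^sup>2) * r\<^sup>2 * E\<^sup>2 / 4 \<le> \<beta> * (1 / 27) * r\<^sup>2 * E\<^sup>2 / 4"
      using beta unfolding B_def by (intro divide_right_mono mult_right_mono mult_left_mono) auto
    finally show ?thesis by simp
  qed
  have t3': "\<beta> * (2 * \<nu> * r * (E * D)) + \<beta> * (E * D) * (5 / 2 * K * \<nu> * r) \<le> \<nu> * D\<^sup>2 + \<beta> / 108 * \<nu> * r\<^sup>2 * E\<^sup>2"
    using mult_left_mono[OF t3, of \<nu>] nu unfolding B_def by (simp add: algebra_simps)
  have t4: "\<beta> * (2 * \<nu> * D\<^sup>2) \<le> 1 / 2 * (2 * \<nu> * D\<^sup>2)"
    using beta(2) nu by (intro mult_right_mono) auto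
  have t5: "0 \<le> 2 * \<mu> * lyap \<tau> N c c" using mu ly0 by simp
  have "2 * lyap \<tau> N c g \<le> - (\<beta> / 108 * \<nu> * r\<^sup>2 * E\<^sup>2)"
    using main t1 t2 t3' t4 t5 unfolding at by (simp add: algebra_simps)
  also have "\<dots> = - (\<beta> / 162 * \<nu> * r\<^sup>2) * (3 / 2 * E\<^sup>2)" by simp
  also have "\<dots> \<le> - (\<beta> / 162 * \<nu> * r\<^sup>2) * lyap \<tau> N c c"
    using ly0(2) beta(1) nu by (intro mult_left_mono_neg) auto
  finally show ?thesis by (simp add: r_def)
qed

section \<open>Decay from right derivatives\<close>

text \<open>Tilting by a small slope e makes the right derivative strictly negative. If the tilted
  function were positive at T, consider the last time at which it is nonpositive: strict decrease
  just to the right of it yields a later such time.\<close>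

lemma nonincreasing_if_right_derivative_nonpos:
  fixes f :: "real \<Rightarrow> real"
  assumes cont: "continuous_on {0..} f"
    and der: "\<And>t. t \<ge> 0 \<Longrightarrow> \<exists>D\<le>0. (f has_real_derivative D) (at t within {t..})"
    and T: "T \<ge> 0"
  shows "f T \<le> f 0"
proof (rule field_le_epsilon)
  fix e0 :: real assume e0: "e0 > 0"
  define e where "e = e0 / (T + 1)"
  have e: "e > 0" "e * T \<le> e0" using e0 T by (auto simp: e_def field_simps)
  define g where "g s = f s - f 0 - e * s" for s
  have "g T \<le> 0"
  proof (rule ccontr)
    assume "\<not> g T \<le> 0"
    then have gT: "g T > 0" by simp
    define S where "S = {s \<in> {0..T}. g s \<le> 0}"
    have "continuous_on {0..T} g"
      unfolding g_def by (intro continuous_intros continuous_on_subset[OF cont]) auto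
    then have "closed ({0..T} \<inter> g -` {..0})"
      by (intro continuous_closed_preimage) auto
    moreover have "{0..T} \<inter> g -` {..0} = S" by (auto simp: S_def)
    ultimately have "closed S" by simp
    moreover have S: "0 \<in> S" "bdd_above S"
      using T by (auto simp: S_def g_def bdd_above_def)
    ultimately have mem: "Sup S \<in> S"
      by (intro closed_contains_Sup) auto
    define s where "s = Sup S"
    have s: "0 \<le> s" "s \<le> T" "g s \<le> 0" using mem by (auto simp: S_def s_def)
    then have "s < T" using gT by (cases "s = T") auto
    obtain D where D: "D \<le> 0" "(f has_real_derivative D) (at s within {s..})"
      using der[OF s(1)] by blast
    have "(g has_real_derivative (D - e)) (at s within {s..})"
      unfolding g_def by (auto intro!: derivative_eq_intros D(2))
    from has_real_derivative_neg_dec_right[OF this] D(1) e(1)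
    obtain d where d: "d > 0" "\<And>h. 0 < h \<Longrightarrow> s + h \<in> {s..} \<Longrightarrow> h < d \<Longrightarrow> g (s + h) < g s"
      by force
    define h where "h = min (d / 2) (T - s)"
    have h: "h > 0" "h < d" "s + h \<le> T" using d(1) \<open>s < T\<close> by (auto simp: h_def)
    have "s + h \<in> S"
      using d(2)[of h] h s by (auto simp: S_def)
    then have "s + h \<le> s" unfolding s_def using S(2) by (rule cSup_upper)
    then show False using h by simp
  qed
  then show "f T \<le> f 0 + e0" using e by (simp add: g_def)
qed

text \<open>Integrating factor exp (\<kappa> t). Only right derivatives enter, because the generator
  is a limit from the right.\<close>

lemma exponential_decay_if_right_derivative_le:
  fixes f :: "real \<Rightarrow> real"
  assumes cont: "continuous_on {0..} f"
    and der: "\<And>t. t \<ge> 0 \<Longrightarrow> \<exists>D\<le>- (\<kappa> * f t). (f has_real_derivative D) (at t within {t..})"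
    and T: "T \<ge> 0"
  shows "f T \<le> exp (- (\<kappa> * T)) * f 0"
proof -
  have "exp (\<kappa> * T) * f T \<le> exp (\<kappa> * 0) * f 0"
  proof (rule nonincreasing_if_right_derivative_nonpos[OF _ _ T])
    show "continuous_on {0..} (\<lambda>t. exp (\<kappa> * t) * f t)"
      by (intro continuous_intros cont)
    fix t :: real assume "t \<ge> 0"
    then obtain D where D: "D \<le> - (\<kappa> * f t)" "(f has_real_derivative D) (at t within {t..})"
      using der by blast
    have "((\<lambda>t. exp (\<kappa> * t) * f t) has_real_derivative exp (\<kappa> * t) * (\<kappa> * f t + D)) (at t within {t..})"
      by (auto intro!: derivative_eq_intros D(2) simp: algebra_simps)
    moreover have "exp (\<kappa> * t) * (\<kappa> * f t + D) \<le> 0"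
      using D(1) by (intro mult_nonneg_nonpos) auto
    ultimately show "\<exists>D\<le>0. ((\<lambda>t. exp (\<kappa> * t) * f t) has_real_derivative D) (at t within {t..})"
      by blast
  qed
  then have "exp (- (\<kappa> * T)) * (exp (\<kappa> * T) * f T) \<le> exp (- (\<kappa> * T)) * f 0"
    by simp
  then show ?thesis by (simp add: mult.assoc[symmetric] flip: exp_add)
qed

text \<open>A Baire category argument: the points with small oscillation nearby form an open dense set,
  because right-continuity makes the oscillation small just to the right of every point.\<close>

lemma right_continuous_imp_continuity_point:
  fixes d :: "real \<Rightarrow> real \<Rightarrow> real"
  assumes sym: "\<And>s t. s > 0 \<Longrightarrow> t > 0 \<Longrightarrow> d s t = d t s"
    and tri: "\<And>r s t. r > 0 \<Longrightarrow> s > 0 \<Longrightarrow> t > 0 \<Longrightarrow> d r t \<le> d r s + d s t"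
    and rc: "\<And>t e. t > 0 \<Longrightarrow> e > 0 \<Longrightarrow> \<exists>\<delta>>0. \<forall>s\<in>{t..<t + \<delta>}. d s t < e"
    and \<tau>: "\<tau> > 0"
  obtains t where "0 < t" "t < \<tau>" "\<And>e. e > 0 \<Longrightarrow> \<exists>\<delta>>0. \<forall>s>0. \<bar>s - t\<bar> < \<delta> \<longrightarrow> d s t < e"
proof -
  \<comment> \<open>Only positive times are constrained, since \<open>d\<close> is assumed to behave
    like a distance there. Open sets of nonpositive reals are small vacuously, so Baire's theorem
    can be applied on the whole line.\<close>
  define small where "small n U \<longleftrightarrow> open U \<and> (\<forall>x\<in>U. \<forall>y\<in>U. x > 0 \<longrightarrow> y > 0 \<longrightarrow> d x y < inverse (Suc n))"
    for n and U :: "real set"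
  define G where "G n = \<Union> (Collect (small n))" for n
  have opG: "open (G n)" for n
    unfolding G_def by (intro open_Union) (auto simp: small_def)
  have dense: "UNIV \<subseteq> closure (G n)" for n
  proof
    fix x :: real
    show "x \<in> closure (G n)"
      unfolding closure_iff_nhds_not_empty
    proof (intro allI impI)
      fix A U :: "real set" assume U: "U \<subseteq> A" "open U" "x \<in> U"
      show "G n \<inter> A \<noteq> {}"
      proof (cases "U \<inter> {0<..} = {}")
        case True
        then have "small n U" using U by (auto simp: small_def)
        then show ?thesis using U by (auto simp: G_def)
      next
        case False
        then obtain t where t: "t \<in> U" "t > 0" by auto
        obtain r where r: "r > 0" "ball t r \<subseteq> U" using t U open_contains_ball by blast
        obtain \<delta> where del: "\<delta> > 0" "\<And>s. s \<in> {t..<t + \<delta>} \<Longrightarrow> d s t < inverse (Suc n) / 2"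
          using rc[OF t(2), of "inverse (Suc n) / 2"] by auto
        define W where "W = {t<..<t + min r \<delta>}"
        have "small n W"
          unfolding small_def
        proof (intro conjI ballI impI)
          fix x y assume xy: "x \<in> W" "y \<in> W"
          have "d x y \<le> d x t + d t y" using xy t by (intro tri) (auto simp: W_def)
          also have "d t y = d y t" using xy t by (intro sym) (auto simp: W_def)
          also have "d x t + d y t < inverse (Suc n) / 2 + inverse (Suc n) / 2"
            using xy by (intro add_strict_mono del) (auto simp: W_def)
          finally show "d x y < inverse (Suc n)" by simp
        qed (auto simp: W_def)
        moreover have "t + min r \<delta> / 2 \<in> W" using r del by (auto simp: W_def)
        moreover have "t + min r \<delta> / 2 \<in> U" using r del by (auto simp: dist_real_def intro!: subsetD[OF r(2)])
        ultimately show ?thesis using U by (auto simp: G_def)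
      qed
    qed
  qed
  have "UNIV \<subseteq> closure (\<Inter> (range G))"
    by (rule Baire) (use opG dense in auto)
  then have "\<tau> / 2 \<in> closure (\<Inter> (range G))" by auto
  then have "\<Inter> (range G) \<inter> {0<..<\<tau>} \<noteq> {}"
    using \<tau> unfolding closure_iff_nhds_not_empty
    by (metis (no_types, lifting) greaterThanLessThan_iff half_gt_zero_iff field_sum_of_halves
        less_add_same_cancel1 open_greaterThanLessThan order_refl)
  then obtain t where t: "t \<in> \<Inter> (range G)" "0 < t" "t < \<tau>" by auto
  show thesis
  proof (rule that[OF t(2,3)])
    fix e :: real assume "e > 0"
    then obtain n where n: "inverse (Suc n) < e" using reals_Archimedean by blast
    have "t \<in> G n" using t by auto
    then obtain U where U: "small n U" "t \<in> U" by (auto simp: G_def)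
    then obtain r where r: "r > 0" "ball t r \<subseteq> U" using open_contains_ball unfolding small_def by blast
    show "\<exists>\<delta>>0. \<forall>s>0. \<bar>s - t\<bar> < \<delta> \<longrightarrow> d s t < e"
    proof (intro exI[of _ r] conjI allI impI)
      fix s assume "s > 0" "\<bar>s - t\<bar> < r"
      then have "s \<in> U" using r(2) by (auto simp: dist_real_def abs_minus_commute)
      then show "d s t < e" using U t(2) \<open>s > 0\<close> n unfolding small_def by fastforce
    qed (rule r(1))
  qed
qed

section \<open>Fourier coefficients on the torus\<close>

abbreviation Tm :: "(real \<times> real) measure" where "Tm \<equiv> restrict_space lborel torus_cell"

abbreviation Pm :: "real measure" where "Pm \<equiv> restrict_space lborel {0..2 * pi}"

lemma torus_cell_sets [measurable, simp]: "torus_cell \<in> sets borel"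
  unfolding torus_cell_def by (intro borel_closed closed_Times) auto

lemma space_Tm [simp]: "space Tm = torus_cell"
  by (simp add: space_restrict_space)

lemma Tm_integrable: "set_integrable lborel torus_cell f \<longleftrightarrow> integrable Tm f"
  for f :: "_ \<Rightarrow> 'b::{banach, second_countable_topology}"
  by (simp add: set_integrable_def integrable_restrict_space)

lemma Tm_integral: "(LINT z:torus_cell|lborel. f z) = (\<integral>z. f z \<partial>Tm)"
  for f :: "_ \<Rightarrow> 'b::{banach, second_countable_topology}"
  by (simp add: set_lebesgue_integral_def Bochner_Integration.integral_restrict_space)

lemma Pm_integral: "(LINT z:{0..2 * pi}|lborel. f z) = (\<integral>z. f z \<partial>Pm)"
  for f :: "_ \<Rightarrow> 'b::{banach, second_countable_topology}"
  by (simp add: set_lebesgue_integral_def Bochner_Integration.integral_restrict_space)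

lemma measurable_Tm [measurable (raw)]: "f \<in> borel_measurable borel \<Longrightarrow> f \<in> borel_measurable Tm"
  by (rule measurable_restrict_space1) simp

lemma AE_Tm: "AE z in lborel. P z \<Longrightarrow> AE z in Tm. P z"
  by (auto simp: AE_restrict_space_iff elim: eventually_mono)

lemma L2_norm_eq: "L2_norm f = l2n Tm f"
  by (simp add: L2_norm_def l2n_def Tm_integral)

lemma L2_torus_iff: "f \<in> L2_torus \<longleftrightarrow> f \<in> borel_measurable borel \<and> doubly_periodic f \<and> sqi Tm f"
  by (auto simp: L2_torus_def sqi_def Tm_integrable intro: measurable_Tm)

lemma L2_torus_sqi: "f \<in> L2_torus \<Longrightarrow> sqi Tm f"
  by (simp add: L2_torus_iff)

lemma integrable_Tm_iff: "integrable Tm f \<longleftrightarrow> integrable (lborel \<Otimes>\<^sub>M lborel) (\<lambda>z. indicator torus_cell z *\<^sub>R f z)"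
  for f :: "_ \<Rightarrow> 'b::{banach, second_countable_topology}"
  by (simp add: integrable_restrict_space lborel_prod)

lemma indicator_torus_cell:
  "indicator torus_cell (x, y) = (indicator {0..2 * pi} x * indicator {0..2 * pi} y :: real)"
  by (auto simp: torus_cell_def split: split_indicator)

lemma Tm_integral_iterated:
  fixes f :: "real \<times> real \<Rightarrow> 'b::{banach, second_countable_topology}"
  assumes f: "integrable Tm f"
  shows "AE y in Pm. integrable Pm (\<lambda>x. f (x, y))" (is ?A)
    and "integrable Pm (\<lambda>y. \<integral>x. f (x, y) \<partial>Pm)" (is ?B)
    and "(\<integral>z. f z \<partial>Tm) = (\<integral>y. (\<integral>x. f (x, y) \<partial>Pm) \<partial>Pm)" (is ?C)
proof -
  define h where "h x y = indicator torus_cell (x, y) *\<^sub>R f (x, y)" for x y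
  have h: "integrable (lborel \<Otimes>\<^sub>M lborel) (case_prod h)"
    using f unfolding integrable_Tm_iff by (simp add: h_def case_prod_beta')
  have hx: "h x y = indicator {0..2 * pi} y *\<^sub>R (indicator {0..2 * pi} x *\<^sub>R f (x, y))" for x y
    by (simp add: h_def indicator_torus_cell)
  have inner: "(\<integral>x. h x y \<partial>lborel) = indicator {0..2 * pi} y *\<^sub>R (\<integral>x. f (x, y) \<partial>Pm)" for y
    by (simp only: hx integral_scaleR_right) (simp add: Bochner_Integration.integral_restrict_space)
  have "AE y in lborel. integrable lborel (\<lambda>x. h x y)"
    using lborel_pair.AE_integrable_snd[OF h] .
  then have "AE y in lborel. y \<in> {0..2 * pi} \<longrightarrow> integrable Pm (\<lambda>x. f (x, y))"
    by eventually_elim (auto simp: hx integrable_restrict_space)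
  then show ?A by (simp add: AE_restrict_space_iff)
  show ?B using lborel_pair.integrable_snd[OF h]
    by (simp add: inner integrable_restrict_space)
  have "(\<integral>z. f z \<partial>Tm) = integral\<^sup>L (lborel \<Otimes>\<^sub>M lborel) (case_prod h)"
    by (simp add: Bochner_Integration.integral_restrict_space lborel_prod h_def case_prod_beta')
  also have "\<dots> = (\<integral>y. (\<integral>x. h x y \<partial>lborel) \<partial>lborel)"
    by (rule lborel_pair.integral_snd[OF h, symmetric])
  finally show ?C by (simp add: inner Bochner_Integration.integral_restrict_space)
qed

text \<open>The opposite order of integration, for integrating by parts in y.\<close>

lemma Tm_integral_iterated':
  fixes f :: "real \<times> real \<Rightarrow> 'b::{banach, second_countable_topology}"
  assumes f: "integrable Tm f"
  shows "(\<integral>z. f z \<partial>Tm) = (\<integral>x. (\<integral>y. f (x, y) \<partial>Pm) \<partial>Pm)"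
proof -
  define h where "h x y = indicator torus_cell (x, y) *\<^sub>R f (x, y)" for x y
  have h: "integrable (lborel \<Otimes>\<^sub>M lborel) (case_prod h)"
    using f unfolding integrable_Tm_iff by (simp add: h_def case_prod_beta')
  have hx: "h x y = indicator {0..2 * pi} x *\<^sub>R (indicator {0..2 * pi} y *\<^sub>R f (x, y))" for x y
    by (simp add: h_def indicator_torus_cell)
  have inner: "(\<integral>y. h x y \<partial>lborel) = indicator {0..2 * pi} x *\<^sub>R (\<integral>y. f (x, y) \<partial>Pm)" for x
    by (simp only: hx integral_scaleR_right) (simp add: Bochner_Integration.integral_restrict_space)
  have "(\<integral>z. f z \<partial>Tm) = integral\<^sup>L (lborel \<Otimes>\<^sub>M lborel) (case_prod h)"
    by (simp add: Bochner_Integration.integral_restrict_space lborel_prod h_def case_prod_beta')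
  also have "\<dots> = (\<integral>x. (\<integral>y. h x y \<partial>lborel) \<partial>lborel)"
    by (rule lborel_pair.integral_fst[OF h, symmetric])
  finally show ?thesis by (simp add: inner Bochner_Integration.integral_restrict_space)
qed

lemma emeasure_Tm: "emeasure Tm torus_cell < \<infinity>"
proof -
  have "bounded torus_cell" unfolding torus_cell_def by (intro bounded_Times) auto
  then have "emeasure lborel torus_cell < \<infinity>" by (rule emeasure_bounded_finite)
  then show ?thesis by (simp add: emeasure_restrict_space)
qed

lemma finite_measure_Tm: "finite_measure Tm"
  using emeasure_Tm by (intro finite_measureI) auto

lemma integrable_Tm_bounded:
  fixes f :: "_ \<Rightarrow> 'b::{banach, second_countable_topology}"
  assumes "f \<in> borel_measurable Tm" "\<And>z. z \<in> torus_cell \<Longrightarrow> norm (f z) \<le> B"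
  shows "integrable Tm f"
  by (rule finite_measure.integrable_const_bound[OF finite_measure_Tm _ assms(1), of B])
     (use assms(2) in auto)

lemma sqi_Tm_bounded:
  assumes "f \<in> borel_measurable Tm" "\<And>z. z \<in> torus_cell \<Longrightarrow> cmod (f z) \<le> B"
  shows "sqi Tm f"
  unfolding sqi_def
proof
  show "integrable Tm (\<lambda>z. (cmod (f z))\<^sup>2)"
    by (rule integrable_Tm_bounded[of _ "B\<^sup>2"]) (use assms in \<open>auto intro!: power_mono\<close>)
qed (rule assms(1))

lemma integrable_Tm_continuous:
  fixes f :: "_ \<Rightarrow> 'b::{banach, second_countable_topology}"
  assumes "continuous_on UNIV f"
  shows "integrable Tm f"
proof -
  have "compact torus_cell" unfolding torus_cell_def by (intro compact_Times) auto
  then have "bounded (f ` torus_cell)"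
    by (intro compact_imp_bounded compact_continuous_image continuous_on_subset[OF assms]) auto
  then obtain B where "\<And>z. z \<in> torus_cell \<Longrightarrow> norm (f z) \<le> B"
    unfolding bounded_iff by blast
  then show ?thesis
    by (intro integrable_Tm_bounded[of _ B]) (use assms in \<open>auto intro!: measurable_Tm borel_measurable_continuous_onI\<close>)
qed

lemma sqi_Tm_continuous:
  assumes "continuous_on UNIV f"
  shows "sqi Tm f"
  unfolding sqi_def
  using assms by (auto intro!: integrable_Tm_continuous continuous_intros measurable_Tm borel_measurable_continuous_onI)

lemma sqi_Tm_integrable: "sqi Tm f \<Longrightarrow> integrable Tm f"
  using sqi_integrable_mult[of Tm f "\<lambda>_. 1"] sqi_Tm_continuous[of "\<lambda>_. 1"] by simp

section \<open>Characters, Fourier coefficients and the finite Parseval identity\<close>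

definition tch :: "int \<times> int \<Rightarrow> real \<times> real \<Rightarrow> complex" where
  "tch p z = cis (of_int (fst p) * fst z + of_int (snd p) * snd z)"

text \<open>The divisor 4 pi^2 is the area of the cell: a character has coefficient 1 at its own
  frequency, and the norm identities carry the area instead.\<close>

definition fcoef :: "(real \<times> real \<Rightarrow> complex) \<Rightarrow> int \<times> int \<Rightarrow> complex" where
  "fcoef f p = (\<integral>z. f z * cnj (tch p z) \<partial>Tm) / (4 * pi\<^sup>2)"

lemma norm_tch [simp]: "cmod (tch p z) = 1"
  by (simp add: tch_def)

lemma continuous_tch [continuous_intros]: "continuous_on S (tch p)"
  unfolding tch_def[abs_def] cis_conv_exp by (intro continuous_intros)

lemma measurable_tch [measurable]: "tch p \<in> borel_measurable borel"
  by (intro borel_measurable_continuous_onI continuous_tch)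

lemma tch_mult: "tch p z * tch q z = tch (fst p + fst q, snd p + snd q) z"
  by (simp add: tch_def cis_mult algebra_simps)

lemma cnj_tch: "cnj (tch p z) = tch (- fst p, - snd p) z"
  by (simp add: tch_def cis_cnj)

lemma tch_split: "tch (l, j) (x, y) = cis (of_int l * x) * cis (of_int j * y)"
  by (simp add: tch_def cis_mult)

lemma sqi_tch: "sqi Tm (tch p)"
  by (intro sqi_Tm_continuous continuous_tch)

lemma sqi_mult_tch: "sqi Tm f \<Longrightarrow> sqi Tm (\<lambda>z. f z * tch p z)"
  using sqi_mult_bounded[of Tm f "tch p" 1] by (simp add: mult.commute)

lemma integrable_mult_tch: "sqi Tm f \<Longrightarrow> integrable Tm (\<lambda>z. f z * tch p z)"
  by (intro sqi_Tm_integrable sqi_mult_tch)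

lemma integrable_mult_cnj_tch: "sqi Tm f \<Longrightarrow> integrable Tm (\<lambda>z. f z * cnj (tch p z))"
  unfolding cnj_tch by (rule integrable_mult_tch)

lemma cis_of_int_2pi: "cis (of_int n * (2 * pi)) = 1"
  using cis_multiple_2pi[of "of_int n"] by (simp add: mult_ac)

lemma Pm_integral_derivative:
  fixes F f :: "real \<Rightarrow> complex"
  assumes "\<And>x. (F has_vector_derivative f x) (at x)" "continuous_on UNIV f"
  shows "(\<integral>x. f x \<partial>Pm) = F (2 * pi) - F 0"
  using integral_FTC_Icc[of 0 "2 * pi" F f] assms
  by (simp add: Bochner_Integration.integral_restrict_space has_vector_derivative_at_within continuous_on_subset)

lemma has_vector_derivative_cis:
  "((\<lambda>x. cis (of_int n * x)) has_vector_derivative (\<i> * of_int n * cis (of_int n * x))) (at x within S)"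
  unfolding cis_conv_exp
  by (rule has_vector_derivative_real_field derivative_eq_intros refl | simp)+

lemma Pm_integral_cis: "(\<integral>x. cis (of_int n * x) \<partial>Pm) = (if n = 0 then 2 * pi else 0)"
proof (cases "n = 0")
  case True
  have "(\<integral>x. 1 \<partial>Pm) = (of_real (2 * pi) - of_real 0 :: complex)"
  proof (rule Pm_integral_derivative)
    show "((\<lambda>x. complex_of_real x) has_vector_derivative 1) (at x)" for x
      using bounded_linear.has_vector_derivative[OF bounded_linear_of_real has_vector_derivative_id[of "at x"]]
      by simp
  qed simp
  then show ?thesis using True by simp
next
  case False
  have "(\<integral>x. (\<i> * of_int n * cis (of_int n * x)) \<partial>Pm) = cis (of_int n * (2 * pi)) - cis (of_int n * 0)"
  proof (rule Pm_integral_derivative)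
    show "continuous_on UNIV (\<lambda>x. \<i> * of_int n * cis (of_int n * x))"
      unfolding cis_conv_exp by (intro continuous_intros)
  qed (rule has_vector_derivative_cis)
  then show ?thesis using False by (simp add: cis_of_int_2pi)
qed

lemma Tm_integral_tch: "(\<integral>z. tch p z \<partial>Tm) = (if p = (0, 0) then 4 * pi\<^sup>2 else 0)"
proof -
  obtain l j where p: "p = (l, j)" by fastforce
  have "(\<integral>z. tch p z \<partial>Tm) = (\<integral>y. (\<integral>x. tch p (x, y) \<partial>Pm) \<partial>Pm)"
    by (intro Tm_integral_iterated(3) integrable_Tm_continuous continuous_tch)
  also have "\<dots> = (\<integral>y. (\<integral>x. cis (of_int l * x) \<partial>Pm) * cis (of_int j * y) \<partial>Pm)"
    by (simp add: p tch_split)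
  also have "\<dots> = (\<integral>x. cis (of_int l * x) \<partial>Pm) * (\<integral>y. cis (of_int j * y) \<partial>Pm)"
    by simp
  finally show ?thesis unfolding Pm_integral_cis p by (auto simp: power2_eq_square)
qed

lemma tch_orthogonal: "(\<integral>z. tch p z * cnj (tch q z) \<partial>Tm) = (if p = q then 4 * pi\<^sup>2 else 0)"
  unfolding cnj_tch tch_mult Tm_integral_tch by (cases p; cases q) auto

lemma fcoef_cong_AE:
  assumes [measurable]: "f \<in> borel_measurable Tm" "g \<in> borel_measurable Tm" and "AE z in Tm. f z = g z"
  shows "fcoef f p = fcoef g p"
proof -
  have "(\<integral>z. f z * cnj (tch p z) \<partial>Tm) = (\<integral>z. g z * cnj (tch p z) \<partial>Tm)"
    by (rule integral_cong_AE) (use assms(3) in \<open>auto simp: cnj_tch\<close>)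
  then show ?thesis by (simp add: fcoef_def)
qed

lemma fcoef_add: "sqi Tm f \<Longrightarrow> sqi Tm g \<Longrightarrow> fcoef (\<lambda>z. f z + g z) p = fcoef f p + fcoef g p"
  by (simp add: fcoef_def distrib_right integrable_mult_cnj_tch add_divide_distrib)

lemma fcoef_diff: "sqi Tm f \<Longrightarrow> sqi Tm g \<Longrightarrow> fcoef (\<lambda>z. f z - g z) p = fcoef f p - fcoef g p"
  by (simp add: fcoef_def left_diff_distrib integrable_mult_cnj_tch diff_divide_distrib)

lemma fcoef_cmult: "fcoef (\<lambda>z. c * f z) p = c * fcoef f p"
  by (simp add: fcoef_def mult.assoc)

lemma fcoef_divide: "fcoef (\<lambda>z. f z / c) p = fcoef f p / c"
  using fcoef_cmult[of "inverse c" f p] by (simp add: field_simps)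

lemma fcoef_zero [simp]: "fcoef (\<lambda>z. 0) p = 0"
  by (simp add: fcoef_def)

lemma fcoef_sum: "(\<And>i. i \<in> I \<Longrightarrow> sqi Tm (f i)) \<Longrightarrow> fcoef (\<lambda>z. \<Sum>i\<in>I. f i z) p = (\<Sum>i\<in>I. fcoef (f i) p)"
  by (induction I rule: infinite_finite_induct) (auto simp: fcoef_add sqi_sum)

lemma fcoef_tch: "fcoef (tch q) p = (if q = p then 1 else 0)"
  by (simp add: fcoef_def tch_orthogonal)

definition tpoly :: "(int \<times> int) set \<Rightarrow> (int \<times> int \<Rightarrow> complex) \<Rightarrow> real \<times> real \<Rightarrow> complex" where
  "tpoly P a z = (\<Sum>p\<in>P. a p * tch p z)"

lemma sqi_tpoly: "sqi Tm (tpoly P a)"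
  unfolding tpoly_def[abs_def] by (intro sqi_sum sqi_cmult sqi_tch)

lemma fcoef_tpoly: "finite P \<Longrightarrow> fcoef (tpoly P a) p = (if p \<in> P then a p else 0)"
  unfolding tpoly_def[abs_def]
  by (subst fcoef_sum) (auto simp: sqi_cmult sqi_tch fcoef_cmult fcoef_tch if_distrib sum.delta cong: if_cong)

lemma inner_tpoly:
  assumes "sqi Tm f"
  shows "(\<integral>z. f z * cnj (tpoly P a z) \<partial>Tm) = 4 * pi\<^sup>2 * (\<Sum>p\<in>P. cnj (a p) * fcoef f p)"
proof -
  have "(\<integral>z. f z * cnj (tpoly P a z) \<partial>Tm) = (\<integral>z. (\<Sum>p\<in>P. cnj (a p) * (f z * cnj (tch p z))) \<partial>Tm)"
    by (simp add: tpoly_def sum_distrib_left mult_ac)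
  also have "\<dots> = (\<Sum>p\<in>P. cnj (a p) * (\<integral>z. f z * cnj (tch p z) \<partial>Tm))"
    using assms by (subst Bochner_Integration.integral_sum) (auto simp: integrable_mult_cnj_tch)
  also have "\<dots> = 4 * pi\<^sup>2 * (\<Sum>p\<in>P. cnj (a p) * fcoef f p)"
    by (simp add: fcoef_def sum_distrib_left)
  finally show ?thesis .
qed

text \<open>The expanded square is kept as an identity because three facts are read off from it: a =
  fcoef f gives Bessel's inequality, comparing two choices of \<open>a\<close> gives best
  approximation, and a polynomial \<open>f\<close> gives Parseval's identity.\<close>

lemma l2n_diff_tpoly:
  assumes f: "sqi Tm f" and P: "finite P"
  shows "(l2n Tm (\<lambda>z. f z - tpoly P a z))\<^sup>2
    = (l2n Tm f)\<^sup>2 - 4 * pi\<^sup>2 * (\<Sum>p\<in>P. (cmod (fcoef f p))\<^sup>2) + 4 * pi\<^sup>2 * (\<Sum>p\<in>P. (cmod (fcoef f p - a p))\<^sup>2)"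
proof -
  define q where "q = tpoly P a"
  have q: "sqi Tm q" by (simp add: q_def sqi_tpoly)
  have fq: "(\<integral>z. f z * cnj (q z) \<partial>Tm) = 4 * pi\<^sup>2 * (\<Sum>p\<in>P. cnj (a p) * fcoef f p)"
    unfolding q_def by (rule inner_tpoly[OF f])
  have qf: "(\<integral>z. q z * cnj (f z) \<partial>Tm) = cnj (\<integral>z. f z * cnj (q z) \<partial>Tm)"
    by (simp add: mult.commute flip: Bochner_Integration.integral_cnj)
  have "(\<integral>z. q z * cnj (q z) \<partial>Tm) = 4 * pi\<^sup>2 * (\<Sum>p\<in>P. cnj (a p) * fcoef q p)"
    unfolding q_def by (rule inner_tpoly[OF sqi_tpoly])
  also have "(\<Sum>p\<in>P. cnj (a p) * fcoef q p) = of_real (\<Sum>p\<in>P. (cmod (a p))\<^sup>2)"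
    unfolding of_real_sum q_def fcoef_tpoly[OF P]
    by (intro sum.cong refl) (simp add: mult.commute complex_norm_square[unfolded of_real_power])
  finally have qq: "(\<integral>z. q z * cnj (q z) \<partial>Tm) = of_real (4 * pi\<^sup>2 * (\<Sum>p\<in>P. (cmod (a p))\<^sup>2))" by simp
  have "of_real ((l2n Tm (\<lambda>z. f z - q z))\<^sup>2) = (\<integral>z. (f z - q z) * cnj (f z - q z) \<partial>Tm)"
    by (rule integral_mult_cnj_self[symmetric])
  also have "\<dots> = (\<integral>z. f z * cnj (f z) - f z * cnj (q z) - q z * cnj (f z) + q z * cnj (q z) \<partial>Tm)"
    by (intro Bochner_Integration.integral_cong) (auto simp: algebra_simps)
  also have "\<dots> = (\<integral>z. f z * cnj (f z) \<partial>Tm) - (\<integral>z. f z * cnj (q z) \<partial>Tm) - (\<integral>z. q z * cnj (f z) \<partial>Tm) + (\<integral>z. q z * cnj (q z) \<partial>Tm)"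
    by (simp only: Bochner_Integration.integral_add Bochner_Integration.integral_diff
        Bochner_Integration.integrable_add Bochner_Integration.integrable_diff inner_integrable f q)
  finally have eq: "of_real ((l2n Tm (\<lambda>z. f z - q z))\<^sup>2) = of_real ((l2n Tm f)\<^sup>2)
      - 4 * pi\<^sup>2 * (\<Sum>p\<in>P. cnj (a p) * fcoef f p) - cnj (4 * pi\<^sup>2 * (\<Sum>p\<in>P. cnj (a p) * fcoef f p))
      + of_real (4 * pi\<^sup>2 * (\<Sum>p\<in>P. (cmod (a p))\<^sup>2))"
    using qq unfolding integral_mult_cnj_self qf fq by simp
  have re: "Re (4 * pi\<^sup>2 * (\<Sum>p\<in>P. cnj (a p) * fcoef f p)) = 4 * pi\<^sup>2 * (\<Sum>p\<in>P. Re (cnj (a p) * fcoef f p))"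
    by (simp flip: of_real_mult of_real_power add: Re_sum)
  have e1: "(l2n Tm (\<lambda>z. f z - q z))\<^sup>2 = (l2n Tm f)\<^sup>2 - 2 * (4 * pi\<^sup>2 * (\<Sum>p\<in>P. Re (cnj (a p) * fcoef f p)))
      + 4 * pi\<^sup>2 * (\<Sum>p\<in>P. (cmod (a p))\<^sup>2)"
    using arg_cong[OF eq, of Re] re by (simp only: Re_complex_of_real minus_complex.sel plus_complex.sel cnj.sel)
  have e2: "(\<Sum>p\<in>P. (cmod (fcoef f p - a p))\<^sup>2)
      = (\<Sum>p\<in>P. (cmod (fcoef f p))\<^sup>2) - 2 * (\<Sum>p\<in>P. Re (cnj (a p) * fcoef f p)) + (\<Sum>p\<in>P. (cmod (a p))\<^sup>2)"
    unfolding sum_distrib_left sum_subtractf[symmetric] sum.distrib[symmetric]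
    by (intro sum.cong refl) (unfold cmod_power2, simp add: power2_eq_square algebra_simps)
  show ?thesis using e1 unfolding q_def e2 by (simp add: algebra_simps)
qed

section \<open>Density of trigonometric polynomials\<close>

text \<open>An inductive closure in place of explicit finite sums: stability under products and
  under composition with polynomials then follows by induction, and \<open>trigs_imp_tpoly\<close>
  returns to coefficients.\<close>

inductive_set trigs :: "(real \<times> real \<Rightarrow> complex) set" where
  tch: "tch p \<in> trigs"
| add: "f \<in> trigs \<Longrightarrow> g \<in> trigs \<Longrightarrow> (\<lambda>z. f z + g z) \<in> trigs"
| cmult: "f \<in> trigs \<Longrightarrow> (\<lambda>z. c * f z) \<in> trigs"

lemma trigs_mult: "f \<in> trigs \<Longrightarrow> g \<in> trigs \<Longrightarrow> (\<lambda>z. f z * g z) \<in> trigs"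
proof (induction rule: trigs.induct)
  case (tch p)
  then show ?case
  proof (induction rule: trigs.induct)
    case (tch q)
    show ?case using trigs.tch[of "(fst p + fst q, snd p + snd q)"] by (simp add: tch_mult[abs_def])
  next
    case (add f g)
    show ?case using trigs.add[OF add.IH] by (simp add: algebra_simps)
  next
    case (cmult f c)
    show ?case using trigs.cmult[OF cmult.IH, of c] by (simp add: algebra_simps)
  qed
next
  case (add f f')
  show ?case using trigs.add[OF add.IH(1)[OF add.prems] add.IH(2)[OF add.prems]] by (simp add: algebra_simps)
next
  case (cmult f c)
  show ?case using trigs.cmult[OF cmult.IH[OF cmult.prems], of c] by (simp add: algebra_simps)
qed

lemma trigs_imp_tpoly:
  assumes "f \<in> trigs"
  obtains P a where "finite P" "f = tpoly P a"
proof -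
  from assms have "\<exists>P a. finite P \<and> f = tpoly P a"
  proof (induction rule: trigs.induct)
    case (tch p)
    have "tch p = tpoly {p} (\<lambda>_. 1)" by (simp add: tpoly_def fun_eq_iff)
    then show ?case by blast
  next
    case (add f g)
    then obtain P a Q b where *: "finite P" "f = tpoly P a" "finite Q" "g = tpoly Q b" by blast
    have "(\<lambda>z. f z + g z) = tpoly (P \<union> Q) (\<lambda>p. (if p \<in> P then a p else 0) + (if p \<in> Q then b p else 0))"
    proof
      fix z
      have "(\<Sum>p\<in>P. a p * tch p z) = (\<Sum>p\<in>P \<union> Q. (if p \<in> P then a p else 0) * tch p z)"
        "(\<Sum>p\<in>Q. b p * tch p z) = (\<Sum>p\<in>P \<union> Q. (if p \<in> Q then b p else 0) * tch p z)"
        using * by (auto intro!: sum.mono_neutral_cong_left)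
      then show "f z + g z = tpoly (P \<union> Q) (\<lambda>p. (if p \<in> P then a p else 0) + (if p \<in> Q then b p else 0)) z"
        by (simp add: * tpoly_def distrib_right sum.distrib)
    qed
    then show ?case using * by blast
  next
    case (cmult f c)
    then obtain P a where *: "finite P" "f = tpoly P a" by blast
    then have "(\<lambda>z. c * f z) = tpoly P (\<lambda>p. c * a p)"
      by (simp add: tpoly_def fun_eq_iff sum_distrib_left mult.assoc)
    then show ?case using * by blast
  qed
  then show ?thesis using that by blast
qed

lemma trigs_sqi: "f \<in> trigs \<Longrightarrow> sqi Tm f"
  using trigs_imp_tpoly sqi_tpoly by metis

lemma trigs_const: "(\<lambda>z. c) \<in> trigs"
  using trigs.cmult[OF trigs.tch[of "(0, 0)"], of c] by (simp add: tch_def)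

lemma trigs_cos:
  "(\<lambda>z. of_real (cos (fst z - c))) \<in> trigs" "(\<lambda>z. of_real (cos (snd z - c))) \<in> trigs"
proof -
  have *: "of_real (cos (x - c)) = cis (- c) / 2 * cis x + cis c / 2 * cis (- x)" for x
    by (simp add: complex_eq_iff cos_diff flip: add_divide_distrib)
  show "(\<lambda>z. of_real (cos (fst z - c))) \<in> trigs"
    using trigs.add[OF trigs.cmult[OF trigs.tch[of "(1, 0)"], of "cis (- c) / 2"]
        trigs.cmult[OF trigs.tch[of "(- 1, 0)"], of "cis c / 2"]]
    by (simp add: * tch_def)
  show "(\<lambda>z. of_real (cos (snd z - c))) \<in> trigs"
    using trigs.add[OF trigs.cmult[OF trigs.tch[of "(0, 1)"], of "cis (- c) / 2"]
        trigs.cmult[OF trigs.tch[of "(0, - 1)"], of "cis c / 2"]]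
    by (simp add: * tch_def)
qed

text \<open>Together with \<open>trigs_cos\<close> this makes every polynomial in a translated
  cosine a trigonometric polynomial. In the linear case, a linear map of the reals is multiplication
  by its value at 1.\<close>

lemma trigs_polynomial:
  fixes h :: "real \<times> real \<Rightarrow> real"
  assumes p: "real_polynomial_function p" and h: "(\<lambda>z. of_real (h z)) \<in> trigs"
  shows "(\<lambda>z. of_real (p (h z))) \<in> trigs"
  using p
proof (induction rule: real_polynomial_function.induct)
  case (linear f)
  have "f x = f 1 * x" for x
    using linear_scale[OF bounded_linear.linear[OF linear], of x 1] by (simp add: mult.commute)
  then show ?case using trigs.cmult[OF h, of "of_real (f 1)"] by (metis (no_types, lifting) ext of_real_mult)
next
  case (const c)
  show ?case by (rule trigs_const)
next
  case (add f g)
  then show ?case using trigs.add[OF add.IH] by simp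
next
  case (mult f g)
  then show ?case using trigs_mult[OF mult.IH] by simp
qed

text \<open>Membership in the L2 closure of the trigonometric polynomials. Density is reached by
  placing rectangles, then Borel sets, then simple functions in this closure.\<close>

definition approximable :: "(real \<times> real \<Rightarrow> complex) \<Rightarrow> bool" where
  "approximable f \<longleftrightarrow> sqi Tm f \<and> (\<forall>e>0. \<exists>g\<in>trigs. l2n Tm (\<lambda>z. f z - g z) < e)"

lemma approximable_sqi: "approximable f \<Longrightarrow> sqi Tm f"
  by (simp add: approximable_def)

lemma approximable_limit:
  assumes F: "\<And>n. approximable (F n)" and f: "sqi Tm f"
    and lim: "(\<lambda>n. l2n Tm (\<lambda>z. F n z - f z)) \<longlonglongrightarrow> 0"
  shows "approximable f"
  unfolding approximable_def
proof (intro conjI allI impI f)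
  fix e :: real assume e: "e > 0"
  then have "\<forall>\<^sub>F n in sequentially. l2n Tm (\<lambda>z. F n z - f z) < e / 2"
    using lim by (intro order_tendstoD(2)) auto
  then obtain n where n: "l2n Tm (\<lambda>z. F n z - f z) < e / 2"
    using eventually_happens' sequentially_bot by blast
  obtain g where g: "g \<in> trigs" "l2n Tm (\<lambda>z. F n z - g z) < e / 2"
    using F[of n] e unfolding approximable_def by (meson half_gt_zero)
  have "l2n Tm (\<lambda>z. f z - g z) \<le> l2n Tm (\<lambda>z. f z - F n z) + l2n Tm (\<lambda>z. F n z - g z)"
    by (intro l2n_diff_triangle f approximable_sqi F trigs_sqi g)
  also have "\<dots> < e" using n g by (simp add: l2n_minus_commute[of Tm f])
  finally show "\<exists>g\<in>trigs. l2n Tm (\<lambda>z. f z - g z) < e" using g by blast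
qed

lemma trigs_approximable: "f \<in> trigs \<Longrightarrow> approximable f"
  unfolding approximable_def using trigs_sqi by (auto intro!: bexI[of _ f])

lemma approximable_add:
  assumes "approximable f" "approximable g"
  shows "approximable (\<lambda>z. f z + g z)"
  unfolding approximable_def
proof (intro conjI allI impI)
  show "sqi Tm (\<lambda>z. f z + g z)" using assms by (intro sqi_add approximable_sqi)
  fix e :: real assume e: "e > 0"
  obtain f' g' where *: "f' \<in> trigs" "l2n Tm (\<lambda>z. f z - f' z) < e / 2" "g' \<in> trigs" "l2n Tm (\<lambda>z. g z - g' z) < e / 2"
    using assms e unfolding approximable_def by (meson half_gt_zero)
  have "l2n Tm (\<lambda>z. (f z - f' z) + (g z - g' z)) \<le> l2n Tm (\<lambda>z. f z - f' z) + l2n Tm (\<lambda>z. g z - g' z)"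
    using assms * by (intro l2n_triangle sqi_diff approximable_sqi trigs_sqi)
  also have "\<dots> < e" using * by simp
  finally show "\<exists>h\<in>trigs. l2n Tm (\<lambda>z. f z + g z - h z) < e"
    by (intro bexI[of _ "\<lambda>z. f' z + g' z"]) (use * in \<open>auto simp: algebra_simps intro: trigs.add\<close>)
qed

lemma approximable_cmult:
  assumes "approximable f"
  shows "approximable (\<lambda>z. c * f z)"
  unfolding approximable_def
proof (intro conjI allI impI)
  show "sqi Tm (\<lambda>z. c * f z)" using assms by (intro sqi_cmult approximable_sqi)
  fix e :: real assume e: "e > 0"
  have "e / (cmod c + 1) > 0" using e by (simp add: add_nonneg_pos)
  then obtain f' where *: "f' \<in> trigs" "l2n Tm (\<lambda>z. f z - f' z) < e / (cmod c + 1)"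
    using assms unfolding approximable_def by meson
  have "l2n Tm (\<lambda>z. c * f z - c * f' z) = cmod c * l2n Tm (\<lambda>z. f z - f' z)"
    unfolding right_diff_distrib[symmetric] by (rule l2n_cmult)
  also have "\<dots> \<le> cmod c * (e / (cmod c + 1))" using * by (intro mult_left_mono) auto
  also have "\<dots> < e"
  proof -
    have "cmod c + 1 > 0" by (simp add: add_nonneg_pos)
    then show ?thesis using e by (simp add: pos_divide_less_eq algebra_simps)
  qed
  finally show "\<exists>h\<in>trigs. l2n Tm (\<lambda>z. c * f z - h z) < e"
    using * by (intro bexI[of _ "\<lambda>z. c * f' z"]) (auto intro: trigs.cmult)
qed

lemma approximable_sum: "(\<And>i. i \<in> I \<Longrightarrow> approximable (f i)) \<Longrightarrow> approximable (\<lambda>z. \<Sum>i\<in>I. f i z)"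
  by (induction I rule: infinite_finite_induct)
     (auto intro: approximable_add trigs_approximable trigs_const)

lemma approximable_cong_AE:
  assumes "approximable f" "sqi Tm g" "AE z in Tm. f z = g z"
  shows "approximable g"
proof (rule approximable_limit[where F = "\<lambda>_. f"])
  have "l2n Tm (\<lambda>z. f z - g z) = l2n Tm (\<lambda>z. 0)"
    using assms by (intro l2n_cong_AE) (auto dest: approximable_sqi sqi_measurable)
  then show "(\<lambda>n. l2n Tm (\<lambda>z. f z - g z)) \<longlonglongrightarrow> 0" by simp
qed (use assms in auto)

text \<open>Clipped linear functions of slope n, zero up to and including \<rho>, tend pointwise to
  the strict step, and Weierstrass replaces each by a polynomial with error below 1/(n+1). The
  uniform bound serves dominated convergence; [-1, 1] is the range of the cosine to be
  inserted.\<close>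

lemma polynomial_step:
  fixes \<rho> :: real
  shows "\<exists>q :: nat \<Rightarrow> real \<Rightarrow> real. (\<forall>n. real_polynomial_function (q n)) \<and>
    (\<forall>n. \<forall>s\<in>{-1..1}. \<bar>q n s\<bar> \<le> 2) \<and> (\<forall>s\<in>{-1..1}. (\<lambda>n. q n s) \<longlonglongrightarrow> of_bool (\<rho> < s))"
proof -
  define st where "st n s = min 1 (max 0 (real n * (s - \<rho>)))" for n s
  have "\<exists>p. real_polynomial_function p \<and> (\<forall>s\<in>{-1..1}. \<bar>st n s - p s\<bar> < inverse (Suc n))" for n
  proof -
    have "continuous_on {-1..1} (st n)" unfolding st_def by (intro continuous_intros)
    from Stone_Weierstrass_real_polynomial_function[OF compact_Icc this, of "inverse (Suc n)"]
    obtain g where "real_polynomial_function g" "\<And>x. x \<in> {-1..1} \<Longrightarrow> \<bar>st n x - g x\<bar> < inverse (Suc n)"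
      using inverse_positive_iff_positive of_nat_0_less_iff zero_less_Suc by blast
    then show ?thesis by blast
  qed
  then have "\<exists>q. \<forall>n. real_polynomial_function (q n) \<and> (\<forall>s\<in>{-1..1}. \<bar>st n s - q n s\<bar> < inverse (Suc n))"
    by (intro choice allI)
  then obtain q where q: "\<And>n. real_polynomial_function (q n)"
    "\<And>n s. s \<in> {-1..1} \<Longrightarrow> \<bar>st n s - q n s\<bar> < inverse (Suc n)"
    by blast
  show ?thesis
  proof (intro exI[of _ q] conjI allI ballI q(1))
    fix s :: real assume s: "s \<in> {-1..1}"
    have 1: "inverse (real (Suc n)) \<le> 1" for n by (simp add: inverse_le_1_iff)
    have st01: "0 \<le> st n s" "st n s \<le> 1" for n by (auto simp: st_def)
    show "\<bar>q n s\<bar> \<le> 2" for n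
      using q(2)[OF s, of n] 1[of n] st01[of n] by linarith
    have "(\<lambda>n. st n s) \<longlonglongrightarrow> of_bool (\<rho> < s)"
    proof (cases "\<rho> < s")
      case True
      then obtain n0 where n0: "1 < real n0 * (s - \<rho>)"
        using ex_less_of_nat_mult[of "s - \<rho>" 1] unfolding diff_gt_0_iff_gt by blast
      have "st n s = 1" if "n \<ge> n0" for n
      proof -
        have "real n0 * (s - \<rho>) \<le> real n * (s - \<rho>)" using that True by (intro mult_right_mono) auto
        then show ?thesis using n0 by (simp add: st_def)
      qed
      then have "\<forall>\<^sub>F n in sequentially. st n s = of_bool (\<rho> < s)"
        using True by (intro eventually_sequentiallyI[of n0]) simp
      then show ?thesis by (rule tendsto_eventually)
    next
      case False
      then have "st n s = 0" for n by (simp add: st_def mult_nonneg_nonpos)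
      then show ?thesis using False by simp
    qed
    moreover have "(\<lambda>n. q n s - st n s) \<longlonglongrightarrow> 0"
    proof (rule Lim_null_comparison[OF _ LIMSEQ_inverse_real_of_nat])
      have "norm (q n s - st n s) \<le> inverse (Suc n)" for n
        using q(2)[OF s, of n] unfolding real_norm_def abs_minus_commute[of "q n s"] by (rule less_imp_le)
      then show "\<forall>\<^sub>F n in sequentially. norm (q n s - st n s) \<le> inverse (Suc n)"
        by (rule always_eventually[OF allI])
    qed
    ultimately show "(\<lambda>n. q n s) \<longlonglongrightarrow> of_bool (\<rho> < s)"
      using tendsto_add[of "\<lambda>n. q n s - st n s" 0 sequentially "\<lambda>n. st n s"] by simp
  qed
qed

text \<open>An interval of length at most 2 pi is a superlevel set of the cosine centred at its
  midpoint. A step applied to that cosine is therefore its indicator, and polynomial approximations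
  of the step become periodic approximations of the indicator.\<close>

lemma cos_greater_iff_arc:
  fixes a b x :: real
  assumes "0 \<le> a" "a < b" "b \<le> 2 * pi" "x \<in> {0..2 * pi}"
  shows "cos ((b - a) / 2) < cos (x - (a + b) / 2) \<longleftrightarrow> a < x \<and> x < b"
proof -
  define r t where "r = (b - a) / 2" and "t = \<bar>x - (a + b) / 2\<bar>"
  have r: "0 < r" "r \<le> pi" using assms by (auto simp: r_def)
  have t: "0 \<le> t" by (simp add: t_def)
  have x: "0 \<le> x" "x \<le> 2 * pi" using assms(4) by auto
  have mid: "(a + b) / 2 = a + r" "(a + b) / 2 = b - r"
    by (simp_all add: r_def field_simps)
  \<comment> \<open>The distance to the midpoint may exceed pi; this bound lets the reflection 2 pi
    - t return it to the monotone branch of the cosine, at or beyond r.\<close>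
  have t2: "t \<le> 2 * pi - r"
    unfolding t_def
  proof (rule abs_leI)
    show "x - (a + b) / 2 \<le> 2 * pi - r"
      using assms(1-3) x mid by linarith
    show "- (x - (a + b) / 2) \<le> 2 * pi - r"
      using assms(1-3) x mid by linarith
  qed
  have ct: "cos (x - (a + b) / 2) = cos t" by (simp add: t_def)
  have "cos r < cos t \<longleftrightarrow> t < r"
  proof
    assume "t < r"
    then show "cos r < cos t" using t r by (intro cos_monotone_0_pi) auto
  next
    assume *: "cos r < cos t"
    show "t < r"
    proof (rule ccontr)
      assume "\<not> t < r"
      then have "cos t \<le> cos r"
      proof (cases "t \<le> pi")
        case True
        then show ?thesis using \<open>\<not> t < r\<close> r by (intro cos_monotone_0_pi_le) auto
      next
        case False
        have "cos (2 * pi - t) \<le> cos r" using False t t2 r by (intro cos_monotone_0_pi_le) auto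
        then show ?thesis by (simp add: cos_diff)
      qed
      then show False using * by simp
    qed
  qed
  moreover have "t < r \<longleftrightarrow> a < x \<and> x < b" unfolding t_def abs_less_iff
    by (intro iffI conjI; elim conjE; use mid in linarith)
  ultimately show ?thesis unfolding ct r_def by blast
qed

lemma approximable_inner_rectangle:
  assumes a: "0 \<le> a" "a < b" "b \<le> 2 * pi" and c: "0 \<le> c" "c < d" "d \<le> 2 * pi"
  shows "approximable (indicator ({a<..<b} \<times> {c<..<d}))"
proof -
  from polynomial_step[of "cos ((b - a) / 2)"]
  obtain p :: "nat \<Rightarrow> real \<Rightarrow> real" where p': "\<forall>n. real_polynomial_function (p n)"
    "\<forall>n. \<forall>s\<in>{-1..1}. \<bar>p n s\<bar> \<le> 2"
    "\<forall>s\<in>{-1..1}. (\<lambda>n. p n s) \<longlonglongrightarrow> of_bool (cos ((b - a) / 2) < s)"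
    by (elim exE conjE)
  from polynomial_step[of "cos ((d - c) / 2)"]
  obtain q :: "nat \<Rightarrow> real \<Rightarrow> real" where q': "\<forall>n. real_polynomial_function (q n)"
    "\<forall>n. \<forall>s\<in>{-1..1}. \<bar>q n s\<bar> \<le> 2"
    "\<forall>s\<in>{-1..1}. (\<lambda>n. q n s) \<longlonglongrightarrow> of_bool (cos ((d - c) / 2) < s)"
    by (elim exE conjE)
  note p = p'[rule_format] and q = q'[rule_format]
  define R where "R = {a<..<b} \<times> {c<..<d}"
  have R [measurable]: "R \<in> sets borel"
    unfolding R_def by (intro borel_open open_Times) auto
  define F where "F n z = complex_of_real (p n (cos (fst z - (a + b) / 2))) * of_real (q n (cos (snd z - (c + d) / 2)))" for n z
  have Ft: "F n \<in> trigs" for n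
    using trigs_mult[OF trigs_polynomial[OF p(1)[of n] trigs_cos(1)[of "(a + b) / 2"]]
        trigs_polynomial[OF q(1)[of n] trigs_cos(2)[of "(c + d) / 2"]]]
    by (simp add: F_def[abs_def])
  have iR: "indicator R \<in> borel_measurable Tm"
    by (intro measurable_Tm) simp
  show ?thesis
    unfolding R_def[symmetric]
  proof (rule approximable_limit)
    show "approximable (F n)" for n using Ft by (rule trigs_approximable)
    show "sqi Tm (indicator R)"
      by (rule sqi_Tm_bounded[OF iR, of 1]) (auto split: split_indicator)
    show "(\<lambda>n. l2n Tm (\<lambda>z. F n z - indicator R z)) \<longlonglongrightarrow> 0"
    proof (rule l2n_tendsto_dominated[OF _ iR])
      \<comment> \<open>25 = (2 * 2 + 1)^2: each polynomial factor is at most 2 and the indicator at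
        most 1.\<close>
      show "integrable Tm (\<lambda>z. 25 :: real)" by (intro integrable_Tm_continuous continuous_intros)
      show "F n \<in> borel_measurable Tm" for n using trigs_sqi[OF Ft] by (rule sqi_measurable)
      show "AE z in Tm. (\<lambda>n. F n z) \<longlonglongrightarrow> indicator R z"
      proof (rule AE_I2)
        fix z assume "z \<in> space Tm"
        then have "z \<in> torus_cell" by simp
        then have z: "fst z \<in> {0..2 * pi}" "snd z \<in> {0..2 * pi}" by (auto simp: torus_cell_def)
        have "(\<lambda>n. F n z) \<longlonglongrightarrow> of_real (of_bool (cos ((b - a) / 2) < cos (fst z - (a + b) / 2)))
            * of_real (of_bool (cos ((d - c) / 2) < cos (snd z - (c + d) / 2)))"
          unfolding F_def by (rule tendsto_mult[OF tendsto_of_real[OF p(3)] tendsto_of_real[OF q(3)]]) simp_all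
        moreover have "of_real (of_bool (cos ((b - a) / 2) < cos (fst z - (a + b) / 2)))
            * of_real (of_bool (cos ((d - c) / 2) < cos (snd z - (c + d) / 2))) = (indicator R z :: complex)"
          unfolding cos_greater_iff_arc[OF a z(1)] cos_greater_iff_arc[OF c z(2)]
          by (cases z) (auto simp: R_def split: split_indicator)
        ultimately show "(\<lambda>n. F n z) \<longlonglongrightarrow> indicator R z" by simp
      qed
      fix n
      show "AE z in Tm. (cmod (F n z - indicator R z))\<^sup>2 \<le> 25"
      proof (rule AE_I2)
        fix z
        have "\<bar>p n (cos (fst z - (a + b) / 2))\<bar> * \<bar>q n (cos (snd z - (c + d) / 2))\<bar> \<le> 2 * 2"
          by (intro mult_mono p q) auto
        then have "cmod (F n z) \<le> 4" by (simp add: F_def norm_mult)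
        moreover have "cmod (indicator R z) \<le> 1" by (auto split: split_indicator)
        ultimately have "cmod (F n z - indicator R z) \<le> 5"
          using norm_triangle_ineq4[of "F n z" "indicator R z"] by linarith
        then have "(cmod (F n z - indicator R z))\<^sup>2 \<le> 5\<^sup>2" by (intro power_mono) auto
        then show "(cmod (F n z - indicator R z))\<^sup>2 \<le> 25" by simp
      qed
    qed
  qed
qed

text \<open>The boundary of the closed cell is a null set, so open boxes inside the cell suffice for
  the density argument.\<close>

lemma AE_Tm_interior: "AE z in Tm. z \<in> {0<..<2 * pi} \<times> {0<..<2 * pi}"
proof -
  have "AE z in lborel. fst z \<noteq> c \<and> snd z \<noteq> c" for c :: real
  proof -
    have "{c} \<times> UNIV \<in> null_sets (lborel \<Otimes>\<^sub>M (lborel :: real measure))"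
      "UNIV \<times> {c} \<in> null_sets ((lborel :: real measure) \<Otimes>\<^sub>M lborel)"
      by (auto simp: null_sets_def lborel.emeasure_pair_measure_Times)
    from this[unfolded lborel_prod, THEN AE_not_in] show ?thesis
      by eventually_elim auto
  qed
  from this[of 0] this[of "2 * pi"]
  have "AE z in lborel. z \<in> torus_cell \<longrightarrow> z \<in> {0<..<2 * pi} \<times> {0<..<2 * pi}"
    by eventually_elim (auto simp: torus_cell_def)
  then show ?thesis by (simp add: AE_restrict_space_iff)
qed

lemma sqi_indicator: "A \<in> sets borel \<Longrightarrow> sqi Tm (indicator A)"
  by (rule sqi_Tm_bounded[of _ 1]) (auto intro!: measurable_Tm split: split_indicator)

lemma box_real_prod: "box a b = {fst a<..<fst b} \<times> {snd a<..<snd b}" for a b :: "real \<times> real"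
  by (cases a; cases b) (auto simp: mem_box Basis_prod_def)

text \<open>Open boxes form an intersection-stable generator of the Borel sets, and the closure is
  stable under complements and countable disjoint unions, so Dynkin's theorem applies. A box is
  first cut down to the cell, which alters its indicator on the cell only along the
  boundary.\<close>

lemma approximable_indicator:
  assumes "A \<in> sets (borel :: (real \<times> real) measure)"
  shows "approximable (indicator A)"
proof -
  define G where "G = range (\<lambda>(a, b). box a b :: (real \<times> real) set)"
  have sets: "sets (borel :: (real \<times> real) measure) = sigma_sets UNIV G"
    unfolding G_def by (subst borel_eq_box) auto
  have stable: "Int_stable G"
  proof (rule Int_stableI)
    fix A B assume "A \<in> G" "B \<in> G"
    then obtain a b c d where "A = box a b" "B = box c d" by (auto simp: G_def)
    then have "A \<inter> B = box (max (fst a) (fst c), max (snd a) (snd c)) (min (fst b) (fst d), min (snd b) (snd d))"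
      by (auto simp: box_real_prod)
    then show "A \<inter> B \<in> G" by (auto simp: G_def)
  qed
  from assms have "A \<in> sigma_sets UNIV G" by (simp add: sets)
  with Pow_UNIV have "G \<subseteq> Pow UNIV" "A \<in> sigma_sets UNIV G" by simp_all
  with stable show ?thesis
  proof (induction rule: sigma_sets_induct_disjoint)
    case (basic A)
    then obtain a b where A: "A = box a b" by (auto simp: G_def)
    define a1 a2 b1 b2 where "a1 = max 0 (fst a)" and "a2 = max 0 (snd a)"
      and "b1 = min (2 * pi) (fst b)" and "b2 = min (2 * pi) (snd b)"
    have eq: "AE z in Tm. indicator ({a1<..<b1} \<times> {a2<..<b2}) z = (indicator A z :: complex)"
      using AE_Tm_interior
    proof eventually_elim
      case (elim z)
      then show ?case
        by (cases a; cases b; cases z)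
           (auto simp: A box_real_prod a1_def a2_def b1_def b2_def split: split_indicator)
    qed
    have s: "sqi Tm (indicator A)" by (rule sqi_indicator) (simp add: A)
    show ?case
    proof (cases "a1 < b1 \<and> a2 < b2")
      case True
      then have "approximable (indicator ({a1<..<b1} \<times> {a2<..<b2}))"
        by (intro approximable_inner_rectangle) (auto simp: a1_def a2_def b1_def b2_def)
      then show ?thesis by (rule approximable_cong_AE[OF _ s eq])
    next
      case False
      then have *: "{a1<..<b1} \<times> {a2<..<b2} = {}" by auto
      have "AE z in Tm. 0 = (indicator A z :: complex)" using eq by eventually_elim (simp add: *)
      from approximable_cong_AE[OF _ s this] trigs_approximable[OF trigs_const] show ?thesis by blast
    qed
  next
    case empty
    show ?case using trigs_approximable[OF trigs_const[of 0]] by simp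
  next
    case (compl A)
    have "indicator (UNIV - A) = (\<lambda>z. 1 + (- 1) * (indicator A z :: complex))"
      by (auto split: split_indicator)
    then show ?case
      by (simp only:) (intro approximable_add approximable_cmult trigs_approximable trigs_const compl.IH)
  next
    case (union A)
    then have Ab: "A i \<in> sets borel" for i using sets by auto
    then have Ub: "\<Union> (range A) \<in> sets borel" by auto
    show ?case
    proof (rule approximable_limit[where F = "\<lambda>n z. \<Sum>i<n. indicator (A i) z"])
      show "approximable (\<lambda>z. \<Sum>i<n. indicator (A i) z)" for n
        by (intro approximable_sum union.IH)
      show "sqi Tm (indicator (\<Union> (range A)))" by (rule sqi_indicator[OF Ub])
      have sum_eq: "(\<Sum>i<n. indicator (A i) z) = (indicator (\<Union>i<n. A i) z :: complex)" for n z
        by (rule indicator_UN_disjoint[symmetric])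
           (use union.hyps in \<open>auto intro: disjoint_family_on_mono\<close>)
      show "(\<lambda>n. l2n Tm (\<lambda>z. (\<Sum>i<n. indicator (A i) z) - indicator (\<Union> (range A)) z)) \<longlonglongrightarrow> 0"
      proof (rule l2n_tendsto_dominated)
        show "integrable Tm (\<lambda>z. 1 :: real)" by (intro integrable_Tm_continuous continuous_intros)
        show "(\<lambda>z. \<Sum>i<n. indicator (A i) z :: complex) \<in> borel_measurable Tm" for n
          by (intro sqi_measurable approximable_sqi approximable_sum union.IH)
        show "(indicator (\<Union> (range A)) :: _ \<Rightarrow> complex) \<in> borel_measurable Tm"
          using Ub by (intro measurable_Tm) simp
        show "AE z in Tm. (\<lambda>n. \<Sum>i<n. indicator (A i) z :: complex) \<longlonglongrightarrow> indicator (\<Union> (range A)) z"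
          unfolding sum_eq using LIMSEQ_indicator_UN[of A] by (intro AE_I2)
        show "AE z in Tm. (cmod ((\<Sum>i<n. indicator (A i) z) - indicator (\<Union> (range A)) z))\<^sup>2 \<le> 1" for n
          unfolding sum_eq by (intro AE_I2) (auto split: split_indicator)
      qed
    qed
  qed
qed

text \<open>Simple functions converge pointwise to f and stay below 2 |f|, so (2 + 1)^2 |f|^2
  dominates the squared error.\<close>

lemma sqi_approximable:
  assumes f: "sqi Tm f"
  shows "approximable f"
proof -
  note fm [measurable] = sqi_measurable[OF f]
  from borel_measurable_implies_sequence_metric[OF fm, of 0]
  obtain F where F': "\<forall>i. simple_function Tm (F i)" "\<forall>x\<in>space Tm. (\<lambda>i. F i x) \<longlonglongrightarrow> f x"
    "\<forall>i. \<forall>x\<in>space Tm. dist (F i x) 0 \<le> 2 * dist (f x) 0"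
    by (elim exE conjE)
  note F = F'[rule_format]
  show ?thesis
  proof (rule approximable_limit[OF _ f])
    have Fm [measurable]: "F i \<in> borel_measurable Tm" for i using F(1) by (rule borel_measurable_simple_function)
    have Fs: "sqi Tm (F i)" for i
      by (rule sqi_bound[OF f, of _ 2]) (use F(3) in auto)
    show "approximable (F i)" for i
    proof (rule approximable_cong_AE[OF _ Fs])
      show "approximable (\<lambda>z. \<Sum>y\<in>F i ` space Tm. y * indicator (F i -` {y} \<inter> space Tm) z)"
      proof (intro approximable_sum approximable_cmult approximable_indicator)
        fix y
        have "F i -` {y} \<inter> space Tm \<in> sets Tm" using F(1) by (rule simple_functionD(2))
        then show "F i -` {y} \<inter> space Tm \<in> sets borel"
          by (simp add: sets_restrict_space_iff)
      qed
      show "AE z in Tm. (\<Sum>y\<in>F i ` space Tm. y * indicator (F i -` {y} \<inter> space Tm) z) = F i z"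
      proof (rule AE_I2)
        fix z assume "z \<in> space Tm"
        have "(\<Sum>y\<in>F i ` space Tm. y * indicator (F i -` {y} \<inter> space Tm) z)
            = (\<Sum>y\<in>F i ` space Tm. indicator (F i -` {y} \<inter> space Tm) z *\<^sub>R y)"
          by (intro sum.cong refl) (auto split: split_indicator)
        also have "\<dots> = F i z"
          by (rule simple_function_indicator_representation_banach[OF F(1) \<open>z \<in> space Tm\<close>, symmetric])
        finally show "(\<Sum>y\<in>F i ` space Tm. y * indicator (F i -` {y} \<inter> space Tm) z) = F i z" .
      qed
    qed
    show "(\<lambda>i. l2n Tm (\<lambda>z. F i z - f z)) \<longlonglongrightarrow> 0"
    proof (rule l2n_tendsto_dominated[OF Fm fm])
      show "integrable Tm (\<lambda>z. 9 * (cmod (f z))\<^sup>2)" using sqi_integrable[OF f] by simp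
      show "AE z in Tm. (\<lambda>i. F i z) \<longlonglongrightarrow> f z" using F(2) by (intro AE_I2)
      show "AE z in Tm. (cmod (F i z - f z))\<^sup>2 \<le> 9 * (cmod (f z))\<^sup>2" for i
      proof (rule AE_I2)
        fix z assume "z \<in> space Tm"
        then have "cmod (F i z - f z) \<le> 3 * cmod (f z)"
          using F(3)[of z i] norm_triangle_ineq4[of "F i z" "f z"] by simp
        then have "(cmod (F i z - f z))\<^sup>2 \<le> (3 * cmod (f z))\<^sup>2" by (intro power_mono) auto
        then show "(cmod (F i z - f z))\<^sup>2 \<le> 9 * (cmod (f z))\<^sup>2" by (simp add: power_mult_distrib)
      qed
    qed
  qed
qed

text \<open>Replacing the coefficients of any good approximation by Fourier coefficients on the same
  index set only lowers the error: the last term of \<open>l2n_diff_tpoly\<close> becomes 0.\<close>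

lemma fourier_partial_sum_dense:
  assumes f: "sqi Tm f" and e: "e > 0"
  obtains P where "finite P" "l2n Tm (\<lambda>z. f z - tpoly P (fcoef f) z) < e"
proof -
  obtain g where g: "g \<in> trigs" "l2n Tm (\<lambda>z. f z - g z) < e"
    using sqi_approximable[OF f] e unfolding approximable_def by blast
  obtain P a where P: "finite P" "g = tpoly P a" using trigs_imp_tpoly[OF g(1)] .
  have "(l2n Tm (\<lambda>z. f z - tpoly P (fcoef f) z))\<^sup>2 \<le> (l2n Tm (\<lambda>z. f z - tpoly P a z))\<^sup>2"
    unfolding l2n_diff_tpoly[OF f P(1)] by (simp add: sum_nonneg)
  then have "l2n Tm (\<lambda>z. f z - tpoly P (fcoef f) z) \<le> l2n Tm (\<lambda>z. f z - tpoly P a z)"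
    by (rule power2_le_imp_le) simp
  then show ?thesis using that[OF P(1)] g(2) P(2) by simp
qed

lemma bessel:
  assumes "sqi Tm f" "finite P"
  shows "4 * pi\<^sup>2 * (\<Sum>p\<in>P. (cmod (fcoef f p))\<^sup>2) \<le> (l2n Tm f)\<^sup>2"
proof -
  have "0 \<le> (l2n Tm (\<lambda>z. f z - tpoly P (fcoef f) z))\<^sup>2" by simp
  then show ?thesis unfolding l2n_diff_tpoly[OF assms] by simp
qed

lemma l2n_tpoly:
  assumes "finite P"
  shows "(l2n Tm (tpoly P a))\<^sup>2 = 4 * pi\<^sup>2 * (\<Sum>p\<in>P. (cmod (a p))\<^sup>2)"
proof -
  have "(l2n Tm (\<lambda>z. tpoly P a z - tpoly P a z))\<^sup>2 = (l2n Tm (tpoly P a))\<^sup>2 - 4 * pi\<^sup>2 * (\<Sum>p\<in>P. (cmod (a p))\<^sup>2)"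
    unfolding l2n_diff_tpoly[OF sqi_tpoly assms] using assms by (simp add: fcoef_tpoly)
  then show ?thesis by simp
qed

section \<open>Modes in the first variable and integration by parts\<close>

definition xmode :: "int \<Rightarrow> (real \<times> real \<Rightarrow> complex) \<Rightarrow> int \<Rightarrow> complex" where
  "xmode l f j = fcoef f (l, j)"

text \<open>Bessel's inequality on the single row of frequencies with first entry l.\<close>

lemma sqi_xmode:
  assumes f: "sqi Tm f"
  shows "sqi Zm (xmode l f)" and "2 * pi * l2n Zm (xmode l f) \<le> l2n Tm f"
proof -
  have le: "(\<Sum>j\<in>P. (cmod (xmode l f j))\<^sup>2) \<le> (l2n Tm f)\<^sup>2 / (4 * pi\<^sup>2)" if "finite P" for P
  proof -
    have "(\<Sum>j\<in>P. (cmod (xmode l f j))\<^sup>2) = (\<Sum>p\<in>Pair l ` P. (cmod (fcoef f p))\<^sup>2)"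
      by (subst sum.reindex) (auto simp: xmode_def inj_on_def)
    then show ?thesis using bessel[OF f, of "Pair l ` P"] that by (simp add: field_simps)
  qed
  show "sqi Zm (xmode l f)"
    unfolding sqi_def using Zm_integrable_bounded_sums(1)[OF _ le] by simp
  have "(l2n Zm (xmode l f))\<^sup>2 \<le> (l2n Tm f)\<^sup>2 / (4 * pi\<^sup>2)"
    unfolding l2n_power2[of Zm] using Zm_integrable_bounded_sums(2)[OF _ le] by simp
  then have "(2 * pi * l2n Zm (xmode l f))\<^sup>2 \<le> (l2n Tm f)\<^sup>2"
    by (simp add: field_simps power_mult_distrib)
  then show "2 * pi * l2n Zm (xmode l f) \<le> l2n Tm f" by (rule power2_le_imp_le) simp
qed

lemma smooth_family_continuous: "smooth_family D \<Longrightarrow> continuous_on S (D i j)"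
  unfolding smooth_family_def using continuous_on_subset by blast

lemma smooth_family_dx:
  "smooth_family D \<Longrightarrow> ((\<lambda>s. D i j (s, y)) has_vector_derivative D (Suc i) j (x, y)) (at x)"
  by (simp add: smooth_family_def)

lemma smooth_family_dy:
  "smooth_family D \<Longrightarrow> ((\<lambda>s. D i j (x, s)) has_vector_derivative D i (Suc j) (x, y)) (at y)"
  by (simp add: smooth_family_def)

lemma has_vector_derivative_shift:
  assumes "(f has_vector_derivative D) (at (x + c))"
  shows "((\<lambda>s. f (s + c)) has_vector_derivative D) (at x)"
proof -
  have "((\<lambda>s. s + c) has_vector_derivative 1) (at x)"
    by (auto intro!: derivative_eq_intros)
  from vector_diff_chain_at[OF this assms] show ?thesis by (simp add: o_def)
qed

text \<open>Test functions are required to be periodic at order (0, 0) alone, while a second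
  integration by parts needs it for derivatives. They inherit the periods because a translate has
  the translated derivative and derivatives are unique.\<close>

lemma smooth_family_periodic:
  assumes D: "smooth_family D" and P: "doubly_periodic (D 0 0)"
  shows "doubly_periodic (D i j)"
proof -
  have x: "doubly_periodic (D (Suc i) j)" if P: "doubly_periodic (D i j)" for i j
    unfolding doubly_periodic_def
  proof (intro allI conjI)
    fix x y
    have "((\<lambda>s. D i j (s + 2 * pi, y)) has_vector_derivative D (Suc i) j (x + 2 * pi, y)) (at x)"
      by (rule has_vector_derivative_shift[OF smooth_family_dx[OF D]])
    then have "((\<lambda>s. D i j (s, y)) has_vector_derivative D (Suc i) j (x + 2 * pi, y)) (at x)"
      using P by (simp add: doubly_periodic_def)
    then show "D (Suc i) j (x + 2 * pi, y) = D (Suc i) j (x, y)"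
      using smooth_family_dx[OF D] vector_derivative_unique_at by blast
    have "((\<lambda>s. D i j (s, y + 2 * pi)) has_vector_derivative D (Suc i) j (x, y + 2 * pi)) (at x)"
      by (rule smooth_family_dx[OF D])
    then have "((\<lambda>s. D i j (s, y)) has_vector_derivative D (Suc i) j (x, y + 2 * pi)) (at x)"
      using P by (simp add: doubly_periodic_def)
    then show "D (Suc i) j (x, y + 2 * pi) = D (Suc i) j (x, y)"
      using smooth_family_dx[OF D] vector_derivative_unique_at by blast
  qed
  have y: "doubly_periodic (D i (Suc j))" if P: "doubly_periodic (D i j)" for i j
    unfolding doubly_periodic_def
  proof (intro allI conjI)
    fix x y
    have "((\<lambda>s. D i j (x, s + 2 * pi)) has_vector_derivative D i (Suc j) (x, y + 2 * pi)) (at y)"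
      by (rule has_vector_derivative_shift[OF smooth_family_dy[OF D]])
    then have "((\<lambda>s. D i j (x, s)) has_vector_derivative D i (Suc j) (x, y + 2 * pi)) (at y)"
      using P by (simp add: doubly_periodic_def)
    then show "D i (Suc j) (x, y + 2 * pi) = D i (Suc j) (x, y)"
      using smooth_family_dy[OF D] vector_derivative_unique_at by blast
    have "((\<lambda>s. D i j (x + 2 * pi, s)) has_vector_derivative D i (Suc j) (x + 2 * pi, y)) (at y)"
      by (rule smooth_family_dy[OF D])
    then have "((\<lambda>s. D i j (x, s)) has_vector_derivative D i (Suc j) (x + 2 * pi, y)) (at y)"
      using P by (simp add: doubly_periodic_def)
    then show "D i (Suc j) (x + 2 * pi, y) = D i (Suc j) (x, y)"
      using smooth_family_dy[OF D] vector_derivative_unique_at by blast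
  qed
  have "doubly_periodic (D i 0)" by (induction i) (auto intro: P x)
  then show ?thesis by (induction j) (auto intro: y)
qed

lemma smooth_family_tch: "smooth_family (\<lambda>i j z. (\<i> * of_int (fst p)) ^ i * (\<i> * of_int (snd p)) ^ j * tch p z)"
proof -
  obtain l m where p: "p = (l, m)" by fastforce
  show ?thesis
    unfolding smooth_family_def
  proof (intro allI conjI)
    fix i j :: nat and x y :: real
    show "continuous_on UNIV (\<lambda>z. (\<i> * of_int (fst p)) ^ i * (\<i> * of_int (snd p)) ^ j * tch p z)"
      by (intro continuous_intros)
    have "((\<lambda>s. cis (of_int l * s)) has_vector_derivative \<i> * of_int l * cis (of_int l * x)) (at x)"
      by (rule has_vector_derivative_cis)
    from has_vector_derivative_mult_right[OF this, of "(\<i> * of_int l) ^ i * (\<i> * of_int m) ^ j * cis (of_int m * y)"]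
    show "((\<lambda>s. (\<i> * of_int (fst p)) ^ i * (\<i> * of_int (snd p)) ^ j * tch p (s, y)) has_vector_derivative
      (\<i> * of_int (fst p)) ^ Suc i * (\<i> * of_int (snd p)) ^ j * tch p (x, y)) (at x)"
      by (simp add: p tch_split mult_ac)
    have "((\<lambda>s. cis (of_int m * s)) has_vector_derivative \<i> * of_int m * cis (of_int m * y)) (at y)"
      by (rule has_vector_derivative_cis)
    from has_vector_derivative_mult_right[OF this, of "(\<i> * of_int l) ^ i * (\<i> * of_int m) ^ j * cis (of_int l * x)"]
    show "((\<lambda>s. (\<i> * of_int (fst p)) ^ i * (\<i> * of_int (snd p)) ^ j * tch p (x, s)) has_vector_derivative
      (\<i> * of_int (fst p)) ^ i * (\<i> * of_int (snd p)) ^ Suc j * tch p (x, y)) (at y)"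
      by (simp add: p tch_split mult_ac)
  qed
qed

lemma doubly_periodic_tch: "doubly_periodic (tch p)"
  unfolding doubly_periodic_def
  by (cases p) (simp add: tch_split distrib_left cis_of_int_2pi flip: cis_mult)

text \<open>A weight depending on y alone passes through the x-derivative. It covers the drift term
  with a rough shear as well as the diffusion term with weight 1; boundary terms cancel by
  periodicity.\<close>

lemma integral_by_parts_x:
  assumes D: "smooth_family D" and P: "doubly_periodic (D 0 0)" and w: "continuous_on UNIV w"
  shows "(\<integral>z. w (snd z) * tch (l, m) z * D (Suc 0) 0 z \<partial>Tm) = - (\<i> * of_int l) * (\<integral>z. w (snd z) * tch (l, m) z * D 0 0 z \<partial>Tm)"
proof -
  have c1: "continuous_on UNIV (\<lambda>z. w (snd z) * tch (l, m) z * D i 0 z)" for i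
    by (intro continuous_intros smooth_family_continuous[OF D] continuous_on_compose2[OF w]) auto
  then have i1: "integrable Tm (\<lambda>z. w (snd z) * tch (l, m) z * D i 0 z)" for i
    by (rule integrable_Tm_continuous)
  have "(\<integral>z. w (snd z) * tch (l, m) z * D (Suc 0) 0 z + \<i> * of_int l * (w (snd z) * tch (l, m) z * D 0 0 z) \<partial>Tm)
      = (\<integral>y. (\<integral>x. w y * tch (l, m) (x, y) * D (Suc 0) 0 (x, y) + \<i> * of_int l * (w y * tch (l, m) (x, y) * D 0 0 (x, y)) \<partial>Pm) \<partial>Pm)"
    using i1 by (subst Tm_integral_iterated(3)) auto
  also have "\<dots> = (\<integral>y. 0 \<partial>Pm)"
  proof (intro Bochner_Integration.integral_cong refl)
    fix y
    define F where "F x = w y * cis (of_int m * y) * (cis (of_int l * x) * D 0 0 (x, y))" for x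
    have "((\<lambda>x. cis (of_int l * x) * D 0 0 (x, y)) has_vector_derivative
        cis (of_int l * x) * D (Suc 0) 0 (x, y) + \<i> * of_int l * cis (of_int l * x) * D 0 0 (x, y)) (at x)" for x
      by (rule has_vector_derivative_mult[OF has_vector_derivative_cis smooth_family_dx[OF D]])
    from has_vector_derivative_mult_right[OF this, of "w y * cis (of_int m * y)"]
    have F: "(F has_vector_derivative (w y * tch (l, m) (x, y) * D (Suc 0) 0 (x, y) + \<i> * of_int l * (w y * tch (l, m) (x, y) * D 0 0 (x, y)))) (at x)" for x
      unfolding F_def by (simp add: tch_split algebra_simps)
    have "(\<integral>x. w y * tch (l, m) (x, y) * D (Suc 0) 0 (x, y) + \<i> * of_int l * (w y * tch (l, m) (x, y) * D 0 0 (x, y)) \<partial>Pm) = F (2 * pi) - F 0"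
    proof (rule Pm_integral_derivative[OF F])
      show "continuous_on UNIV (\<lambda>x. w y * tch (l, m) (x, y) * D (Suc 0) 0 (x, y) + \<i> * of_int l * (w y * tch (l, m) (x, y) * D 0 0 (x, y)))"
        by (intro continuous_intros continuous_on_compose2[OF continuous_tch[of UNIV]]
            continuous_on_compose2[OF smooth_family_continuous[OF D, of UNIV]]) auto
    qed
    also have "F (2 * pi) = F 0"
      using P[unfolded doubly_periodic_def, rule_format, of 0 y] by (simp add: F_def cis_of_int_2pi)
    finally show "(\<integral>x. w y * tch (l, m) (x, y) * D (Suc 0) 0 (x, y) + \<i> * of_int l * (w y * tch (l, m) (x, y) * D 0 0 (x, y)) \<partial>Pm) = 0"
      by simp
  qed
  finally have "(\<integral>z. w (snd z) * tch (l, m) z * D (Suc 0) 0 z \<partial>Tm)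
      + \<i> * of_int l * (\<integral>z. w (snd z) * tch (l, m) z * D 0 0 z \<partial>Tm) = 0"
    using i1 by simp
  then show ?thesis by (simp add: eq_neg_iff_add_eq_0)
qed

text \<open>No weight here: one depending on y would be differentiated, and the shear is only known
  to be continuous. The diffusion in y is the one term that uses this direction.\<close>

lemma integral_by_parts_y:
  assumes D: "smooth_family D" and P: "doubly_periodic (D 0 0)"
  shows "(\<integral>z. tch (l, m) z * D 0 (Suc 0) z \<partial>Tm) = - (\<i> * of_int m) * (\<integral>z. tch (l, m) z * D 0 0 z \<partial>Tm)"
proof -
  have c1: "continuous_on UNIV (\<lambda>z. tch (l, m) z * D 0 i z)" for i
    by (intro continuous_intros smooth_family_continuous[OF D])
  then have i1: "integrable Tm (\<lambda>z. tch (l, m) z * D 0 i z)" for i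
    by (rule integrable_Tm_continuous)
  have "(\<integral>z. tch (l, m) z * D 0 (Suc 0) z + \<i> * of_int m * (tch (l, m) z * D 0 0 z) \<partial>Tm)
      = (\<integral>x. (\<integral>y. tch (l, m) (x, y) * D 0 (Suc 0) (x, y) + \<i> * of_int m * (tch (l, m) (x, y) * D 0 0 (x, y)) \<partial>Pm) \<partial>Pm)"
    using i1 by (subst Tm_integral_iterated') auto
  also have "\<dots> = (\<integral>x. 0 \<partial>Pm)"
  proof (intro Bochner_Integration.integral_cong refl)
    fix x
    define F where "F y = cis (of_int l * x) * (cis (of_int m * y) * D 0 0 (x, y))" for y
    have dF: "((\<lambda>y. cis (of_int m * y) * D 0 0 (x, y)) has_vector_derivative
        cis (of_int m * y) * D 0 (Suc 0) (x, y) + \<i> * of_int m * cis (of_int m * y) * D 0 0 (x, y)) (at y)" for y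
      by (rule has_vector_derivative_mult[OF has_vector_derivative_cis smooth_family_dy[OF D]])
    have F: "(F has_vector_derivative (tch (l, m) (x, y) * D 0 (Suc 0) (x, y) + \<i> * of_int m * (tch (l, m) (x, y) * D 0 0 (x, y)))) (at y)" for y
      unfolding F_def using has_vector_derivative_mult_right[OF dF[of y], of "cis (of_int l * x)"]
      by (simp add: tch_split algebra_simps)
    have "(\<integral>y. tch (l, m) (x, y) * D 0 (Suc 0) (x, y) + \<i> * of_int m * (tch (l, m) (x, y) * D 0 0 (x, y)) \<partial>Pm) = F (2 * pi) - F 0"
    proof (rule Pm_integral_derivative[OF F])
      show "continuous_on UNIV (\<lambda>y. tch (l, m) (x, y) * D 0 (Suc 0) (x, y) + \<i> * of_int m * (tch (l, m) (x, y) * D 0 0 (x, y)))"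
        by (intro continuous_intros continuous_on_compose2[OF continuous_tch[of UNIV]]
            continuous_on_compose2[OF smooth_family_continuous[OF D, of UNIV]]) auto
    qed
    also have "F (2 * pi) = F 0"
      using P[unfolded doubly_periodic_def, rule_format, of x 0] by (simp add: F_def cis_of_int_2pi)
    finally show "(\<integral>y. tch (l, m) (x, y) * D 0 (Suc 0) (x, y) + \<i> * of_int m * (tch (l, m) (x, y) * D 0 0 (x, y)) \<partial>Pm) = 0"
      by simp
  qed
  finally have "(\<integral>z. tch (l, m) z * D 0 (Suc 0) z \<partial>Tm) + \<i> * of_int m * (\<integral>z. tch (l, m) z * D 0 0 z \<partial>Tm) = 0"
    using i1 by simp
  then show ?thesis by (simp add: eq_neg_iff_add_eq_0)
qed

section \<open>The drift-diffusion operator in Fourier variables\<close>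

lemma summable_shear:
  fixes b c :: "nat \<Rightarrow> real"
  shows "summable (\<lambda>n. \<bar>b n\<bar>) \<Longrightarrow> summable (\<lambda>n. b n * sin (c n * y))"
  by (rule summable_comparison_test'[of "\<lambda>n. \<bar>b n\<bar>" 0]) (auto simp: abs_mult intro!: mult_left_le)

lemma shear_continuous:
  fixes b c :: "nat \<Rightarrow> real"
  assumes b: "summable (\<lambda>n. \<bar>b n\<bar>)" and u: "\<And>y. u y = (\<Sum>n. b n * sin (c n * y))"
  shows "continuous_on UNIV u"
proof -
  have "uniform_limit UNIV (\<lambda>n y. \<Sum>i<n. b i * sin (c i * y)) (\<lambda>y. \<Sum>i. b i * sin (c i * y)) sequentially"
    by (rule Weierstrass_m_test[OF _ b]) (auto simp: abs_mult intro!: mult_left_le)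
  then have "continuous_on UNIV (\<lambda>y. \<Sum>i. b i * sin (c i * y))"
    by (rule uniform_limit_theorem[rotated]) (auto intro!: always_eventually continuous_intros)
  then show ?thesis by (simp add: u[abs_def])
qed

lemma shear_periodic:
  fixes b :: "nat \<Rightarrow> real" and s :: "nat \<Rightarrow> int"
  assumes u: "\<And>y. u y = (\<Sum>n. b n * sin (of_int (s n) * y))"
  shows "u (y + 2 * pi) = u y"
proof -
  have "sin (of_int (s n) * (y + 2 * pi)) = sin (of_int (s n) * y)" for n
    using sin_int_2pin[of "s n"] cos_int_2pin[of "s n"]
    by (simp add: distrib_left sin_add mult_ac)
  then show ?thesis by (simp add: u)
qed

text \<open>Writing the sine as a difference of two characters over 2i turns multiplication by the
  shear into a series of shifts of the coefficients in y. The exchange of sum and integral is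
  dominated by |b n| |f|, integrable because the cell has finite measure.\<close>

lemma shear_fcoef:
  fixes b :: "nat \<Rightarrow> real" and s :: "nat \<Rightarrow> int"
  assumes b: "summable (\<lambda>n. \<bar>b n\<bar>)" and u: "\<And>y. u y = (\<Sum>n. b n * sin (of_int (s n) * y))"
    and f: "sqi Tm f"
  shows "(\<lambda>n. of_real (b n) * ((xmode l f (j - s n) - xmode l f (j + s n)) / (2 * \<i>))) sums fcoef (\<lambda>z. of_real (u (snd z)) * f z) (l, j)"
proof -
  define h where "h n z = of_real (b n * sin (of_int (s n) * snd z)) * (f z * cnj (tch (l, j) z))" for n z
  have ft: "integrable Tm (\<lambda>z. f z * cnj (tch (l, j) z))" by (rule integrable_mult_cnj_tch[OF f])
  have sin_tch: "of_real (sin (of_int (s n) * snd z)) * cnj (tch (l, j) z)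
      = (cnj (tch (l, j - s n) z) - cnj (tch (l, j + s n) z)) / (2 * \<i>)" for n z
  proof -
    have "of_real (sin (of_int (s n) * snd z)) = (tch (0, s n) z - tch (0, - s n) z) / (2 * \<i>)"
      by (simp add: tch_def complex_eq_iff)
    moreover have "tch (- l, - s n - j) z = tch (- l, - j - s n) z"
      by (rule arg_cong[where f = "\<lambda>m. tch (- l, m) z"]) simp
    ultimately show ?thesis by (simp add: cnj_tch tch_mult left_diff_distrib)
  qed
  have h_eq: "h n z = of_real (b n) * ((f z * cnj (tch (l, j - s n) z) - f z * cnj (tch (l, j + s n) z)) / (2 * \<i>))" for n z
  proof -
    have "h n z = of_real (b n) * (f z * (of_real (sin (of_int (s n) * snd z)) * cnj (tch (l, j) z)))"
      by (simp add: h_def mult_ac)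
    then show ?thesis unfolding sin_tch by (simp add: algebra_simps diff_divide_distrib)
  qed
  have bd: "norm (h n z) \<le> \<bar>b n\<bar> * cmod (f z)" for n z
    by (auto simp: h_def norm_mult abs_mult mult.assoc intro!: mult_left_mono mult_left_le_one_le)
  have hi: "integrable Tm (h n)" for n
    unfolding h_eq[abs_def] using f by (auto simp: integrable_mult_cnj_tch)
  have "(\<lambda>n. integral\<^sup>L Tm (h n)) sums (\<integral>z. (\<Sum>n. h n z) \<partial>Tm)"
  proof (rule sums_integral[OF hi])
    have "summable (\<lambda>n. norm (h n z))" for z
      by (rule summable_comparison_test'[OF summable_mult2[OF b, of "cmod (f z)"], of 0]) (simp add: bd)
    then show "AE z in Tm. summable (\<lambda>n. norm (h n z))" by simp
    show "summable (\<lambda>n. \<integral>z. norm (h n z) \<partial>Tm)"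
    proof (rule summable_comparison_test'[OF summable_mult2[OF b, of "\<integral>z. cmod (f z) \<partial>Tm"], of 0])
      fix n
      have "(\<integral>z. norm (h n z) \<partial>Tm) \<le> (\<integral>z. \<bar>b n\<bar> * cmod (f z) \<partial>Tm)"
        using hi[of n] sqi_Tm_integrable[OF f] bd by (intro integral_mono) auto
      then show "norm (\<integral>z. norm (h n z) \<partial>Tm) \<le> \<bar>b n\<bar> * (\<integral>z. cmod (f z) \<partial>Tm)" by simp
    qed
  qed
  moreover have "integral\<^sup>L Tm (h n) = of_real (b n) * ((xmode l f (j - s n) - xmode l f (j + s n)) / (2 * \<i>)) * (4 * pi\<^sup>2)" for n
  proof -
    have "integral\<^sup>L Tm (h n) = of_real (b n) * (((\<integral>z. f z * cnj (tch (l, j - s n) z) \<partial>Tm) - (\<integral>z. f z * cnj (tch (l, j + s n) z) \<partial>Tm)) / (2 * \<i>))"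
      unfolding h_eq[abs_def]
      by (simp only: integral_mult_right_zero integral_divide_zero Bochner_Integration.integral_diff integrable_mult_cnj_tch[OF f])
    then show ?thesis
      unfolding xmode_def fcoef_def by (simp flip: diff_divide_distrib)
  qed
  moreover have "(\<Sum>n. h n z) = of_real (u (snd z)) * f z * cnj (tch (l, j) z)" for z
  proof -
    have "summable (\<lambda>n. b n * sin (of_int (s n) * snd z))"
      by (rule summable_shear[OF b])
    then have "(\<lambda>n. complex_of_real (b n * sin (of_int (s n) * snd z))) sums of_real (u (snd z))"
      unfolding u by (intro sums_of_real summable_sums)
    from sums_mult2[OF this, of "f z * cnj (tch (l, j) z)"] show ?thesis
      by (auto simp: h_def mult.assoc dest: sums_unique)
  qed
  ultimately have "(\<lambda>n. of_real (b n) * ((xmode l f (j - s n) - xmode l f (j + s n)) / (2 * \<i>)) * (4 * pi\<^sup>2))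
      sums (\<integral>z. of_real (u (snd z)) * f z * cnj (tch (l, j) z) \<partial>Tm)" by simp
  from sums_divide[OF this, of "4 * pi\<^sup>2"] show ?thesis by (simp add: fcoef_def mult.left_commute)
qed

lemma sqi_mult_shear:
  assumes f: "sqi Tm f" and u: "continuous_on UNIV u"
  shows "sqi Tm (\<lambda>z. complex_of_real (u (snd z)) * f z)"
proof -
  have c: "continuous_on UNIV (\<lambda>z::real \<times> real. complex_of_real (u (snd z)))"
    by (intro continuous_intros continuous_on_compose2[OF u]) auto
  have "compact torus_cell" unfolding torus_cell_def by (intro compact_Times) auto
  then have "bounded ((\<lambda>z. complex_of_real (u (snd z))) ` torus_cell)"
    by (intro compact_imp_bounded compact_continuous_image continuous_on_subset[OF c]) auto
  then obtain B where "\<And>z. z \<in> torus_cell \<Longrightarrow> cmod (complex_of_real (u (snd z))) \<le> B"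
    unfolding bounded_iff by blast
  then show ?thesis
    by (intro sqi_mult_bounded[OF f, of _ B]) (use c in \<open>auto intro!: measurable_Tm borel_measurable_continuous_onI\<close>)
qed

text \<open>Testing the weak equation with a conjugate character reads off one coefficient.
  \<open>V\<close> is 2i times the coefficients of u f, so the drift -i l (u f) becomes -(l/2) V,
  and its square summability follows from boundedness of u on the cell.\<close>

lemma drift_diffusion_xmode:
  fixes b :: "nat \<Rightarrow> real" and s :: "nat \<Rightarrow> int" and l j :: int
  assumes b: "summable (\<lambda>n. \<bar>b n\<bar>)" and u: "\<And>y. u y = (\<Sum>n. b n * sin (of_int (s n) * y))"
    and f: "sqi Tm f" and g: "sqi Tm g" and op: "drift_diffusion_op \<nu>x \<nu> u f g"
  defines "V \<equiv> \<lambda>j. \<Sum>n. of_real (b n) * (xmode l f (j - s n) - xmode l f (j + s n))"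
  shows "sqi Zm V"
    and "xmode l g j = - of_real (\<nu>x * (of_int l)\<^sup>2 + \<nu> * (of_int j)\<^sup>2) * xmode l f j - of_real (of_int l / 2) * V j"
proof -
  have uc: "continuous_on UNIV u" by (rule shear_continuous[OF b u])
  have uf: "sqi Tm (\<lambda>z. complex_of_real (u (snd z)) * f z)" by (rule sqi_mult_shear[OF f uc])
  have V: "V j = 2 * \<i> * xmode l (\<lambda>z. of_real (u (snd z)) * f z) j" for j
  proof -
    have "(\<lambda>n. of_real (b n) * (xmode l f (j - s n) - xmode l f (j + s n))) sums (2 * \<i> * xmode l (\<lambda>z. of_real (u (snd z)) * f z) j)"
    proof -
      have "2 * \<i> * (of_real (b n) * ((xmode l f (j - s n) - xmode l f (j + s n)) / (2 * \<i>)))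
          = of_real (b n) * (xmode l f (j - s n) - xmode l f (j + s n))" for n
        by (simp add: mult_ac)
      then show ?thesis
        using sums_mult[OF shear_fcoef[OF b u f, of l j], of "2 * \<i>"] unfolding xmode_def[of l "\<lambda>z. of_real (u (snd z)) * f z"] by simp
    qed
    then show ?thesis unfolding V_def by (rule sums_unique[symmetric])
  qed
  show "sqi Zm V" unfolding V[abs_def] by (intro sqi_cmult sqi_xmode(1) uf)
  \<comment> \<open>All derivatives of the character with frequency (-l, -j), the conjugate of the
    one that defines the coefficient.\<close>
  define D where "D = (\<lambda>i j' z. (\<i> * of_int (fst (- l, - j))) ^ i * (\<i> * of_int (snd (- l, - j))) ^ j' * tch (- l, - j) z)"
  have D00: "D 0 0 = tch (- l, - j)" by (simp add: D_def)
  have "smooth_family D" unfolding D_def by (rule smooth_family_tch)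
  moreover have "doubly_periodic (D 0 0)" unfolding D00 by (rule doubly_periodic_tch)
  ultimately have eq: "(\<integral>z. g z * D 0 0 z \<partial>Tm) = (\<integral>z. f z * (of_real \<nu>x * D 2 0 z + of_real \<nu> * D 0 2 z + of_real (u (snd z)) * D 1 0 z) \<partial>Tm)"
    using op unfolding drift_diffusion_op_def Tm_integral by blast
  have D_cnj: "tch (- l, - j) z = cnj (tch (l, j) z)" for z by (simp add: cnj_tch)
  have "f z * (of_real \<nu>x * D 2 0 z + of_real \<nu> * D 0 2 z + of_real (u (snd z)) * D 1 0 z)
     = - of_real (\<nu>x * (of_int l)\<^sup>2 + \<nu> * (of_int j)\<^sup>2) * (f z * cnj (tch (l, j) z))
       + - (\<i> * of_int l) * ((of_real (u (snd z)) * f z) * cnj (tch (l, j) z))" for z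
    unfolding D_def D_cnj by (simp add: power_mult_distrib algebra_simps)
  then have "(\<integral>z. g z * cnj (tch (l, j) z) \<partial>Tm)
     = - of_real (\<nu>x * (of_int l)\<^sup>2 + \<nu> * (of_int j)\<^sup>2) * (\<integral>z. f z * cnj (tch (l, j) z) \<partial>Tm)
       + - (\<i> * of_int l) * (\<integral>z. (of_real (u (snd z)) * f z) * cnj (tch (l, j) z) \<partial>Tm)"
    using eq integrable_mult_cnj_tch[OF f, of "(l, j)"] integrable_mult_cnj_tch[OF uf, of "(l, j)"]
    unfolding D00 D_cnj
    by (simp only: Bochner_Integration.integral_add integrable_mult_right integral_mult_right_zero)
  from arg_cong[OF this, of "\<lambda>w. w / (4 * pi\<^sup>2)"]
  have "xmode l g j = - of_real (\<nu>x * (of_int l)\<^sup>2 + \<nu> * (of_int j)\<^sup>2) * xmode l f j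
     + - (\<i> * of_int l) * xmode l (\<lambda>z. of_real (u (snd z)) * f z) j"
    unfolding xmode_def fcoef_def by (simp only: add_divide_distrib times_divide_eq_right)
  then show "xmode l g j = - of_real (\<nu>x * (of_int l)\<^sup>2 + \<nu> * (of_int j)\<^sup>2) * xmode l f j - of_real (of_int l / 2) * V j"
    unfolding V by simp
qed

section \<open>Trigonometric polynomials belong to the domain\<close>

lemma L2_torus_add: "f \<in> L2_torus \<Longrightarrow> g \<in> L2_torus \<Longrightarrow> (\<lambda>z. f z + g z) \<in> L2_torus"
  by (auto simp: L2_torus_iff doubly_periodic_def intro: sqi_add)

lemma L2_torus_cmult: "f \<in> L2_torus \<Longrightarrow> (\<lambda>z. c * f z) \<in> L2_torus"
  by (auto simp: L2_torus_iff doubly_periodic_def intro: sqi_cmult)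

lemma L2_torus_diff: "f \<in> L2_torus \<Longrightarrow> g \<in> L2_torus \<Longrightarrow> (\<lambda>z. f z - g z) \<in> L2_torus"
  by (auto simp: L2_torus_iff doubly_periodic_def intro: sqi_diff)

lemma L2_torus_divide: "f \<in> L2_torus \<Longrightarrow> (\<lambda>z. f z / c) \<in> L2_torus"
  by (auto simp: L2_torus_iff doubly_periodic_def intro: sqi_divide)

lemma L2_torus_tch: "tch p \<in> L2_torus"
  by (simp add: L2_torus_iff doubly_periodic_tch sqi_tch)

lemma L2_torus_tpoly: "tpoly P a \<in> L2_torus"
proof (induction P rule: infinite_finite_induct)
  case (insert p P)
  have "tpoly (insert p P) a = (\<lambda>z. a p * tch p z + tpoly P a z)"
    using insert by (simp add: tpoly_def fun_eq_iff)
  then show ?case using insert by (simp add: L2_torus_add L2_torus_cmult L2_torus_tch)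
qed (simp_all add: tpoly_def[abs_def] L2_torus_iff doubly_periodic_def)

lemma drift_diffusion_test_sqi:
  assumes D: "smooth_family D" and u: "continuous_on UNIV u"
  shows "sqi Tm (\<lambda>z. of_real \<nu>x * D 2 0 z + of_real \<nu> * D 0 2 z + of_real (u (snd z)) * D 1 0 z)"
  by (intro sqi_add sqi_cmult sqi_mult_shear u sqi_Tm_continuous smooth_family_continuous[OF D])

lemma drift_diffusion_add:
  assumes u: "continuous_on UNIV u" and s: "sqi Tm f" "sqi Tm g" "sqi Tm f'" "sqi Tm g'"
    and "drift_diffusion_op \<nu>x \<nu> u f g" "drift_diffusion_op \<nu>x \<nu> u f' g'"
  shows "drift_diffusion_op \<nu>x \<nu> u (\<lambda>z. f z + f' z) (\<lambda>z. g z + g' z)"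
  unfolding drift_diffusion_op_def Tm_integral
proof (intro allI impI)
  fix D assume D: "smooth_family D \<and> doubly_periodic (D 0 0)"
  define T where "T = (\<lambda>z. of_real \<nu>x * D 2 0 z + of_real \<nu> * D 0 2 z + of_real (u (snd z)) * D 1 0 z)"
  have T: "sqi Tm T" unfolding T_def using D by (intro drift_diffusion_test_sqi u) auto
  have D0: "sqi Tm (D 0 0)" using D by (intro sqi_Tm_continuous smooth_family_continuous) auto
  have "(\<integral>z. g z * D 0 0 z \<partial>Tm) = (\<integral>z. f z * T z \<partial>Tm)" "(\<integral>z. g' z * D 0 0 z \<partial>Tm) = (\<integral>z. f' z * T z \<partial>Tm)"
    using assms(6,7) D unfolding drift_diffusion_op_def Tm_integral T_def by blast+
  then have "(\<integral>z. (g z + g' z) * D 0 0 z \<partial>Tm) = (\<integral>z. (f z + f' z) * T z \<partial>Tm)"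
    unfolding distrib_right
    by (simp only: Bochner_Integration.integral_add sqi_integrable_mult[OF s(1) T] sqi_integrable_mult[OF s(3) T]
        sqi_integrable_mult[OF s(2) D0] sqi_integrable_mult[OF s(4) D0])
  then show "(\<integral>z. (g z + g' z) * D 0 0 z \<partial>Tm) = (\<integral>z. (f z + f' z) *
      (of_real \<nu>x * D 2 0 z + of_real \<nu> * D 0 2 z + of_real (u (snd z)) * D 1 0 z) \<partial>Tm)"
    unfolding T_def .
qed

lemma drift_diffusion_cmult:
  assumes "drift_diffusion_op \<nu>x \<nu> u f g"
  shows "drift_diffusion_op \<nu>x \<nu> u (\<lambda>z. c * f z) (\<lambda>z. c * g z)"
  using assms unfolding drift_diffusion_op_def Tm_integral mult.assoc by simp

text \<open>Every derivative moves from the test function to the character. The drift differentiates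
  in x alone, so continuity of u is enough.\<close>

lemma drift_diffusion_tch:
  assumes u: "continuous_on UNIV u"
  shows "drift_diffusion_op \<nu>x \<nu> u (tch (l, m))
    (\<lambda>z. - of_real (\<nu>x * (of_int l)\<^sup>2 + \<nu> * (of_int m)\<^sup>2) * tch (l, m) z - \<i> * of_int l * (of_real (u (snd z)) * tch (l, m) z))"
  unfolding drift_diffusion_op_def Tm_integral
proof (intro allI impI)
  fix D assume *: "smooth_family D \<and> doubly_periodic (D 0 0)"
  then have D: "smooth_family D" and P: "doubly_periodic (D 0 0)" by auto
  \<comment> \<open>Shifting an index yields a smooth family again, so the second integration by
    parts is the first one applied to a derivative of the test function.\<close>
  have Dx: "smooth_family (\<lambda>i. D (Suc i))" using D by (simp add: smooth_family_def)
  have Dy: "smooth_family (\<lambda>i j. D i (Suc j))" using D by (simp add: smooth_family_def)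
  define X where "X = (\<integral>z. tch (l, m) z * D 0 0 z \<partial>Tm)"
  define Y where "Y = (\<integral>z. of_real (u (snd z)) * tch (l, m) z * D 0 0 z \<partial>Tm)"
  have x1: "(\<integral>z. tch (l, m) z * D (Suc 0) 0 z \<partial>Tm) = - (\<i> * of_int l) * X"
    using integral_by_parts_x[OF D P, of "\<lambda>_. 1" l m] by (simp add: X_def)
  have x2: "(\<integral>z. tch (l, m) z * D 2 0 z \<partial>Tm) = - (of_int l)\<^sup>2 * X"
    using integral_by_parts_x[OF Dx smooth_family_periodic[OF D P], of "\<lambda>_. 1" l m] x1
    by (simp add: numeral_2_eq_2 power2_eq_square mult_ac)
  have y1: "(\<integral>z. tch (l, m) z * D 0 (Suc 0) z \<partial>Tm) = - (\<i> * of_int m) * X"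
    using integral_by_parts_y[OF D P, of l m] by (simp add: X_def)
  have y2: "(\<integral>z. tch (l, m) z * D 0 2 z \<partial>Tm) = - (of_int m)\<^sup>2 * X"
    using integral_by_parts_y[OF Dy smooth_family_periodic[OF D P], of l m] y1
    by (simp add: numeral_2_eq_2 power2_eq_square mult_ac)
  have cu: "continuous_on UNIV (\<lambda>y. complex_of_real (u y))" by (intro continuous_intros u)
  have ux: "(\<integral>z. of_real (u (snd z)) * tch (l, m) z * D (Suc 0) 0 z \<partial>Tm) = - (\<i> * of_int l) * Y"
    using integral_by_parts_x[OF D P cu, of l m] by (simp add: Y_def)
  have i1: "integrable Tm (\<lambda>z. tch (l, m) z * D i j z)" for i j
    by (intro sqi_integrable_mult sqi_tch sqi_Tm_continuous smooth_family_continuous[OF D])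
  have i2: "integrable Tm (\<lambda>z. of_real (u (snd z)) * tch (l, m) z * D i j z)" for i j
    by (intro sqi_integrable_mult sqi_mult_shear u sqi_tch sqi_Tm_continuous smooth_family_continuous[OF D])
  have "(\<integral>z. (- of_real (\<nu>x * (of_int l)\<^sup>2 + \<nu> * (of_int m)\<^sup>2) * tch (l, m) z - \<i> * of_int l * (of_real (u (snd z)) * tch (l, m) z)) * D 0 0 z \<partial>Tm)
     = (\<integral>z. - of_real (\<nu>x * (of_int l)\<^sup>2 + \<nu> * (of_int m)\<^sup>2) * (tch (l, m) z * D 0 0 z) - \<i> * of_int l * (of_real (u (snd z)) * tch (l, m) z * D 0 0 z) \<partial>Tm)"
    by (simp only: left_diff_distrib mult.assoc)
  also have "\<dots> = - of_real (\<nu>x * (of_int l)\<^sup>2 + \<nu> * (of_int m)\<^sup>2) * X - \<i> * of_int l * Y"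
    unfolding X_def Y_def
    by (simp only: Bochner_Integration.integral_diff integrable_mult_right i1 i2 integral_mult_right_zero)
  also have "\<dots> = of_real \<nu>x * (- (of_int l)\<^sup>2 * X) + of_real \<nu> * (- (of_int m)\<^sup>2 * X) + - (\<i> * of_int l) * Y"
    by (simp add: algebra_simps)
  also have "\<dots> = (\<integral>z. of_real \<nu>x * (tch (l, m) z * D 2 0 z) + of_real \<nu> * (tch (l, m) z * D 0 2 z)
      + of_real (u (snd z)) * tch (l, m) z * D (Suc 0) 0 z \<partial>Tm)"
    unfolding x2[symmetric] y2[symmetric] ux[symmetric]
    by (simp only: Bochner_Integration.integral_add Bochner_Integration.integrable_add integrable_mult_right i1 i2 integral_mult_right_zero)
  also have "\<dots> = (\<integral>z. tch (l, m) z * (of_real \<nu>x * D 2 0 z + of_real \<nu> * D 0 2 z + of_real (u (snd z)) * D 1 0 z) \<partial>Tm)"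
    by (simp add: algebra_simps)
  finally show "(\<integral>z. (- of_real (\<nu>x * (of_int l)\<^sup>2 + \<nu> * (of_int m)\<^sup>2) * tch (l, m) z - \<i> * of_int l * (of_real (u (snd z)) * tch (l, m) z)) * D 0 0 z \<partial>Tm)
     = (\<integral>z. tch (l, m) z * (of_real \<nu>x * D 2 0 z + of_real \<nu> * D 0 2 z + of_real (u (snd z)) * D 1 0 z) \<partial>Tm)" .
qed

lemma L2_torus_mult_shear:
  assumes f: "f \<in> L2_torus" and u: "continuous_on UNIV u" and p: "\<And>y. u (y + 2 * pi) = u y"
  shows "(\<lambda>z. complex_of_real (u (snd z)) * f z) \<in> L2_torus"
proof -
  have "continuous_on UNIV (\<lambda>z::real \<times> real. complex_of_real (u (snd z)))"
    by (intro continuous_intros continuous_on_compose2[OF u]) auto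
  then have "(\<lambda>z::real \<times> real. complex_of_real (u (snd z))) \<in> borel_measurable borel"
    by (rule borel_measurable_continuous_onI)
  then show ?thesis
    using f p sqi_mult_shear[OF _ u] by (auto simp: L2_torus_iff doubly_periodic_def)
qed

text \<open>Supplies a dense set of initial data with differentiable orbits. The image is asserted
  only to exist, since afterwards it matters solely as the generator applied to the datum.\<close>

lemma tpoly_in_domain:
  assumes u: "continuous_on UNIV u" and p: "\<And>y. u (y + 2 * pi) = u y"
  shows "\<exists>q\<in>L2_torus. drift_diffusion_op \<nu>x \<nu> u (tpoly P a) q"
proof (induction P rule: infinite_finite_induct)
  case (insert r P)
  obtain l m where r: "r = (l, m)" by fastforce
  obtain q where q: "q \<in> L2_torus" "drift_diffusion_op \<nu>x \<nu> u (tpoly P a) q" using insert by blast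
  define q' where "q' = (\<lambda>z. - of_real (\<nu>x * (of_int l)\<^sup>2 + \<nu> * (of_int m)\<^sup>2) * tch (l, m) z - \<i> * of_int l * (of_real (u (snd z)) * tch (l, m) z))"
  have q': "q' \<in> L2_torus"
    unfolding q'_def by (intro L2_torus_diff L2_torus_cmult L2_torus_tch L2_torus_mult_shear u p)
  have "tpoly (insert r P) a = (\<lambda>z. a r * tch (l, m) z + tpoly P a z)"
    using insert by (simp add: tpoly_def fun_eq_iff r)
  moreover have "drift_diffusion_op \<nu>x \<nu> u (\<lambda>z. a r * tch (l, m) z + tpoly P a z) (\<lambda>z. a r * q' z + q z)"
    unfolding q'_def
    by (intro drift_diffusion_add drift_diffusion_cmult drift_diffusion_tch u q sqi_cmult sqi_tch sqi_tpoly
        L2_torus_sqi[OF q(1)] L2_torus_sqi[OF q'[unfolded q'_def]])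
  moreover have "(\<lambda>z. a r * q' z + q z) \<in> L2_torus"
    by (intro L2_torus_add L2_torus_cmult q q')
  ultimately show ?case by auto
\<comment> \<open>The sum over the empty set and, by convention, over an infinite one is the zero
  function, whose image is zero.\<close>
qed (auto intro!: bexI[of _ "\<lambda>z. 0"] simp: tpoly_def[abs_def] drift_diffusion_op_def L2_torus_iff doubly_periodic_def set_lebesgue_integral_def)

section \<open>Orbits of strongly continuous semigroups\<close>

text \<open>Continuity of a bounded quadratic form: with d = c s - c t the increment is the form at
  d plus twice its polarisation at c t and d.\<close>

lemma lyap_curve_continuous:
  fixes c :: "real \<Rightarrow> int \<Rightarrow> complex"
  assumes c: "\<And>t. t \<ge> 0 \<Longrightarrow> sqi Zm (c t)"
    and lim: "\<And>t. t \<ge> 0 \<Longrightarrow> ((\<lambda>s. l2n Zm (\<lambda>j. c s j - c t j)) \<longlongrightarrow> 0) (at t within {0..})"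
  shows "continuous_on {0..} (\<lambda>t. lyap \<tau> N (c t) (c t))"
  unfolding continuous_on_def
proof
  fix t :: real assume t: "t \<in> {0..}"
  define F where "F = at t within {0..}"
  define e where "e s = l2n Zm (\<lambda>j. c s j - c t j)" for s
  have lim': "(e \<longlongrightarrow> 0) F" using lim t by (simp add: F_def e_def[abs_def])
  have le: "\<bar>lyap \<tau> N (c s) (c s) - lyap \<tau> N (c t) (c t)\<bar> \<le> (1 + \<bar>\<tau>\<bar>) * (e s * e s + 2 * (l2n Zm (c t) * e s))" if s: "s \<ge> 0" for s
  proof -
    define d where "d = (\<lambda>j. c s j - c t j)"
    have ct: "sqi Zm (c t)" using c t by simp
    have d: "sqi Zm d" unfolding d_def using c s t by (intro sqi_diff) auto
    have cs: "c s = (\<lambda>j. c t j + d j)" by (simp add: d_def)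
    have "lyap \<tau> N (c s) (c s) = lyap \<tau> N (c s) (c t) + lyap \<tau> N (c s) d"
      using lyap_add_right[OF c[OF s] ct d] unfolding cs[symmetric] .
    also have "lyap \<tau> N (c s) (c t) = lyap \<tau> N (c t) (c t) + lyap \<tau> N (c t) d"
      using lyap_add_right[OF ct ct d] unfolding cs[symmetric] by (simp add: lyap_commute)
    also have "lyap \<tau> N (c s) d = lyap \<tau> N (c t) d + lyap \<tau> N d d"
      using lyap_add_right[OF d ct d] unfolding cs[symmetric] by (metis lyap_commute)
    finally have "lyap \<tau> N (c s) (c s) - lyap \<tau> N (c t) (c t) = lyap \<tau> N d d + 2 * lyap \<tau> N (c t) d"
      by simp
    also have "\<bar>\<dots>\<bar> \<le> (1 + \<bar>\<tau>\<bar>) * (e s * e s) + 2 * ((1 + \<bar>\<tau>\<bar>) * (l2n Zm (c t) * e s))"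
      using lyap_bound[OF d d, of \<tau> N] lyap_bound[OF ct d, of \<tau> N]
      unfolding e_def d_def[symmetric] by linarith
    finally show ?thesis by (simp add: algebra_simps)
  qed
  have "((\<lambda>s. lyap \<tau> N (c s) (c s) - lyap \<tau> N (c t) (c t)) \<longlongrightarrow> 0) F"
  proof (rule Lim_null_comparison)
    show "\<forall>\<^sub>F s in F. norm (lyap \<tau> N (c s) (c s) - lyap \<tau> N (c t) (c t)) \<le> (1 + \<bar>\<tau>\<bar>) * (e s * e s + 2 * (l2n Zm (c t) * e s))"
      unfolding F_def eventually_at_filter using le by (auto intro!: always_eventually)
    have "((\<lambda>s. (1 + \<bar>\<tau>\<bar>) * (e s * e s + 2 * (l2n Zm (c t) * e s))) \<longlongrightarrow> (1 + \<bar>\<tau>\<bar>) * (0 * 0 + 2 * (l2n Zm (c t) * 0))) F"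
      by (intro tendsto_intros lim')
    then show "((\<lambda>s. (1 + \<bar>\<tau>\<bar>) * (e s * e s + 2 * (l2n Zm (c t) * e s))) \<longlongrightarrow> 0) F" by simp
  qed
  then show "((\<lambda>s. lyap \<tau> N (c s) (c s)) \<longlongrightarrow> lyap \<tau> N (c t) (c t)) (at t within {0..})"
    unfolding F_def by (rule LIM_zero_cancel)
qed

text \<open>Differentiation of a bounded quadratic form. With \<open>d\<close> the difference
  quotient, the increment over h equals 2 \<open>lyap\<close> at (c t, d) plus h times
  \<open>lyap\<close> at (d, d), and \<open>d\<close> tends to \<open>g\<close> in norm. The limit
  is taken over h > 0, hence a right derivative.\<close>

lemma lyap_curve_derivative:
  fixes c :: "real \<Rightarrow> int \<Rightarrow> complex"
  assumes t: "t \<ge> 0" and c: "\<And>t. t \<ge> 0 \<Longrightarrow> sqi Zm (c t)" and g: "sqi Zm g"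
    and lim: "((\<lambda>h. l2n Zm (\<lambda>j. (c (t + h) j - c t j) / of_real h - g j)) \<longlongrightarrow> 0) (at_right 0)"
  shows "((\<lambda>t. lyap \<tau> N (c t) (c t)) has_real_derivative 2 * lyap \<tau> N (c t) g) (at t within {t..})"
proof -
  have ct: "sqi Zm (c t)" using c t by simp
  define r where "r h = (\<lambda>j. (c (t + h) j - c t j) / of_real h - g j)" for h
  define e where "e h = l2n Zm (r h)" for h
  have e: "(e \<longlongrightarrow> 0) (at_right 0)" using lim by (simp add: e_def[abs_def] r_def)
  define K where "K = 1 + \<bar>\<tau>\<bar>"
  have K: "K \<ge> 0" by (simp add: K_def)
  have le: "\<bar>(lyap \<tau> N (c (h + t)) (c (h + t)) - lyap \<tau> N (c t) (c t)) / h - 2 * lyap \<tau> N (c t) g\<bar>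
      \<le> 2 * (K * (l2n Zm (c t) * e h)) + h * (K * ((l2n Zm g + e h) * (l2n Zm g + e h)))" if h: "h > 0" for h
  proof -
    have r: "sqi Zm (r h)" unfolding r_def using c g t h by (intro sqi_diff sqi_divide) auto
    define d where "d = (\<lambda>j. g j + r h j)"
    have d: "sqi Zm d" unfolding d_def by (intro sqi_add g r)
    have hd: "sqi Zm (\<lambda>j. of_real h * d j)" by (intro sqi_cmult d)
    have cs: "c (h + t) = (\<lambda>j. c t j + of_real h * d j)"
      using h by (simp add: d_def r_def add.commute)
    have csq: "sqi Zm (c (h + t))" using c t h by simp
    have "lyap \<tau> N (c (h + t)) (c (h + t)) = lyap \<tau> N (c (h + t)) (c t) + lyap \<tau> N (c (h + t)) (\<lambda>j. of_real h * d j)"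
      using lyap_add_right[OF csq ct hd] unfolding cs[symmetric] .
    also have "lyap \<tau> N (c (h + t)) (c t) = lyap \<tau> N (c t) (c t) + h * lyap \<tau> N (c t) d"
      using lyap_add_right[OF ct ct hd] unfolding cs[symmetric] lyap_scale_right by (simp add: lyap_commute)
    also have "lyap \<tau> N (c (h + t)) (\<lambda>j. of_real h * d j) = h * lyap \<tau> N d (c (h + t))"
      unfolding lyap_scale_right by (simp add: lyap_commute)
    also have "lyap \<tau> N d (c (h + t)) = lyap \<tau> N (c t) d + h * lyap \<tau> N d d"
      using lyap_add_right[OF d ct hd] unfolding cs[symmetric] lyap_scale_right by (simp add: lyap_commute)
    finally have "(lyap \<tau> N (c (h + t)) (c (h + t)) - lyap \<tau> N (c t) (c t)) / h = 2 * lyap \<tau> N (c t) d + h * lyap \<tau> N d d"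
      using h by (simp add: field_simps)
    also have "lyap \<tau> N (c t) d = lyap \<tau> N (c t) g + lyap \<tau> N (c t) (r h)"
      unfolding d_def by (rule lyap_add_right[OF ct g r])
    finally have "(lyap \<tau> N (c (h + t)) (c (h + t)) - lyap \<tau> N (c t) (c t)) / h - 2 * lyap \<tau> N (c t) g
        = 2 * lyap \<tau> N (c t) (r h) + h * lyap \<tau> N d d" by simp
    also have "\<bar>\<dots>\<bar> \<le> 2 * \<bar>lyap \<tau> N (c t) (r h)\<bar> + h * \<bar>lyap \<tau> N d d\<bar>"
      using h by (metis (no_types, opaque_lifting) abs_mult abs_numeral abs_of_pos abs_triangle_ineq)
    also have "\<dots> \<le> 2 * (K * (l2n Zm (c t) * e h)) + h * (K * ((l2n Zm g + e h) * (l2n Zm g + e h)))"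
    proof (intro add_mono mult_left_mono)
      show "\<bar>lyap \<tau> N (c t) (r h)\<bar> \<le> K * (l2n Zm (c t) * e h)"
        unfolding K_def e_def by (rule lyap_bound[OF ct r])
      have "\<bar>lyap \<tau> N d d\<bar> \<le> K * (l2n Zm d * l2n Zm d)"
        unfolding K_def by (rule lyap_bound[OF d d])
      also have "\<dots> \<le> K * ((l2n Zm g + e h) * (l2n Zm g + e h))"
        using l2n_triangle[OF g r] K by (intro mult_left_mono mult_mono) (auto simp: d_def e_def)
      finally show "\<bar>lyap \<tau> N d d\<bar> \<le> K * ((l2n Zm g + e h) * (l2n Zm g + e h))" .
    qed (use h in auto)
    finally show ?thesis .
  qed
  have "((\<lambda>h. (lyap \<tau> N (c (h + t)) (c (h + t)) - lyap \<tau> N (c t) (c t)) / h - 2 * lyap \<tau> N (c t) g) \<longlongrightarrow> 0) (at_right 0)"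
  proof (rule Lim_null_comparison)
    show "\<forall>\<^sub>F h in at_right 0. norm ((lyap \<tau> N (c (h + t)) (c (h + t)) - lyap \<tau> N (c t) (c t)) / h - 2 * lyap \<tau> N (c t) g)
        \<le> 2 * (K * (l2n Zm (c t) * e h)) + h * (K * ((l2n Zm g + e h) * (l2n Zm g + e h)))"
      unfolding eventually_at_filter using le by (auto intro!: always_eventually)
    have "((\<lambda>h. 2 * (K * (l2n Zm (c t) * e h)) + h * (K * ((l2n Zm g + e h) * (l2n Zm g + e h))))
       \<longlongrightarrow> 2 * (K * (l2n Zm (c t) * 0)) + 0 * (K * ((l2n Zm g + 0) * (l2n Zm g + 0)))) (at_right 0)"
      by (intro tendsto_intros e)
    then show "((\<lambda>h. 2 * (K * (l2n Zm (c t) * e h)) + h * (K * ((l2n Zm g + e h) * (l2n Zm g + e h)))) \<longlongrightarrow> 0) (at_right 0)"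
      by simp
  qed
  then have "((\<lambda>h. (lyap \<tau> N (c (h + t)) (c (h + t)) - lyap \<tau> N (c t) (c t)) / (h + t - t)) \<longlongrightarrow> 2 * lyap \<tau> N (c t) g) (at_right 0)"
    using LIM_zero_cancel by (simp only: add_diff_cancel_right')
  then have "((\<lambda>s. (lyap \<tau> N (c s) (c s) - lyap \<tau> N (c t) (c t)) / (s - t)) \<longlongrightarrow> 2 * lyap \<tau> N (c t) g) (at_right t)"
    unfolding filterlim_at_right_to_0[of _ _ t] .
  then show ?thesis
    unfolding has_field_derivative_iff at_within_Ici_at_right .
qed

section \<open>Continuity and differentiability of orbits\<close>

lemma C0_semigroupD:
  assumes "C0_semigroup S"
  shows C0_semigroup_in: "\<And>t f. t \<ge> 0 \<Longrightarrow> f \<in> L2_torus \<Longrightarrow> S t f \<in> L2_torus"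
    and C0_semigroup_linear: "\<And>t f g c. t \<ge> 0 \<Longrightarrow> f \<in> L2_torus \<Longrightarrow> g \<in> L2_torus \<Longrightarrow>
      AE z in lborel. S t (\<lambda>w. c * f w + g w) z = c * S t f z + S t g z"
    and C0_semigroup_bound: "\<And>t. t \<ge> 0 \<Longrightarrow> \<exists>M. \<forall>f\<in>L2_torus. l2n Tm (S t f) \<le> M * l2n Tm f"
    and C0_semigroup_zero: "\<And>f. f \<in> L2_torus \<Longrightarrow> AE z in lborel. S 0 f z = f z"
    and C0_semigroup_plus: "\<And>s t f. s \<ge> 0 \<Longrightarrow> t \<ge> 0 \<Longrightarrow> f \<in> L2_torus \<Longrightarrow> AE z in lborel. S (s + t) f z = S s (S t f) z"
    and C0_semigroup_tendsto: "\<And>f. f \<in> L2_torus \<Longrightarrow> ((\<lambda>h. l2n Tm (\<lambda>z. S h f z - f z)) \<longlongrightarrow> 0) (at_right 0)"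
proof -
  note * = assms[unfolded C0_semigroup_def L2_norm_eq]
  show "\<And>t f. t \<ge> 0 \<Longrightarrow> f \<in> L2_torus \<Longrightarrow> S t f \<in> L2_torus"
    by (rule *[THEN conjunct1, rule_format])
  show "\<And>t f g c. t \<ge> 0 \<Longrightarrow> f \<in> L2_torus \<Longrightarrow> g \<in> L2_torus \<Longrightarrow>
      AE z in lborel. S t (\<lambda>w. c * f w + g w) z = c * S t f z + S t g z"
    by (rule *[THEN conjunct2, THEN conjunct1, rule_format])
  show "\<And>t. t \<ge> 0 \<Longrightarrow> \<exists>M. \<forall>f\<in>L2_torus. l2n Tm (S t f) \<le> M * l2n Tm f"
    by (rule *[THEN conjunct2, THEN conjunct2, THEN conjunct1, THEN spec, THEN mp])
  show "\<And>f. f \<in> L2_torus \<Longrightarrow> AE z in lborel. S 0 f z = f z"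
    by (rule *[THEN conjunct2, THEN conjunct2, THEN conjunct2, THEN conjunct1, rule_format])
  show "\<And>s t f. s \<ge> 0 \<Longrightarrow> t \<ge> 0 \<Longrightarrow> f \<in> L2_torus \<Longrightarrow> AE z in lborel. S (s + t) f z = S s (S t f) z"
    by (rule *[THEN conjunct2, THEN conjunct2, THEN conjunct2, THEN conjunct2, THEN conjunct1, rule_format])
  show "\<And>f. f \<in> L2_torus \<Longrightarrow> ((\<lambda>h. l2n Tm (\<lambda>z. S h f z - f z)) \<longlongrightarrow> 0) (at_right 0)"
    by (rule *[THEN conjunct2, THEN conjunct2, THEN conjunct2, THEN conjunct2, THEN conjunct2, rule_format])
qed

text \<open>Linearity holds only almost everywhere and is stated for c f + g, hence the detour over
  f = (f - g) + g. Differences are the form in which the limit arguments use the bound; M is made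
  nonnegative so that division by M + 1 is possible.\<close>

lemma C0_semigroup_bounded:
  assumes "C0_semigroup S" "t \<ge> 0"
  obtains M where "M \<ge> 0" "\<And>f g. f \<in> L2_torus \<Longrightarrow> g \<in> L2_torus \<Longrightarrow>
    l2n Tm (\<lambda>z. S t f z - S t g z) \<le> M * l2n Tm (\<lambda>z. f z - g z)"
proof -
  obtain M0 where M0: "\<And>f. f \<in> L2_torus \<Longrightarrow> l2n Tm (S t f) \<le> M0 * l2n Tm f"
    using C0_semigroup_bound[OF assms] by blast
  show thesis
  proof (rule that[of "max 0 M0"])
    fix f g assume f: "f \<in> L2_torus" and g: "g \<in> L2_torus"
    have fg: "(\<lambda>z. f z - g z) \<in> L2_torus" by (rule L2_torus_diff[OF f g])
    have S: "S t f \<in> L2_torus" "S t g \<in> L2_torus" "S t (\<lambda>z. f z - g z) \<in> L2_torus"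
      by (intro C0_semigroup_in[OF assms] f g fg)+
    have "AE z in lborel. S t (\<lambda>w. 1 * (f w - g w) + g w) z = 1 * S t (\<lambda>z. f z - g z) z + S t g z"
      by (rule C0_semigroup_linear[OF assms fg g])
    then have "AE z in lborel. S t f z - S t g z = S t (\<lambda>z. f z - g z) z"
      by eventually_elim simp
    then have "l2n Tm (\<lambda>z. S t f z - S t g z) = l2n Tm (S t (\<lambda>z. f z - g z))"
      by (intro l2n_cong_AE AE_Tm sqi_measurable sqi_diff L2_torus_sqi S)
    also have "\<dots> \<le> M0 * l2n Tm (\<lambda>z. f z - g z)" by (rule M0[OF fg])
    also have "\<dots> \<le> max 0 M0 * l2n Tm (\<lambda>z. f z - g z)" by (intro mult_right_mono) auto
    finally show "l2n Tm (\<lambda>z. S t f z - S t g z) \<le> max 0 M0 * l2n Tm (\<lambda>z. f z - g z)" .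
  qed simp
qed

lemma C0_semigroup_sqi: "C0_semigroup S \<Longrightarrow> t \<ge> 0 \<Longrightarrow> f \<in> L2_torus \<Longrightarrow> sqi Tm (S t f)"
  by (rule L2_torus_sqi[OF C0_semigroup_in])

lemma C0_semigroup_add:
  "C0_semigroup S \<Longrightarrow> s \<ge> 0 \<Longrightarrow> t \<ge> 0 \<Longrightarrow> f \<in> L2_torus \<Longrightarrow> AE z in Tm. S (s + t) f z = S s (S t f) z"
  by (rule AE_Tm[OF C0_semigroup_plus])

lemma l2n_orbit_shift:
  assumes S: "C0_semigroup S" and s: "s \<ge> 0" and ab: "a \<ge> 0" "b \<ge> 0" and f: "f \<in> L2_torus"
  shows "l2n Tm (\<lambda>z. S (s + a) f z - S (s + b) f z) = l2n Tm (\<lambda>z. S s (S a f) z - S s (S b f) z)"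
proof (rule l2n_cong_AE)
  show "AE z in Tm. S (s + a) f z - S (s + b) f z = S s (S a f) z - S s (S b f) z"
    using C0_semigroup_add[OF S s ab(1) f] C0_semigroup_add[OF S s ab(2) f] by eventually_elim simp
qed (use s ab f in \<open>auto intro!: sqi_measurable sqi_diff C0_semigroup_sqi[OF S] C0_semigroup_in[OF S]\<close>)

text \<open>Boundedness of each single \<open>S t\<close> gives right-continuity at once. A right-continuous orbit has
  continuity points arbitrarily close to \<open>0\<close>, and \<open>S\<close> carries continuity forward in time. This
  avoids local boundedness of \<open>t \<mapsto> \<parallel>S t\<parallel>\<close>.\<close>

lemma C0_semigroup_continuous:
  assumes S: "C0_semigroup S" and f: "f \<in> L2_torus" and t: "t \<ge> 0" and e: "e > 0"
  shows "\<exists>\<delta>>0. \<forall>s\<ge>0. \<bar>s - t\<bar> < \<delta> \<longrightarrow> l2n Tm (\<lambda>z. S s f z - S t f z) < e"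
proof -
  define d where "d s t = l2n Tm (\<lambda>z. S s f z - S t f z)" for s t
  have sq: "sqi Tm (S s f)" if "s \<ge> 0" for s by (rule C0_semigroup_sqi[OF S that f])
  have right: "\<exists>\<delta>>0. \<forall>s\<in>{t..<t + \<delta>}. d s t < e" if t: "t \<ge> 0" and e: "e > 0" for t e
  proof -
    obtain M where M: "M \<ge> 0" "\<And>f g. f \<in> L2_torus \<Longrightarrow> g \<in> L2_torus \<Longrightarrow>
        l2n Tm (\<lambda>z. S t f z - S t g z) \<le> M * l2n Tm (\<lambda>z. f z - g z)"
      using C0_semigroup_bounded[OF S t] by blast
    have "e / (M + 1) > 0" using M e by simp
    moreover have "((\<lambda>h. l2n Tm (\<lambda>z. S h f z - f z)) \<longlongrightarrow> 0) (at_right 0)"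
      by (rule C0_semigroup_tendsto[OF S f])
    ultimately have "\<forall>\<^sub>F h in at_right 0. l2n Tm (\<lambda>z. S h f z - f z) < e / (M + 1)"
      by (rule order_tendstoD(2)[rotated])
    then obtain \<delta> where \<delta>: "\<delta> > 0" "\<And>h. 0 < h \<Longrightarrow> h < \<delta> \<Longrightarrow> l2n Tm (\<lambda>z. S h f z - f z) < e / (M + 1)"
      unfolding eventually_at_right_field by auto
    show ?thesis
    proof (intro exI[of _ \<delta>] conjI ballI)
      fix s assume s: "s \<in> {t..<t + \<delta>}"
      show "d s t < e"
      proof (cases "s = t")
        case True then show ?thesis using e by (simp add: d_def)
      next
        case False
        define h where "h = s - t"
        have h: "0 < h" "h < \<delta>" "s = t + h" using s False by (auto simp: h_def)
        have "d s t = l2n Tm (\<lambda>z. S t (S h f) z - S t f z)"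
          unfolding d_def h(3)
        proof (rule l2n_cong_AE)
          show "AE z in Tm. S (t + h) f z - S t f z = S t (S h f) z - S t f z"
            using C0_semigroup_add[OF S t less_imp_le[OF h(1)] f] by eventually_elim simp
        qed (use t h f in \<open>auto intro!: sqi_measurable sqi_diff C0_semigroup_sqi[OF S] C0_semigroup_in[OF S]\<close>)
        also have "\<dots> \<le> M * l2n Tm (\<lambda>z. S h f z - f z)"
          using h by (intro M(2) C0_semigroup_in[OF S] f) auto
        also have "\<dots> \<le> M * (e / (M + 1))"
          using M(1) \<delta>(2)[OF h(1,2)] by (intro mult_left_mono) auto
        also have "\<dots> < e"
        proof -
          have "M + 1 > 0" using M(1) by simp
          then show ?thesis using e by (simp add: pos_divide_less_eq algebra_simps)
        qed
        finally show ?thesis .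
      qed
    qed (rule \<delta>(1))
  qed
  have sym: "d s t = d t s" for s t unfolding d_def by (rule l2n_minus_commute)
  show ?thesis
  proof (cases "t = 0")
    case True
    obtain \<delta> where \<delta>: "\<delta> > 0" "\<And>s. s \<in> {0..<\<delta>} \<Longrightarrow> d s 0 < e" using right[of 0, OF _ e] by auto
    show ?thesis
      by (intro exI[of _ \<delta>]) (use \<delta> True in \<open>auto simp: d_def\<close>)
  next
    case False
    then have t0: "t > 0" using t by simp
    obtain r where r: "0 < r" "r < t" "\<And>e. e > 0 \<Longrightarrow> \<exists>\<delta>>0. \<forall>s>0. \<bar>s - r\<bar> < \<delta> \<longrightarrow> d s r < e"
    proof (rule right_continuous_imp_continuity_point[of d t])
      show "d s t = d t s" for s t by (rule sym)
      show "d p t \<le> d p s + d s t" if "p > 0" "s > 0" "t > 0" for p s t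
        unfolding d_def using that by (intro l2n_diff_triangle sq) auto
      show "\<exists>\<delta>>0. \<forall>s\<in>{t..<t + \<delta>}. d s t < e" if "t > 0" "e > 0" for t e
        using right that by simp
    qed (use t0 in auto)
    have tr: "t - r \<ge> 0" using r by simp
    obtain M where M: "M \<ge> 0" "\<And>f g. f \<in> L2_torus \<Longrightarrow> g \<in> L2_torus \<Longrightarrow>
        l2n Tm (\<lambda>z. S (t - r) f z - S (t - r) g z) \<le> M * l2n Tm (\<lambda>z. f z - g z)"
      using C0_semigroup_bounded[OF S tr] by blast
    have "e / (M + 1) > 0" using M e by simp
    then obtain \<delta> where \<delta>: "\<delta> > 0" "\<And>s. s > 0 \<Longrightarrow> \<bar>s - r\<bar> < \<delta> \<Longrightarrow> d s r < e / (M + 1)"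
      using r(3) by blast
    show ?thesis
    proof (intro exI[of _ "min \<delta> r"] conjI allI impI)
      show "min \<delta> r > 0" using \<delta> r by simp
      fix s assume s: "s \<ge> 0" "\<bar>s - t\<bar> < min \<delta> r"
      define s' where "s' = s - (t - r)"
      have s': "s' > 0" "\<bar>s' - r\<bar> < \<delta>" "s = (t - r) + s'" using s by (auto simp: s'_def)
      have "l2n Tm (\<lambda>z. S s f z - S t f z) = l2n Tm (\<lambda>z. S ((t - r) + s') f z - S ((t - r) + r) f z)"
        by (simp add: s'_def)
      also have "\<dots> = l2n Tm (\<lambda>z. S (t - r) (S s' f) z - S (t - r) (S r f) z)"
        using s' r tr by (intro l2n_orbit_shift S f) auto
      also have "\<dots> \<le> M * d s' r"
        unfolding d_def using s' r by (intro M(2) C0_semigroup_in[OF S] f) auto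
      also have "\<dots> \<le> M * (e / (M + 1))"
        using M(1) \<delta>(2)[OF s'(1,2)] by (intro mult_left_mono) auto
      also have "\<dots> < e"
      proof -
        have "M + 1 > 0" using M(1) by simp
        then show ?thesis using e by (simp add: pos_divide_less_eq algebra_simps)
      qed
      finally show "l2n Tm (\<lambda>z. S s f z - S t f z) < e" .
    qed
  qed
qed

text \<open>Both limits come from applying \<open>S t\<close> to the difference quotient of
  \<open>p\<close> at time 0. Read as S (t + h) p, it is the right derivative of the orbit; read as
  S h (S t p), it says that S t p stays in the domain of the generator, with image S t q.\<close>

lemma C0_semigroup_derivative:
  assumes S: "C0_semigroup S" and p: "p \<in> L2_torus" and q: "q \<in> L2_torus" and t: "t \<ge> 0"
    and der: "((\<lambda>h. l2n Tm (\<lambda>z. (S h p z - p z) / of_real h - q z)) \<longlongrightarrow> 0) (at_right 0)"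
  shows "((\<lambda>h. l2n Tm (\<lambda>z. (S (t + h) p z - S t p z) / of_real h - S t q z)) \<longlongrightarrow> 0) (at_right 0)"
    and "((\<lambda>h. l2n Tm (\<lambda>z. (S h (S t p) z - S t p z) / of_real h - S t q z)) \<longlongrightarrow> 0) (at_right 0)"
proof -
  obtain M where M: "M \<ge> 0" "\<And>f g. f \<in> L2_torus \<Longrightarrow> g \<in> L2_torus \<Longrightarrow>
      l2n Tm (\<lambda>z. S t f z - S t g z) \<le> M * l2n Tm (\<lambda>z. f z - g z)"
    using C0_semigroup_bounded[OF S t] by blast
  have le: "l2n Tm (\<lambda>z. (S (t + h) p z - S t p z) / of_real h - S t q z) \<le> M * l2n Tm (\<lambda>z. (S h p z - p z) / of_real h - q z)"
    if h: "h > 0" for h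
  proof -
    \<comment> \<open>Since h F + p = S h p, linearity of \<open>S t\<close> identifies S t F with
      the difference quotient of the orbit at t.\<close>
    define F where "F = (\<lambda>z. (S h p z - p z) / of_real h)"
    have Sh: "S h p \<in> L2_torus" using h by (intro C0_semigroup_in[OF S] p) auto
    have F: "F \<in> L2_torus" unfolding F_def by (intro L2_torus_divide L2_torus_diff Sh p)
    have "AE z in lborel. S t (\<lambda>w. of_real h * F w + p w) z = of_real h * S t F z + S t p z"
      by (rule C0_semigroup_linear[OF S t F p])
    moreover have "(\<lambda>w. of_real h * F w + p w) = S h p" using h by (simp add: F_def)
    ultimately have "AE z in Tm. S t (S h p) z = of_real h * S t F z + S t p z"
      by (intro AE_Tm) simp
    with C0_semigroup_add[OF S t less_imp_le[OF h] p]
    have "AE z in Tm. (S (t + h) p z - S t p z) / of_real h - S t q z = S t F z - S t q z"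
      by eventually_elim (use h in simp)
    then have "l2n Tm (\<lambda>z. (S (t + h) p z - S t p z) / of_real h - S t q z) = l2n Tm (\<lambda>z. S t F z - S t q z)"
      using h t by (intro l2n_cong_AE sqi_measurable sqi_diff sqi_divide C0_semigroup_sqi[OF S] p q F) auto
    also have "\<dots> \<le> M * l2n Tm (\<lambda>z. F z - q z)" by (rule M(2)[OF F q])
    finally show ?thesis by (simp add: F_def)
  qed
  show 1: "((\<lambda>h. l2n Tm (\<lambda>z. (S (t + h) p z - S t p z) / of_real h - S t q z)) \<longlongrightarrow> 0) (at_right 0)"
  proof (rule Lim_null_comparison)
    show "\<forall>\<^sub>F h in at_right 0. norm (l2n Tm (\<lambda>z. (S (t + h) p z - S t p z) / of_real h - S t q z))
        \<le> M * l2n Tm (\<lambda>z. (S h p z - p z) / of_real h - q z)"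
      unfolding eventually_at_filter using le by (auto intro!: always_eventually)
    show "((\<lambda>h. M * l2n Tm (\<lambda>z. (S h p z - p z) / of_real h - q z)) \<longlongrightarrow> 0) (at_right 0)"
      using tendsto_mult_right_zero[OF der] .
  qed
  have "\<forall>\<^sub>F h in at_right 0. l2n Tm (\<lambda>z. (S h (S t p) z - S t p z) / of_real h - S t q z)
      = l2n Tm (\<lambda>z. (S (t + h) p z - S t p z) / of_real h - S t q z)"
  proof -
    have "l2n Tm (\<lambda>z. (S h (S t p) z - S t p z) / of_real h - S t q z)
      = l2n Tm (\<lambda>z. (S (t + h) p z - S t p z) / of_real h - S t q z)" if h: "h > 0" for h
    proof (rule l2n_cong_AE)
      show "AE z in Tm. (S h (S t p) z - S t p z) / of_real h - S t q z = (S (t + h) p z - S t p z) / of_real h - S t q z"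
        using C0_semigroup_add[OF S less_imp_le[OF h] t p] by eventually_elim (simp add: add.commute)
    qed (use h t in \<open>auto intro!: sqi_measurable sqi_diff sqi_divide C0_semigroup_sqi[OF S] C0_semigroup_in[OF S] p q\<close>)
    then show ?thesis unfolding eventually_at_filter by (auto intro!: always_eventually)
  qed
  with 1 show "((\<lambda>h. l2n Tm (\<lambda>z. (S h (S t p) z - S t p z) / of_real h - S t q z)) \<longlongrightarrow> 0) (at_right 0)"
    using tendsto_cong by force
qed

section \<open>Decay of a single mode\<close>

lemma xmode_diff: "sqi Tm f \<Longrightarrow> sqi Tm g \<Longrightarrow> xmode l (\<lambda>z. f z - g z) = (\<lambda>j. xmode l f j - xmode l g j)"
  by (simp add: xmode_def fun_eq_iff fcoef_diff)

lemma xmode_divide: "xmode l (\<lambda>z. f z / c) = (\<lambda>j. xmode l f j / c)"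
  by (simp add: xmode_def fun_eq_iff fcoef_divide)

lemma l2n_xmode_le: "sqi Tm f \<Longrightarrow> l2n Zm (xmode l f) \<le> l2n Tm f"
proof -
  assume f: "sqi Tm f"
  have "1 * l2n Zm (xmode l f) \<le> 2 * pi * l2n Zm (xmode l f)"
    using pi_gt3 by (intro mult_right_mono) auto
  then show ?thesis using sqi_xmode(2)[OF f, of l] by simp
qed

text \<open>Invariance of the domain makes the dissipation inequality available at every time, so
  the functional satisfies a differential inequality along the orbit. The parameters stay free
  because two instances occur: the mode k with its decay rate, and the other modes with \<tau> =
  \<kappa> = 0.\<close>

lemma semigroup_lyap_decay:
  assumes gen: "generated_by S A" and p: "p \<in> L2_torus" and q: "q \<in> L2_torus" and pq: "A p q"
    and diss: "\<And>f g. f \<in> L2_torus \<Longrightarrow> g \<in> L2_torus \<Longrightarrow> A f g \<Longrightarrow>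
      2 * lyap \<tau> N (xmode l f) (xmode l g) \<le> - (\<kappa> * lyap \<tau> N (xmode l f) (xmode l f))"
    and t: "t \<ge> 0"
  shows "lyap \<tau> N (xmode l (S t p)) (xmode l (S t p)) \<le> exp (- (\<kappa> * t)) * lyap \<tau> N (xmode l p) (xmode l p)"
proof -
  have S: "C0_semigroup S" using gen by (simp add: generated_by_def)
  have iff: "((\<lambda>h. l2n Tm (\<lambda>z. (S h f z - f z) / of_real h - g z)) \<longlongrightarrow> 0) (at_right 0) \<longleftrightarrow> A f g"
    if "f \<in> L2_torus" "g \<in> L2_torus" for f g
    using gen that unfolding generated_by_def L2_norm_eq by simp
  note Sp = C0_semigroup_in[OF S _ p] and Sq = C0_semigroup_in[OF S _ q]
  have sp: "sqi Tm (S s p)" if "s \<ge> 0" for s using L2_torus_sqi[OF Sp[OF that]] .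
  have sq: "sqi Tm (S s q)" if "s \<ge> 0" for s using L2_torus_sqi[OF Sq[OF that]] .
  have der0: "((\<lambda>h. l2n Tm (\<lambda>z. (S h p z - p z) / of_real h - q z)) \<longlongrightarrow> 0) (at_right 0)"
    using iff[OF p q] pq by simp
  define c where "c s = xmode l (S s p)" for s
  have c: "sqi Zm (c s)" if "s \<ge> 0" for s unfolding c_def by (rule sqi_xmode(1)[OF sp[OF that]])
  have "lyap \<tau> N (c t) (c t) \<le> exp (- (\<kappa> * t)) * lyap \<tau> N (c 0) (c 0)"
  proof (rule exponential_decay_if_right_derivative_le[OF _ _ t])
    show "continuous_on {0..} (\<lambda>t. lyap \<tau> N (c t) (c t))"
    proof (rule lyap_curve_continuous[OF c])
      fix t :: real assume t: "t \<ge> 0"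
      show "((\<lambda>s. l2n Zm (\<lambda>j. c s j - c t j)) \<longlongrightarrow> 0) (at t within {0..})"
        unfolding tendsto_iff eventually_at dist_real_def
      proof (intro allI impI)
        fix e :: real assume e: "e > 0"
        obtain \<delta> where \<delta>: "\<delta> > 0" "\<And>s. s \<ge> 0 \<Longrightarrow> \<bar>s - t\<bar> < \<delta> \<Longrightarrow> l2n Tm (\<lambda>z. S s p z - S t p z) < e"
          using C0_semigroup_continuous[OF S p t e] by blast
        have "\<bar>l2n Zm (\<lambda>j. c s j - c t j) - 0\<bar> < e" if s: "s \<ge> 0" "\<bar>s - t\<bar> < \<delta>" for s
        proof -
          have "l2n Zm (\<lambda>j. c s j - c t j) = l2n Zm (xmode l (\<lambda>z. S s p z - S t p z))"
            unfolding c_def xmode_diff[OF sp[OF s(1)] sp[OF t]] ..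
          also have "\<dots> \<le> l2n Tm (\<lambda>z. S s p z - S t p z)"
            by (rule l2n_xmode_le[OF sqi_diff[OF sp[OF s(1)] sp[OF t]]])
          also have "\<dots> < e" by (rule \<delta>(2)[OF s])
          finally show ?thesis by simp
        qed
        then show "\<exists>d>0. \<forall>s\<in>{0..}. s \<noteq> t \<and> \<bar>s - t\<bar> < d \<longrightarrow> \<bar>l2n Zm (\<lambda>j. c s j - c t j) - 0\<bar> < e"
          using \<delta>(1) by (intro exI[of _ \<delta>]) simp
      qed
    qed
    fix t :: real assume t: "t \<ge> 0"
    define g where "g = xmode l (S t q)"
    have "A (S t p) (S t q)"
      using C0_semigroup_derivative(2)[OF S p q t der0] iff[OF Sp[OF t] Sq[OF t]] by simp
    then have le: "2 * lyap \<tau> N (c t) g \<le> - (\<kappa> * lyap \<tau> N (c t) (c t))"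
      unfolding c_def g_def by (rule diss[OF Sp[OF t] Sq[OF t]])
    have "((\<lambda>t. lyap \<tau> N (c t) (c t)) has_real_derivative 2 * lyap \<tau> N (c t) g) (at t within {t..})"
    proof (rule lyap_curve_derivative[OF t c])
      show "sqi Zm g" unfolding g_def by (rule sqi_xmode(1)[OF sq[OF t]])
      have eq: "l2n Zm (\<lambda>j. (c (t + h) j - c t j) / of_real h - g j) \<le> l2n Tm (\<lambda>z. (S (t + h) p z - S t p z) / of_real h - S t q z)"
        if h: "h > 0" for h
      proof -
        have th: "t + h \<ge> 0" using t h by simp
        note s1 = sqi_diff[OF sp[OF th] sp[OF t]]
        note s2 = sqi_divide[OF s1, of "of_real h"]
        have "(\<lambda>j. (c (t + h) j - c t j) / of_real h - g j) = xmode l (\<lambda>z. (S (t + h) p z - S t p z) / of_real h - S t q z)"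
          unfolding xmode_diff[OF s2 sq[OF t]] xmode_divide xmode_diff[OF sp[OF th] sp[OF t]] c_def g_def ..
        then show ?thesis using l2n_xmode_le[OF sqi_diff[OF s2 sq[OF t]]] by simp
      qed
      show "((\<lambda>h. l2n Zm (\<lambda>j. (c (t + h) j - c t j) / of_real h - g j)) \<longlongrightarrow> 0) (at_right 0)"
      proof (rule Lim_null_comparison[OF _ C0_semigroup_derivative(1)[OF S p q t der0]])
        show "\<forall>\<^sub>F h in at_right 0. norm (l2n Zm (\<lambda>j. (c (t + h) j - c t j) / of_real h - g j))
            \<le> l2n Tm (\<lambda>z. (S (t + h) p z - S t p z) / of_real h - S t q z)"
          unfolding eventually_at_filter using eq by (auto intro!: always_eventually)
      qed
    qed
    then show "\<exists>D\<le>- (\<kappa> * lyap \<tau> N (c t) (c t)). ((\<lambda>t. lyap \<tau> N (c t) (c t)) has_real_derivative D) (at t within {t..})"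
      using le by blast
  qed
  moreover have "c 0 = xmode l p"
  proof -
    have "fcoef (S 0 p) r = fcoef p r" for r
      by (rule fcoef_cong_AE[OF sqi_measurable[OF sp] sqi_measurable[OF L2_torus_sqi[OF p]] AE_Tm[OF C0_semigroup_zero[OF S p]]]) simp
    then show ?thesis by (simp add: c_def xmode_def fun_eq_iff)
  qed
  ultimately show ?thesis by (simp add: c_def)
qed

text \<open>Completeness of the characters: partial sums approximate \<open>f\<close> and have
  nonzero coefficients only in the row k, where Parseval's identity bounds them by the norm of the
  mode. This reverses the inequality of \<open>sqi_xmode\<close>.\<close>

lemma l2n_le_single_xmode:
  assumes f: "sqi Tm f" and off: "\<And>l j. l \<noteq> k \<Longrightarrow> fcoef f (l, j) = 0"
  shows "l2n Tm f \<le> 2 * pi * l2n Zm (xmode k f)"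
proof (rule field_le_epsilon)
  fix e :: real assume e: "e > 0"
  obtain P where P: "finite P" "l2n Tm (\<lambda>z. f z - tpoly P (fcoef f) z) < e"
    by (rule fourier_partial_sum_dense[OF f e])
  define J where "J = snd ` (P \<inter> {k} \<times> UNIV)"
  have "(\<Sum>p\<in>P. (cmod (fcoef f p))\<^sup>2) = (\<Sum>p\<in>P \<inter> {k} \<times> UNIV. (cmod (fcoef f p))\<^sup>2)"
    using P(1) off by (intro sum.mono_neutral_right) auto
  also have "\<dots> = (\<Sum>j\<in>J. (cmod (xmode k f j))\<^sup>2)"
    unfolding J_def by (subst sum.reindex) (auto simp: inj_on_def xmode_def intro!: sum.cong)
  also have "\<dots> \<le> (l2n Zm (xmode k f))\<^sup>2"
    using P(1) by (intro finite_sum_le_l2n sqi_xmode(1) f) (auto simp: J_def)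
  finally have "(l2n Tm (tpoly P (fcoef f)))\<^sup>2 \<le> (2 * pi * l2n Zm (xmode k f))\<^sup>2"
    unfolding l2n_tpoly[OF P(1)] by (simp add: power_mult_distrib)
  then have "l2n Tm (tpoly P (fcoef f)) \<le> 2 * pi * l2n Zm (xmode k f)"
    by (rule power2_le_imp_le) simp
  then show "l2n Tm f \<le> 2 * pi * l2n Zm (xmode k f) + e"
    using l2n_le_add_diff[OF f sqi_tpoly[of P "fcoef f"]] P(2) by linarith
qed

text \<open>The decay is proved for a partial Fourier sum \<open>p\<close> of \<open>F\<close>,
  which lies in the domain, and transferred to \<open>F\<close> at a cost of at most e by
  boundedness of the single operator \<open>S t\<close>. The hypothesis \<open>mono\<close> is the
  energy estimate for arbitrary modes; it is what keeps S t p in the row k.\<close>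

lemma semigroup_mode_decay:
  fixes u :: "real \<Rightarrow> real"
  assumes gen: "generated_by S (drift_diffusion_op \<nu>x \<nu> u)"
    and u: "continuous_on UNIV u" and per: "\<And>y. u (y + 2 * pi) = u y"
    and \<tau>: "\<bar>\<tau>\<bar> \<le> 1 / 2"
    and diss: "\<And>f g. f \<in> L2_torus \<Longrightarrow> g \<in> L2_torus \<Longrightarrow> drift_diffusion_op \<nu>x \<nu> u f g \<Longrightarrow>
      2 * lyap \<tau> N (xmode k f) (xmode k g) \<le> - (\<kappa> * lyap \<tau> N (xmode k f) (xmode k f))"
    and mono: "\<And>l f g. f \<in> L2_torus \<Longrightarrow> g \<in> L2_torus \<Longrightarrow> drift_diffusion_op \<nu>x \<nu> u f g \<Longrightarrow>
      lyap 0 N (xmode l f) (xmode l g) \<le> 0"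
    and F: "F \<in> L2_torus" and off: "\<And>l j. l \<noteq> k \<Longrightarrow> fcoef F (l, j) = 0" and t: "t \<ge> 0"
  shows "l2n Tm (S t F) \<le> 2 * exp (- (\<kappa> / 2 * t)) * l2n Tm F"
proof (rule field_le_epsilon)
  fix e :: real assume e: "e > 0"
  have S: "C0_semigroup S" using gen by (simp add: generated_by_def)
  obtain M where M: "M \<ge> 0" "\<And>f g. f \<in> L2_torus \<Longrightarrow> g \<in> L2_torus \<Longrightarrow>
      l2n Tm (\<lambda>z. S t f z - S t g z) \<le> M * l2n Tm (\<lambda>z. f z - g z)"
    using C0_semigroup_bounded[OF S t] by blast
  have e': "e / (M + 1) > 0" using M e by simp
  obtain P where P: "finite P" "l2n Tm (\<lambda>z. F z - tpoly P (fcoef F) z) < e / (M + 1)"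
    by (rule fourier_partial_sum_dense[OF L2_torus_sqi[OF F] e'])
  define p where "p = tpoly P (fcoef F)"
  have p: "p \<in> L2_torus" unfolding p_def by (rule L2_torus_tpoly)
  obtain q where q: "q \<in> L2_torus" "drift_diffusion_op \<nu>x \<nu> u p q"
    unfolding p_def using tpoly_in_domain[OF u per] by blast
  have Stp: "S t p \<in> L2_torus" by (rule C0_semigroup_in[OF S t p])
  have offp: "fcoef p (l, j) = 0" if "l \<noteq> k" for l j
    unfolding p_def fcoef_tpoly[OF P(1)] using off[OF that] by simp
  \<comment> \<open>The mode l of \<open>p\<close> vanishes, hence so does its energy, which cannot
    grow; \<tau> and the rate are both 0 here.\<close>
  have offS: "fcoef (S t p) (l, j) = 0" if l: "l \<noteq> k" for l j
  proof -
    have "xmode l p = (\<lambda>j. 0)" using offp[OF l] by (simp add: xmode_def fun_eq_iff)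
    then have "lyap 0 N (xmode l p) (xmode l p) = 0" by (simp add: lyap_def)
    moreover have "lyap 0 N (xmode l (S t p)) (xmode l (S t p)) \<le> exp (- (0 * t)) * lyap 0 N (xmode l p) (xmode l p)"
      by (rule semigroup_lyap_decay[OF gen p q _ t]) (use mono in simp)
    ultimately have "lyap 0 N (xmode l (S t p)) (xmode l (S t p)) \<le> 0" by simp
    moreover have s: "sqi Zm (xmode l (S t p))" by (rule sqi_xmode(1)[OF L2_torus_sqi[OF Stp]])
    ultimately have "(l2n Zm (xmode l (S t p)))\<^sup>2 \<le> 0"
      using lyap_diag[OF s, of 0 N] by simp
    then have "l2n Zm (xmode l (S t p)) = 0" by simp
    then show ?thesis using cmod_le_l2n[OF s, of j] by (simp add: xmode_def)
  qed
  have sk: "sqi Zm (xmode k (S t p))" "sqi Zm (xmode k p)"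
    using sqi_xmode(1) L2_torus_sqi[OF Stp] L2_torus_sqi[OF p] by blast+
  define X where "X = exp (- (\<kappa> / 2 * t))"
  have X2: "exp (- (\<kappa> * t)) = X\<^sup>2" by (simp add: X_def power2_eq_square flip: exp_add)
  \<comment> \<open>Coercivity costs 1/2 on the left and 3/2 on the right; the ratio 3 is at most
    2^2, which gives the prefactor 2 for norms.\<close>
  have "1 / 2 * (l2n Zm (xmode k (S t p)))\<^sup>2 \<le> lyap \<tau> N (xmode k (S t p)) (xmode k (S t p))"
    using lyap_diag[OF sk(1), of \<tau> N] mult_right_mono[OF \<tau>, of "(l2n Zm (xmode k (S t p)))\<^sup>2"] by simp
  also have "\<dots> \<le> exp (- (\<kappa> * t)) * lyap \<tau> N (xmode k p) (xmode k p)"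
    by (rule semigroup_lyap_decay[OF gen p q diss t])
  also have "\<dots> \<le> X\<^sup>2 * (3 / 2 * (l2n Zm (xmode k p))\<^sup>2)"
    using lyap_diag[OF sk(2), of \<tau> N] mult_right_mono[OF \<tau>, of "(l2n Zm (xmode k p))\<^sup>2"]
    unfolding X2 by (intro mult_left_mono) auto
  finally have "(l2n Zm (xmode k (S t p)))\<^sup>2 \<le> X\<^sup>2 * (3 * (l2n Zm (xmode k p))\<^sup>2)" by simp
  also have "\<dots> \<le> (2 * X * l2n Zm (xmode k p))\<^sup>2"
    by (simp add: power_mult_distrib)
  finally have rows: "l2n Zm (xmode k (S t p)) \<le> 2 * X * l2n Zm (xmode k p)"
    by (rule power2_le_imp_le) (simp add: X_def)
  have "l2n Tm (S t p) \<le> 2 * pi * l2n Zm (xmode k (S t p))"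
    by (rule l2n_le_single_xmode[OF L2_torus_sqi[OF Stp] offS])
  also have "\<dots> \<le> 2 * X * (2 * pi * l2n Zm (xmode k p))"
    using mult_left_mono[OF rows, of "2 * pi"] by (simp add: mult_ac)
  also have "\<dots> \<le> 2 * X * l2n Tm p"
    using sqi_xmode(2)[OF L2_torus_sqi[OF p], of k] by (intro mult_left_mono) (auto simp: X_def)
  also have "l2n Tm p \<le> l2n Tm F"
  proof (rule power2_le_imp_le)
    show "(l2n Tm p)\<^sup>2 \<le> (l2n Tm F)\<^sup>2"
      unfolding p_def l2n_tpoly[OF P(1)] by (rule bessel[OF L2_torus_sqi[OF F] P(1)])
  qed simp
  finally have main: "l2n Tm (S t p) \<le> 2 * X * l2n Tm F" by (simp add: X_def)
  have "l2n Tm (\<lambda>z. S t F z - S t p z) \<le> M * l2n Tm (\<lambda>z. F z - p z)" by (rule M(2)[OF F p])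
  also have "\<dots> \<le> M * (e / (M + 1))" using P(2) M(1) unfolding p_def by (intro mult_left_mono) auto
  also have "\<dots> \<le> e"
  proof -
    have "M + 1 > 0" using M(1) by simp
    then show ?thesis using e by (simp add: pos_divide_le_eq algebra_simps)
  qed
  finally have "l2n Tm (\<lambda>z. S t F z - S t p z) \<le> e" .
  then show "l2n Tm (S t F) \<le> 2 * exp (- (\<kappa> / 2 * t)) * l2n Tm F + e"
    using l2n_le_add_diff[OF C0_semigroup_sqi[OF S t F] C0_semigroup_sqi[OF S t p]] main
    unfolding X_def by linarith
qed

section \<open>The projection onto a mode in x\<close>

lemma integrable_Tm_snd:
  fixes h :: "real \<Rightarrow> real"
  assumes m [measurable]: "h \<in> borel_measurable borel" and i: "integrable Pm h"
  shows "integrable Tm (\<lambda>z. h (snd z))"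
  unfolding integrable_Tm_iff
proof (rule lborel_pair.Fubini_integrable)
  have eq: "indicator torus_cell (x, y) *\<^sub>R h (snd (x, y)) = indicator {0..2 * pi} x * (indicator {0..2 * pi} y * h y)" for x y :: real
    by (simp add: indicator_torus_cell)
  have i': "integrable lborel (\<lambda>y. indicator {0..2 * pi} y * h y)"
    using i by (simp add: integrable_restrict_space)
  show "(\<lambda>z. indicator torus_cell z *\<^sub>R h (snd z)) \<in> borel_measurable (lborel \<Otimes>\<^sub>M lborel)"
  proof -
    have "snd \<in> borel_measurable (borel :: (real \<times> real) measure)"
      by (intro borel_measurable_continuous_onI continuous_intros)
    from measurable_compose[OF this m]
    have "(\<lambda>z. indicator torus_cell z *\<^sub>R h (snd z)) \<in> borel_measurable borel"
      by (intro borel_measurable_scaleR borel_measurable_indicator torus_cell_sets)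
    then show ?thesis by (simp add: lborel_prod)
  qed
  show "AE x in lborel. integrable lborel (\<lambda>y. indicator torus_cell (x, y) *\<^sub>R h (snd (x, y)))"
    unfolding eq using i' by simp
  have "integrable lborel (\<lambda>x. indicator {0..2 * pi} x * (\<integral>y. \<bar>indicator {0..2 * pi} y * h y\<bar> \<partial>lborel) :: real)"
    by (intro integrable_mult_left integrable_real_indicator) auto
  then show "integrable lborel (\<lambda>x. \<integral>y. norm (indicator torus_cell (x, y) *\<^sub>R h (snd (x, y))) \<partial>lborel)"
    unfolding eq by (simp add: abs_mult)
qed

lemma Pm_measure: "measure Pm {0..2 * pi} = 2 * pi"
  by (subst measure_restrict_space) auto

lemma x_mode_proj_eq:
  "x_mode_proj k f (x, y) = cis (of_int k * x) * (\<integral>s. f (s, y) * cis (- (of_int k * s)) \<partial>Pm) / (2 * pi)"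
  by (simp add: x_mode_proj_def Pm_integral)

text \<open>Cauchy-Schwarz on almost every line y = const bounds |G y|^2 by 2 pi times the energy of
  that line; integrating over the cell gives a contraction. On the remaining null set of lines
  \<open>G\<close> takes whatever value the integral yields, which affects neither measurability nor
  norms.\<close>

lemma x_mode_proj:
  assumes f: "f \<in> L2_torus"
  shows "x_mode_proj k f \<in> L2_torus" (is ?in)
    and "l2n Tm (x_mode_proj k f) \<le> l2n Tm f" (is ?le)
    and "l \<noteq> k \<Longrightarrow> fcoef (x_mode_proj k f) (l, j) = 0"
proof -
  define G where "G y = (\<integral>s. f (s, y) * cis (- (of_int k * s)) \<partial>Pm)" for y
  have fm [measurable]: "f \<in> borel_measurable borel" and fper: "doubly_periodic f" and fs: "sqi Tm f"
    using f by (auto simp: L2_torus_iff)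
  have fm' [measurable]: "f \<in> borel_measurable (borel \<Otimes>\<^sub>M borel)" by (simp add: borel_prod)
  have cism [measurable]: "(\<lambda>s. cis (c * s)) \<in> borel_measurable borel" for c
    unfolding cis_conv_exp by (intro borel_measurable_continuous_onI continuous_intros)
  have cism' [measurable]: "(\<lambda>s. cis (- (c * s))) \<in> borel_measurable borel" for c
    using cism[of "- c"] by simp
  have proj: "x_mode_proj k f = (\<lambda>z. cis (of_int k * fst z) * G (snd z) / (2 * pi))"
    by (auto simp: fun_eq_iff x_mode_proj_eq G_def)
  have Gm [measurable]: "G \<in> borel_measurable borel"
  proof -
    have "(\<lambda>y. \<integral>s. indicator {0..2 * pi} s *\<^sub>R (f (s, y) * cis (- (of_int k * s))) \<partial>lborel) \<in> borel_measurable borel"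
      by (rule lborel.borel_measurable_lebesgue_integral) measurable
    then show ?thesis by (simp add: G_def[abs_def] Bochner_Integration.integral_restrict_space)
  qed
  have pm: "x_mode_proj k f \<in> borel_measurable borel"
    unfolding proj borel_prod[symmetric] by measurable
  have fy: "(\<lambda>s. f (s, y)) \<in> borel_measurable Pm" for y
    by (rule measurable_restrict_space1) simp
  have I1: "(\<integral>s. (1::real) \<partial>Pm) = 2 * pi" "integrable Pm (\<lambda>s. 1 :: real)"
    by (simp_all add: Pm_measure integrable_restrict_space)
  have cs: "sqi Pm (\<lambda>s. cis (- (of_int k * s)))" "(l2n Pm (\<lambda>s. cis (- (of_int k * s))))\<^sup>2 = 2 * pi"
    using I1 by (auto simp: sqi_def l2n_power2 intro!: measurable_restrict_space1)
  note it = Tm_integral_iterated[OF sqi_integrable[OF fs]]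
  have G2: "AE y in Pm. (cmod (G y))\<^sup>2 \<le> 2 * pi * (\<integral>s. (cmod (f (s, y)))\<^sup>2 \<partial>Pm)"
    using it(1)
  proof eventually_elim
    case (elim y)
    then have s: "sqi Pm (\<lambda>s. f (s, y))" using fy by (simp add: sqi_def)
    have "cmod (G y) \<le> l2n Pm (\<lambda>s. f (s, y)) * l2n Pm (\<lambda>s. cis (- (of_int k * s)))"
      unfolding G_def by (rule l2n_integral_mult_le[OF s cs(1)])
    then have "(cmod (G y))\<^sup>2 \<le> (l2n Pm (\<lambda>s. f (s, y)) * l2n Pm (\<lambda>s. cis (- (of_int k * s))))\<^sup>2"
      by (intro power_mono) auto
    then show ?case unfolding power_mult_distrib cs(2) by (simp add: l2n_power2 mult.commute)
  qed
  have Gi: "integrable Pm (\<lambda>y. (cmod (G y))\<^sup>2)"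
  proof (rule Bochner_Integration.integrable_bound)
    show "integrable Pm (\<lambda>y. 2 * pi * (\<integral>s. (cmod (f (s, y)))\<^sup>2 \<partial>Pm))"
      using it(2) by (rule integrable_mult_right)
    show "(\<lambda>y. (cmod (G y))\<^sup>2) \<in> borel_measurable Pm"
      by (rule measurable_restrict_space1) measurable
    show "AE y in Pm. norm ((cmod (G y))\<^sup>2) \<le> norm (2 * pi * (\<integral>s. (cmod (f (s, y)))\<^sup>2 \<partial>Pm))"
      using G2 by eventually_elim auto
  qed
  have norm_proj: "(cmod (x_mode_proj k f z))\<^sup>2 = (cmod (G (snd z)))\<^sup>2 / (4 * pi\<^sup>2)" for z
    by (simp add: proj norm_mult norm_divide power_divide power_mult_distrib)
  have pi2: "integrable Tm (\<lambda>z. (cmod (x_mode_proj k f z))\<^sup>2)"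
    unfolding norm_proj using integrable_Tm_snd[of "\<lambda>y. (cmod (G y))\<^sup>2", OF _ Gi] by simp
  then have ps: "sqi Tm (x_mode_proj k f)" using pm by (simp add: sqi_def measurable_Tm)
  have "doubly_periodic (x_mode_proj k f)"
    using fper unfolding doubly_periodic_def
    by (simp add: x_mode_proj_eq distrib_left cis_of_int_2pi flip: cis_mult)
  with pm ps show ?in by (simp add: L2_torus_iff)
  have "(l2n Tm (x_mode_proj k f))\<^sup>2 = (\<integral>y. (\<integral>x. (cmod (G y))\<^sup>2 / (4 * pi\<^sup>2) \<partial>Pm) \<partial>Pm)"
    unfolding l2n_power2 Tm_integral_iterated(3)[OF pi2] by (simp only: norm_proj snd_conv)
  also have "\<dots> = (\<integral>y. (cmod (G y))\<^sup>2 / (2 * pi) \<partial>Pm)"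
  proof (intro Bochner_Integration.integral_cong refl)
    fix y
    have "(\<integral>x. (cmod (G y))\<^sup>2 / (4 * pi\<^sup>2) * 1 \<partial>Pm) = (cmod (G y))\<^sup>2 / (4 * pi\<^sup>2) * (\<integral>x. 1 \<partial>Pm)"
      by (rule integral_mult_right_zero)
    also have "(\<integral>x. 1 \<partial>Pm) = 2 * pi" by (rule I1(1))
    finally show "(\<integral>x. (cmod (G y))\<^sup>2 / (4 * pi\<^sup>2) \<partial>Pm) = (cmod (G y))\<^sup>2 / (2 * pi)"
      by (simp only: mult_1_right) (simp add: power2_eq_square)
  qed
  also have "\<dots> \<le> (\<integral>y. (\<integral>s. (cmod (f (s, y)))\<^sup>2 \<partial>Pm) \<partial>Pm)"
  proof (rule integral_mono_AE)
    show "AE y in Pm. (cmod (G y))\<^sup>2 / (2 * pi) \<le> (\<integral>s. (cmod (f (s, y)))\<^sup>2 \<partial>Pm)"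
      using G2 by eventually_elim (simp add: pos_divide_le_eq mult.commute)
  qed (use Gi it(2) in auto)
  also have "\<dots> = (l2n Tm f)\<^sup>2" unfolding l2n_power2 it(3) ..
  finally show ?le by (rule power2_le_imp_le) simp
  assume l: "l \<noteq> k"
  have "(\<integral>z. x_mode_proj k f z * cnj (tch (l, j) z) \<partial>Tm) = (\<integral>y. (\<integral>x. x_mode_proj k f (x, y) * cnj (tch (l, j) (x, y)) \<partial>Pm) \<partial>Pm)"
    by (rule Tm_integral_iterated(3)[OF integrable_mult_cnj_tch[OF ps]])
  also have "\<dots> = (\<integral>y. (\<integral>x. cis (of_int (k - l) * x) * (G y * cis (- (of_int j * y)) / (2 * pi)) \<partial>Pm) \<partial>Pm)"
  proof -
    have "x_mode_proj k f (x, y) * cnj (tch (l, j) (x, y)) = cis (of_int (k - l) * x) * (G y * cis (- (of_int j * y)) / (2 * pi))" for x y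
    proof -
      have "cis (of_int k * x) * cis (- (of_int l * x)) = cis (of_int (k - l) * x)"
        unfolding cis_mult by (simp add: algebra_simps)
      then show ?thesis by (simp add: proj tch_split cis_cnj mult_ac)
    qed
    then show ?thesis by simp
  qed
  also have "\<dots> = 0"
    unfolding integral_mult_left_zero Pm_integral_cis using l by simp
  finally show "fcoef (x_mode_proj k f) (l, j) = 0" by (simp add: fcoef_def)
qed

section \<open>Choice of the resolution scale\<close>

text \<open>The exponent is |n - m|. The tail from m on is a full geometric series, the reversed
  initial part is dominated by a truncated one, and each is at most 1 / (1 - \<rho>).\<close>

lemma two_sided_geometric:
  fixes \<rho> :: real
  assumes "0 \<le> \<rho>" "\<rho> < 1"
  shows "summable (\<lambda>n. \<rho> ^ (if n < m then m - n else n - m))"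
    and "(\<Sum>n. \<rho> ^ (if n < m then m - n else n - m)) \<le> 2 / (1 - \<rho>)"
proof -
  define f where "f n = \<rho> ^ (if n < m then m - n else n - m)" for n
  have tail: "f (n + m) = \<rho> ^ n" for n by (simp add: f_def)
  have g: "summable (\<lambda>n. \<rho> ^ n)" "(\<Sum>n. \<rho> ^ n) = 1 / (1 - \<rho>)"
    using assms by (auto intro: summable_geometric suminf_geometric)
  have sf: "summable f" using g(1) unfolding tail[symmetric] by (simp only: summable_iff_shift)
  have "(\<Sum>n<m. f n) = (\<Sum>n<m. \<rho> ^ Suc n)"
    unfolding sum.nat_diff_reindex[of f m, symmetric] by (intro sum.cong) (auto simp: f_def)
  also have "\<dots> \<le> (\<Sum>n<m. \<rho> ^ n)"
    using assms by (intro sum_mono power_decreasing) auto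
  also have "\<dots> \<le> 1 / (1 - \<rho>)"
    unfolding g(2)[symmetric] using assms by (intro sum_le_suminf g(1)) auto
  finally have "suminf f \<le> 2 / (1 - \<rho>)"
    using suminf_split_initial_segment[OF sf, of m] by (simp add: tail g(2))
  then show "(\<Sum>n. \<rho> ^ (if n < m then m - n else n - m)) \<le> 2 / (1 - \<rho>)" by (simp add: f_def[abs_def])
  show "summable (\<lambda>n. \<rho> ^ (if n < m then m - n else n - m))" using sf by (simp add: f_def[abs_def])
qed

text \<open>In units of s m powr (-1 - \<alpha>), the majorant of the n-th term is 3 powr ((\<alpha>
  - 1) (m - n)) for n < m, from the first argument of the minimum, and 3 powr (-(1 + \<alpha>) (n -
  m)) otherwise, from the second. The first ratio is the larger one and is below 1 because \<alpha>
  < 1, so a single two-sided geometric series dominates both ranges.\<close>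

lemma lacunary_min_sum:
  fixes b :: "nat \<Rightarrow> real" and s :: "nat \<Rightarrow> real"
  assumes \<alpha>: "0 < \<alpha>" "\<alpha> < 1" and s: "\<And>n. s n = 3 ^ Suc n"
    and b: "\<And>n. \<bar>b n\<bar> \<le> C0 * s n powr (- \<alpha>)" and C0: "C0 > 0"
  shows "(\<Sum>n. \<bar>b n\<bar> * min (s n / (s m)\<^sup>2) (1 / s n)) \<le> 2 * C0 / (1 - 3 powr (\<alpha> - 1)) * s m powr (- 1 - \<alpha>)"
proof -
  define \<rho> where "\<rho> = (3::real) powr (\<alpha> - 1)"
  have \<rho>: "0 \<le> \<rho>" "\<rho> < 1" using \<alpha> by (auto simp: \<rho>_def powr_less_one)
  define e where "e n = (if n < m then m - n else n - m)" for n
  note geo = two_sided_geometric[OF \<rho>, of m, folded e_def]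
  have s0: "s n > 0" for n by (simp add: s)
  have rp: "\<rho> ^ n = 3 powr ((\<alpha> - 1) * real n)" for n
    by (simp add: \<rho>_def powr_powr flip: powr_realpow)
  have sp: "s n powr x = 3 powr (real (Suc n) * x)" for n x
  proof -
    have "s n = 3 powr real (Suc n)" unfolding s by (rule powr_realpow[symmetric]) simp
    then show ?thesis by (simp only: powr_powr)
  qed
  have le: "\<bar>b n\<bar> * min (s n / (s m)\<^sup>2) (1 / s n) \<le> C0 * s m powr (- 1 - \<alpha>) * \<rho> ^ e n" for n
  proof -
    have "s n powr (- \<alpha>) * min (s n / (s m)\<^sup>2) (1 / s n) \<le> s m powr (- 1 - \<alpha>) * \<rho> ^ e n"
    proof (cases "n < m")
      case True
      have "s n powr (- \<alpha>) * min (s n / (s m)\<^sup>2) (1 / s n) \<le> s n powr (- \<alpha>) * (s n powr 1 * s m powr (- 2))"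
        using s0[of n] s0[of m] by (intro mult_left_mono) (auto simp: powr_minus_divide)
      also have "\<dots> = 3 powr (real (Suc n) * (- \<alpha>) + (real (Suc n) * 1 + real (Suc m) * (- 2)))"
        unfolding sp powr_add ..
      also have "\<dots> = 3 powr (real (Suc m) * (- 1 - \<alpha>) + (\<alpha> - 1) * real (e n))"
        using True by (intro arg_cong[where f = "\<lambda>x. 3 powr x"]) (simp add: e_def of_nat_diff algebra_simps)
      also have "\<dots> = s m powr (- 1 - \<alpha>) * \<rho> ^ e n" unfolding sp rp powr_add ..
      finally show ?thesis .
    next
      case False
      have "s n powr (- \<alpha>) * min (s n / (s m)\<^sup>2) (1 / s n) \<le> s n powr (- \<alpha>) * s n powr (- 1)"
        using s0[of n] by (intro mult_left_mono) (auto simp: powr_minus_divide)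
      also have "\<dots> = 3 powr (real (Suc n) * (- \<alpha>) + real (Suc n) * (- 1))"
        unfolding sp powr_add ..
      also have "\<dots> \<le> 3 powr (real (Suc m) * (- 1 - \<alpha>) + (\<alpha> - 1) * real (e n))"
      proof (rule powr_mono)
        have "real n = real m + real (e n)" using False by (simp add: e_def of_nat_diff)
        moreover have "0 \<le> \<alpha> * real (e n)" using \<alpha> by simp
        ultimately show "real (Suc n) * (- \<alpha>) + real (Suc n) * (- 1) \<le> real (Suc m) * (- 1 - \<alpha>) + (\<alpha> - 1) * real (e n)"
          by (simp add: algebra_simps)
      qed simp
      also have "\<dots> = s m powr (- 1 - \<alpha>) * \<rho> ^ e n" unfolding sp rp powr_add ..
      finally show ?thesis .
    qed
    from mult_left_mono[OF this, of C0]
    have "C0 * s n powr (- \<alpha>) * min (s n / (s m)\<^sup>2) (1 / s n) \<le> C0 * s m powr (- 1 - \<alpha>) * \<rho> ^ e n"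
      using C0 by (simp add: mult.assoc)
    moreover have "\<bar>b n\<bar> * min (s n / (s m)\<^sup>2) (1 / s n) \<le> C0 * s n powr (- \<alpha>) * min (s n / (s m)\<^sup>2) (1 / s n)"
      using s0[of n] by (intro mult_right_mono b) auto
    ultimately show ?thesis by linarith
  qed
  have sm: "summable (\<lambda>n. C0 * s m powr (- 1 - \<alpha>) * \<rho> ^ e n)"
    by (intro summable_mult geo(1))
  have "(\<Sum>n. \<bar>b n\<bar> * min (s n / (s m)\<^sup>2) (1 / s n)) \<le> (\<Sum>n. C0 * s m powr (- 1 - \<alpha>) * \<rho> ^ e n)"
  proof (rule suminf_le[OF le _ sm])
    show "summable (\<lambda>n. \<bar>b n\<bar> * min (s n / (s m)\<^sup>2) (1 / s n))"
    proof (rule summable_comparison_test'[OF sm, of 0])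
      fix n
      have "0 \<le> \<bar>b n\<bar> * min (s n / (s m)\<^sup>2) (1 / s n)"
        using s0[of n] by (intro mult_nonneg_nonneg) auto
      then show "norm (\<bar>b n\<bar> * min (s n / (s m)\<^sup>2) (1 / s n)) \<le> C0 * s m powr (- 1 - \<alpha>) * \<rho> ^ e n"
        using le[of n] by (simp only: real_norm_def abs_of_nonneg)
    qed
  qed
  also have "\<dots> = C0 * s m powr (- 1 - \<alpha>) * (\<Sum>n. \<rho> ^ e n)"
    by (rule suminf_mult[OF geo(1)])
  also have "\<dots> \<le> C0 * s m powr (- 1 - \<alpha>) * (2 / (1 - \<rho>))"
    using C0 by (intro mult_left_mono geo(2)) auto
  finally show ?thesis by (simp add: \<rho>_def mult_ac)
qed

text \<open>Take the least power of B = 3 powr (\<alpha> + 2) exceeding \<kappa> / \<nu>; it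
  overshoots by at most the factor B <= 27. Since \<kappa> / \<nu> >= 2 exceeds the zeroth power 1,
  the exponent is positive and the scale is one of the frequencies 3, 9, 27, ... of the
  shear.\<close>

lemma resolution_scale:
  fixes \<nu> \<kappa> \<alpha> :: real
  assumes \<alpha>: "0 < \<alpha>" "\<alpha> < 1" and nu: "\<nu> > 0" and \<kappa>: "\<nu> / \<kappa> \<le> 1 / 2" "\<kappa> > 0"
  obtains m where "\<kappa> \<le> \<nu> * (3 ^ Suc m) powr (\<alpha> + 2)" "\<nu> * (3 ^ Suc m) powr (\<alpha> + 2) \<le> 27 * \<kappa>"
proof -
  define B where "B = (3::real) powr (\<alpha> + 2)"
  have "3 powr 1 \<le> B" unfolding B_def using \<alpha> by (intro powr_mono) auto
  then have B1: "B > 1" by simp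
  have "B \<le> 3 powr 3" unfolding B_def using \<alpha> by (intro powr_mono) auto
  then have B27: "B \<le> 27" by simp
  have pw: "(3 ^ n) powr (\<alpha> + 2) = B ^ n" for n
    by (simp add: B_def powr_powr mult.commute flip: powr_realpow)
  define r where "r = \<kappa> / \<nu>"
  have r: "r \<ge> 2" "\<kappa> = \<nu> * r" using nu \<kappa> by (simp_all add: r_def field_simps)
  define n where "n = (LEAST n. r < B ^ n)"
  have ex: "\<exists>n. r < B ^ n" using real_arch_pow[OF B1] by blast
  then have n: "r < B ^ n" unfolding n_def by (rule LeastI_ex)
  have "n \<noteq> 0" using n r by (cases n) auto
  then obtain m where m: "n = Suc m" by (cases n) auto
  have "\<not> r < B ^ m" using not_less_Least[of m "\<lambda>n. r < B ^ n"] m unfolding n_def by simp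
  then have "B ^ n \<le> B * r" using B1 by (simp add: m)
  also have "\<dots> \<le> 27 * r" using B27 r by (intro mult_right_mono) auto
  finally have up: "B ^ n \<le> 27 * r" .
  show thesis
  proof (rule that[of m])
    show "\<kappa> \<le> \<nu> * (3 ^ Suc m) powr (\<alpha> + 2)"
      unfolding pw m[symmetric] r(2) using n nu by (intro mult_left_mono) auto
    show "\<nu> * (3 ^ Suc m) powr (\<alpha> + 2) \<le> 27 * \<kappa>"
      unfolding pw m[symmetric] r(2) using mult_left_mono[OF up, of \<nu>] nu by (simp add: mult_ac)
  qed
qed

text \<open>Raising the bound on |k| to the power 2 / (\<alpha> + 2) produces N^2 and a power of
  \<nu> that completes \<nu> powr (\<alpha> / (\<alpha> + 2)) to \<nu>.\<close>

lemma decay_rate_le: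
  assumes \<alpha>: "0 < \<alpha>" and nu: "\<nu> > 0" and N: "N > 0" and le: "\<bar>of_int k\<bar> \<le> \<nu> * N powr (\<alpha> + 2)"
  shows "decay_rate \<alpha> \<nu> k \<le> \<nu> * N\<^sup>2"
proof -
  have "\<bar>of_int k\<bar> powr (2 / (\<alpha> + 2)) \<le> (\<nu> * N powr (\<alpha> + 2)) powr (2 / (\<alpha> + 2))"
    using le \<alpha> by (intro powr_mono2) auto
  also have "\<dots> = \<nu> powr (2 / (\<alpha> + 2)) * N\<^sup>2"
  proof -
    have ne: "\<alpha> + 2 \<noteq> 0" using \<alpha> by simp
    have eq: "(\<alpha> + 2) * (2 / (\<alpha> + 2)) = 2"
      by (simp only: times_divide_eq_right nonzero_mult_div_cancel_left[OF ne])
    have "(N powr (\<alpha> + 2)) powr (2 / (\<alpha> + 2)) = N\<^sup>2"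
      unfolding powr_powr eq using N by (simp add: powr_numeral)
    then show ?thesis using nu by (simp add: powr_mult)
  qed
  finally have "decay_rate \<alpha> \<nu> k \<le> \<nu> powr (\<alpha> / (\<alpha> + 2)) * (\<nu> powr (2 / (\<alpha> + 2)) * N\<^sup>2)"
    unfolding decay_rate_def by (intro mult_left_mono) auto
  also have "\<dots> = \<nu> powr (\<alpha> / (\<alpha> + 2) + 2 / (\<alpha> + 2)) * N\<^sup>2"
    by (simp add: powr_add)
  also have "\<alpha> / (\<alpha> + 2) + 2 / (\<alpha> + 2) = 1"
    using \<alpha> by (simp flip: add_divide_distrib)
  finally show ?thesis using nu by simp
qed

text \<open>Diffusion \<nu>x >= 0 in x is left open so that both semigroups are instances, with
  \<nu>x = \<nu> and \<nu>x = 0. \<open>K\<close> and \<beta> are constrained by relations free of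
  \<nu>, k and t, which makes the final constants uniform. The rate \<beta>/162 of the quadratic
  functional is halved for the norm, whence 324.\<close>

lemma shear_mode_decay:
  fixes a :: "nat \<Rightarrow> real" and u :: "real \<Rightarrow> real" and \<alpha> C0 :: real
  assumes \<alpha>: "0 < \<alpha>" "\<alpha> < 1" and C0: "C0 > 0"
    and low: "\<And>n. n \<ge> 1 \<Longrightarrow> 3 powr (- (real n * \<alpha>)) \<le> \<bar>a n\<bar>"
    and up: "\<And>n. n \<ge> 1 \<Longrightarrow> \<bar>a n\<bar> \<le> C0 * 3 powr (- (real n * \<alpha>))"
    and u: "\<And>y. u y = (\<Sum>n. a (Suc n) * sin (3 ^ Suc n * y))"
    and K: "K = 2 * C0 / (1 - 3 powr (\<alpha> - 1))"
    and \<beta>: "0 < \<beta>" "\<beta> \<le> 1 / 2" "\<beta> * (2 + 5 / 2 * K)\<^sup>2 \<le> 1 / 27"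
    and nu: "\<nu> > 0" "\<nu>x \<ge> 0" and k: "k \<noteq> 0" "\<nu> / \<bar>of_int k\<bar> \<le> 1 / 2"
    and gen: "generated_by S (drift_diffusion_op \<nu>x \<nu> u)" and t: "t \<ge> 0"
  shows "L2_opnorm (\<lambda>f. S t (x_mode_proj k f)) \<le> ennreal (2 * exp (- (\<beta> / 324) * decay_rate \<alpha> \<nu> k * t))"
proof -
  define b where "b n = a (Suc n)" for n
  define s where "s n = (3::int) ^ Suc n" for n
  have rs: "real_of_int (s n) = 3 ^ Suc n" for n by (simp add: s_def)
  have s0: "s n > 0" for n by (simp add: s_def)
  have spow: "real_of_int (s n) powr x = 3 powr (real (Suc n) * x)" for n x
  proof -
    have "real_of_int (s n) = 3 powr real (Suc n)" unfolding rs by (rule powr_realpow[symmetric]) simp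
    then show ?thesis by (simp only: powr_powr)
  qed
  have bup: "\<bar>b n\<bar> \<le> C0 * real_of_int (s n) powr (- \<alpha>)" for n
    unfolding spow b_def using up[of "Suc n"] by simp
  have blow: "real_of_int (s n) powr (- \<alpha>) \<le> \<bar>b n\<bar>" for n
    unfolding spow b_def using low[of "Suc n"] by simp
  have b: "summable (\<lambda>n. \<bar>b n\<bar>)"
  proof (rule summable_comparison_test'[of "\<lambda>n. C0 * (3 powr (- \<alpha>)) ^ Suc n" 0])
    have "summable (\<lambda>n. (3 powr (- \<alpha>)) ^ n)"
      using \<alpha> by (intro summable_geometric) (simp add: powr_less_one)
    then show "summable (\<lambda>n. C0 * (3 powr (- \<alpha>)) ^ Suc n)"
      by (intro summable_mult) (simp only: summable_Suc_iff)
    fix n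
    have "(3 powr (- \<alpha>)) ^ Suc n = real_of_int (s n) powr (- \<alpha>)"
      unfolding spow by (simp add: powr_powr mult.commute flip: powr_realpow power_Suc)
    then show "norm \<bar>b n\<bar> \<le> C0 * (3 powr (- \<alpha>)) ^ Suc n" using bup[of n] by simp
  qed
  have u': "u y = (\<Sum>n. b n * sin (of_int (s n) * y))" for y
    unfolding u b_def rs ..
  have uc: "continuous_on UNIV u" by (rule shear_continuous[OF b u'])
  have per: "u (y + 2 * pi) = u y" for y by (rule shear_periodic[OF u'])
  have kpos: "\<bar>real_of_int k\<bar> > 0" using k by simp
  obtain m where m: "\<bar>of_int k\<bar> \<le> \<nu> * (3 ^ Suc m) powr (\<alpha> + 2)" "\<nu> * (3 ^ Suc m) powr (\<alpha> + 2) \<le> 27 * \<bar>of_int k\<bar>"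
    by (rule resolution_scale[OF \<alpha> nu(1) k(2) kpos])
  define N where "N = s m"
  have N: "s m = N" "N > 0" using s0 by (auto simp: N_def)
  have mN: "\<bar>of_int k\<bar> \<le> \<nu> * of_int N powr (\<alpha> + 2)" "\<nu> * of_int N powr (\<alpha> + 2) \<le> 27 * \<bar>of_int k\<bar>"
    using m by (simp_all only: N_def rs)
  have sep: "3 * s n \<le> N \<or> 3 * N \<le> s n" if "n \<noteq> m" for n
  proof (cases "n < m")
    case True
    then have "(3::int) ^ Suc (Suc n) \<le> 3 ^ Suc m" by (intro power_increasing) auto
    then show ?thesis by (simp add: s_def N_def)
  next
    case False
    then have "(3::int) ^ Suc (Suc m) \<le> 3 ^ Suc n" using that by (intro power_increasing) auto
    then show ?thesis by (simp add: s_def N_def)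
  qed
  have Npow: "real_of_int N powr (\<alpha> + 2) * real_of_int N powr (- \<alpha>) = (real_of_int N)\<^sup>2"
    "real_of_int N powr (\<alpha> + 2) * real_of_int N powr (- 1 - \<alpha>) = real_of_int N"
    using N by (simp_all add: powr_numeral flip: powr_add)
  \<comment> \<open>\<nu> N^2 is \<nu> N powr (\<alpha> + 2), at most 27 |k|, times N powr
    (-\<alpha>), at most |b m|.\<close>
  have lowN: "\<nu> * (of_int N)\<^sup>2 \<le> 27 * \<bar>of_int k * b m\<bar>"
  proof -
    have "\<nu> * (of_int N)\<^sup>2 = \<nu> * of_int N powr (\<alpha> + 2) * of_int N powr (- \<alpha>)"
      unfolding mult.assoc Npow ..
    also have "\<dots> \<le> 27 * \<bar>of_int k\<bar> * \<bar>b m\<bar>"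
      by (rule mult_mono[OF mN(2) blow[of m, unfolded N(1)]]) auto
    finally show ?thesis by (simp add: abs_mult)
  qed
  have K0: "K \<ge> 0" unfolding K using C0 \<alpha> by (intro divide_nonneg_nonneg) (auto simp: powr_less_one less_imp_le)
  \<comment> \<open>The sum is at most K N powr (-1 - \<alpha>), and |k| <= \<nu> N powr (\<alpha> +
    2) leaves exactly one power of N.\<close>
  have upN: "\<bar>of_int k\<bar> * (\<Sum>n. \<bar>b n\<bar> * min (of_int (s n) / (of_int N)\<^sup>2) (1 / of_int (s n))) \<le> K * \<nu> * of_int N"
  proof -
    have "\<bar>of_int k\<bar> * (\<Sum>n. \<bar>b n\<bar> * min (of_int (s n) / (of_int N)\<^sup>2) (1 / of_int (s n))) \<le> \<bar>of_int k\<bar> * (K * of_int N powr (- 1 - \<alpha>))"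
      using lacunary_min_sum[OF \<alpha> rs bup C0, of m] unfolding K N by (rule mult_left_mono) simp
    also have "\<dots> \<le> \<nu> * of_int N powr (\<alpha> + 2) * (K * of_int N powr (- 1 - \<alpha>))"
      using mN(1) K0 by (intro mult_right_mono) auto
    also have "\<dots> = K * \<nu> * (of_int N powr (\<alpha> + 2) * of_int N powr (- 1 - \<alpha>))" by (simp only: mult_ac)
    finally show ?thesis unfolding Npow .
  qed
  define \<tau> where "\<tau> = \<beta> * sgn (of_int k * b m)"
  have \<tau>: "\<bar>\<tau>\<bar> \<le> 1 / 2"
    using \<beta> by (auto simp: \<tau>_def abs_mult sgn_if)
  define R where "R = \<beta> / 162 * \<nu> * (of_int N)\<^sup>2"
  have decay: "l2n Tm (S t F) \<le> 2 * exp (- (R / 2 * t)) * l2n Tm F"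
    if F: "F \<in> L2_torus" "\<And>l j. l \<noteq> k \<Longrightarrow> fcoef F (l, j) = 0" for F
  proof (rule semigroup_mode_decay[OF gen uc per \<tau> _ _ F t])
    fix f g assume fg: "f \<in> L2_torus" "g \<in> L2_torus" and op: "drift_diffusion_op \<nu>x \<nu> u f g"
    note fs = L2_torus_sqi[OF fg(1)] and gs = L2_torus_sqi[OF fg(2)]
    note dr = drift_diffusion_xmode[OF b u' fs gs op]
    show "2 * lyap \<tau> N (xmode k f) (xmode k g) \<le> - (R * lyap \<tau> N (xmode k f) (xmode k f))"
      using lyap_decay[OF sqi_xmode(1)[OF fs] sqi_xmode(1)[OF gs] dr(1)[of k] b refl s0 N(1) sep nu(1) _ dr(2)[of k]
          lowN upN \<beta> \<tau>_def] nu(2)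
      unfolding R_def by simp
    fix l
    \<comment> \<open>With \<tau> = 0 the shear drops out by skewness, and what remains is minus a
      sum of nonnegative terms.\<close>
    obtain D where "2 * lyap 0 N (xmode l f) (xmode l g) \<le> - 2 * \<nu> * D\<^sup>2 - 2 * (\<nu>x * (of_int l)\<^sup>2) * lyap 0 N (xmode l f) (xmode l f)"
      using lyap_dissipation[OF sqi_xmode(1)[OF fs] sqi_xmode(1)[OF gs] dr(1)[of l] b refl s0 N(1) sep nu(1) dr(2)[of l], of 0]
      by auto
    moreover have "0 \<le> lyap 0 N (xmode l f) (xmode l f)"
      using lyap_diag[OF sqi_xmode(1)[OF fs], of 0 N l] by simp
    then have "0 \<le> 2 * (\<nu>x * (of_int l)\<^sup>2) * lyap 0 N (xmode l f) (xmode l f)" using nu(2) by simp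
    moreover have "0 \<le> 2 * \<nu> * D\<^sup>2" using nu(1) by simp
    ultimately show "lyap 0 N (xmode l f) (xmode l g) \<le> 0" by linarith
  qed
  have rate: "\<beta> / 324 * decay_rate \<alpha> \<nu> k * t \<le> R / 2 * t"
  proof (rule mult_right_mono[OF _ t])
    have "decay_rate \<alpha> \<nu> k \<le> \<nu> * (of_int N)\<^sup>2"
      using N mN(1) by (intro decay_rate_le \<alpha> nu) auto
    then have "\<beta> / 324 * decay_rate \<alpha> \<nu> k \<le> \<beta> / 324 * (\<nu> * (of_int N)\<^sup>2)"
      using \<beta> by (intro mult_left_mono) auto
    then show "\<beta> / 324 * decay_rate \<alpha> \<nu> k \<le> R / 2" by (simp add: R_def)
  qed
  show ?thesis
    unfolding L2_opnorm_def
  proof (rule SUP_least)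
    fix f assume "f \<in> {f \<in> L2_torus. L2_norm f \<le> 1}"
    then have f: "f \<in> L2_torus" "l2n Tm f \<le> 1" by (auto simp: L2_norm_eq)
    have "l2n Tm (S t (x_mode_proj k f)) \<le> 2 * exp (- (R / 2 * t)) * l2n Tm (x_mode_proj k f)"
      by (rule decay[OF x_mode_proj(1)[OF f(1)] x_mode_proj(3)[OF f(1)]])
    also have "\<dots> \<le> 2 * exp (- (R / 2 * t)) * 1"
      using x_mode_proj(2)[OF f(1), of k] f(2) by (intro mult_left_mono) auto
    also have "\<dots> \<le> 2 * exp (- (\<beta> / 324) * decay_rate \<alpha> \<nu> k * t)"
      using rate by simp
    finally show "ennreal (L2_norm (S t (x_mode_proj k f))) \<le> ennreal (2 * exp (- (\<beta> / 324) * decay_rate \<alpha> \<nu> k * t))"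
      unfolding L2_norm_eq by (rule ennreal_leI)
  qed
qed

theorem lemma5p3:
  fixes a :: "nat \<Rightarrow> real" and u :: "real \<Rightarrow> real" and \<alpha> C0 :: real
  assumes "0 < \<alpha>" and "\<alpha> < 1" and "1 < C0"
    and "\<And>n. n \<ge> 1 \<Longrightarrow> 3 powr (- (real n * \<alpha>)) \<le> \<bar>a n\<bar>"
    and "\<And>n. n \<ge> 1 \<Longrightarrow> \<bar>a n\<bar> \<le> C0 * 3 powr (- (real n * \<alpha>))"
    and "\<And>n. n \<ge> 1 \<Longrightarrow> 1 \<le> \<bar>a n\<bar> / \<bar>a (n + 1)\<bar>"
    and "\<And>n. n \<ge> 1 \<Longrightarrow> \<bar>a n\<bar> / \<bar>a (n + 1)\<bar> \<le> 3"
    and "\<And>y. u y = (\<Sum>n. a (Suc n) * sin (3 ^ Suc n * y))"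
  shows "\<exists>\<epsilon> > 0. \<exists>C > 0. \<forall>\<nu> > 0. \<forall>k :: int. k \<noteq> 0 \<and> \<nu> / \<bar>of_int k\<bar> \<le> 1 / 2 \<longrightarrow>
           (\<forall>S. is_S_semigroup u \<nu> S \<longrightarrow>
              (\<forall>t\<ge>0. L2_opnorm (\<lambda>f. S t (x_mode_proj k f))
                       \<le> ennreal (C * exp (- \<epsilon> * decay_rate \<alpha> \<nu> k * t)))) \<and>
           (\<forall>R. is_R_semigroup u \<nu> R \<longrightarrow>
              (\<forall>t\<ge>0. L2_opnorm (\<lambda>f. R t (x_mode_proj k f))
                       \<le> ennreal (C * exp (- \<epsilon> * decay_rate \<alpha> \<nu> k * t))))"
proof -
  define K where "K = 2 * C0 / (1 - 3 powr (\<alpha> - 1))"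
  define Q where "Q = (2 + 5 / 2 * K)\<^sup>2"
  \<comment> \<open>The second argument gives \<beta> Q <= 1/27, as the Young step requires, with Q
    + 1 positive in the denominator; the first is the coercivity bound.\<close>
  define \<beta> where "\<beta> = min (1 / 2) (1 / (27 * (Q + 1)))"
  have Q: "Q \<ge> 0" by (simp add: Q_def)
  have \<beta>: "0 < \<beta>" "\<beta> \<le> 1 / 2" using Q by (auto simp: \<beta>_def)
  have "\<beta> * Q \<le> 1 / (27 * (Q + 1)) * Q" using Q by (intro mult_right_mono) (auto simp: \<beta>_def)
  also have "\<dots> \<le> 1 / 27" using Q by (simp add: divide_simps)
  finally have \<beta>3: "\<beta> * (2 + 5 / 2 * K)\<^sup>2 \<le> 1 / 27" by (simp add: Q_def)
  have C0: "C0 > 0" using assms(3) by simp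
  note main = shear_mode_decay[OF assms(1,2) C0 assms(4,5,8) K_def \<beta> \<beta>3]
  show ?thesis
  proof (rule exI[of _ "\<beta> / 324"], rule conjI, use \<beta> in simp, rule exI[of _ 2], intro conjI allI impI)
    fix \<nu> :: real and k :: int and S t
    assume nu: "\<nu> > 0" and k: "k \<noteq> 0 \<and> \<nu> / \<bar>of_int k\<bar> \<le> 1 / 2" and t: "(0::real) \<le> t"
    show "L2_opnorm (\<lambda>f. S t (x_mode_proj k f)) \<le> ennreal (2 * exp (- (\<beta> / 324) * decay_rate \<alpha> \<nu> k * t))"
      if "is_S_semigroup u \<nu> S"
      by (rule main[OF _ _ nu less_imp_le[OF nu] conjunct1[OF k] conjunct2[OF k] that[unfolded is_S_semigroup_def] t])
    show "L2_opnorm (\<lambda>f. S t (x_mode_proj k f)) \<le> ennreal (2 * exp (- (\<beta> / 324) * decay_rate \<alpha> \<nu> k * t))"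
      if "is_R_semigroup u \<nu> S"
      by (rule main[OF _ _ nu order_refl conjunct1[OF k] conjunct2[OF k] that[unfolded is_R_semigroup_def] t])
  qed (use \<beta> in auto)
qed

end
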